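(* Let $\boldsymbol n=(n_1,n_2,n_3)\in\mathbb Z^3_{\ge1}$, let $\mathcal B_{\boldsymbol n}$ be the corresponding type-I box spline, let $\boldsymbol d=(n_2+n_3-2,\;n_1+n_3-2,\;n_1+n_2-2)$, and let $H$ be a three-directional hierarchical multicell domain, associated to a domain $\Omega\subset\mathbb R^2$ with multicell domains $M^1,\dots,M^N$. If, for each $\ell=1,\dots,N$, the multicell domain $M^\ell$ is admissible with respect to the grid level $\ell$ (that is, with respect to the grid $G^\ell$ and the level-$\ell$ box splines $B^\ell_{\boldsymbol n}$), then the hierarchical box spline basis $K=\bigcup_{\ell=1}^N K^\ell$ spans the hierarchical box spline space $\mathbb S^{\boldsymbol d}(H,\mathcal V_{\boldsymbol n})$.
   Context: Grids. $G^1=G$ is the uniform type-I (three-directional) triangulation of $\mathbb R^2$ with vertex set $\mathbb Z^2$, obtained from the lines $x=k$, $y=k$, $x-y=k$ ($k\in\mathbb Z$), and $G^{\ell+1}=\tfrac12G^\ell$ for $\ell=1,\dots,N-1$ ($N\ge1$), so each triangle of $G^\ell$ is split into four triangles of $G^{\ell+1}$. The directions are $\boldsymbol e_1=(1,0)$, $\boldsymbol e_2=(0,1)$, $\boldsymbol e_3=(1,1)$; an edge has type $i$ if it is parallel to $\boldsymbol e_i$, and $E_i$ denotes the set of type-$i$ edges. Triangles are open sets; $\hat\triangle$ is the set consisting of the triangle $\triangle$, its three edges and its three vertices; $\overline\triangle$ is the topological closure. A multicell domain in $G^\ell$ is a finite union $M=\bigcup_j\hat\triangle_j$ with $\triangle_j$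 triangles of $G^\ell$; $M^*=\bigcup_{\triangle\in M}\overline\triangle$. Box splines. For a real-valued function $\beta$, $\mathrm{supp}(\beta)$ is the set of points $\boldsymbol x$ of its domain with $\beta(\boldsymbol x)\neq0$. $\mathcal B_{(1,1,1)}$ is the Courant hat function: the continuous function on $\mathbb R^2$, affine on each triangle of $G$, with value $1$ at $(1,1)$ and $0$ at every other point of $\mathbb Z^2$. For $\boldsymbol n\in\mathbb Z_{\ge1}^3$, $\mathcal B_{\boldsymbol n}$ is defined recursively by $\mathcal B_{\boldsymbol n}(\boldsymbol x)=\int_0^1\mathcal B_{\boldsymbol n'}(\boldsymbol x-t\boldsymbol e_i)\,dt$, where $\boldsymbol n'$ is $\boldsymbol n$ with $n_i$ replaced by $n_i-1$, for any $i$ with $n_i\ge2$ (independent of the order of the choices of $i$). The space of polynomials in $\mathbb R[x,y]$ whose restrictions to a triangle $\triangle$ of $G$ form the span of the restrictions to $\triangle$ of all translates $\mathcal B_{\boldsymbol n}(\cdot-\boldsymbol v)$, $\boldsymbol v\in\mathbb Z^2$, does not depend on $\triangle$ and is denoted $\mathcal V_{\boldsymbol n}$. Hierarchical domain. $\Omega\subset\mathbb R^2$ is a domain whose boundary is a union of edges of $G^N$, together with a nested sequence $\emptyset=\mathcal M^0\subseteq\mathcal M^1\subseteq\dots\subseteq\mathcal M^N=\Omega$, where $\mathcal M^\ell=\bigcup_{\triangle\in M^\ell}\overline\triangle$ for a multicell domain $M^\ell$ in $G^\ell$, $\ell=1,\dots,N$. Let $\mathcal D^\ell=\overline{\mathcal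 M^\ell\setminus\mathcal M^{\ell-1}}$, let $D^\ell$ be the union of the sets $\hat\triangle$ over the triangles $\triangle$ of $G^\ell$ with $\triangle\subset\mathcal D^\ell$, and $H=\bigcup_{\ell=1}^ND^\ell$, the hierarchical multicell domain associated to $\Omega$. Thus $\Omega=\bigcup_{\triangle\in H}\overline\triangle$. Hierarchical spline space. $\mathbb P(H,\mathcal V_{\boldsymbol n})$ is the set of $f\in C^0(\Omega)$ such that $f|_\triangle$ is the restriction of an element of $\mathcal V_{\boldsymbol n}$ for each triangle $\triangle\in H$. For an edge $\varepsilon\in H$ that is an edge of a triangle of $M^\ell$ (i.e. $\varepsilon$ is an edge of level $\ell$), let $\Diamond(\varepsilon)^*$ be the union of the closures of the (at most two) triangles of $M^\ell$ having $\varepsilon$ as an edge. With $\boldsymbol d=(d_1,d_2,d_3)$, $\mathbb S^{\boldsymbol d}(H,\mathcal V_{\boldsymbol n})$ is the set of $f\in\mathbb P(H,\mathcal V_{\boldsymbol n})$ such that $f$ is $C^{d_i}$ on $\Diamond(\varepsilon)^*$ for every $i\in\{1,2,3\}$ and every edge $\varepsilon\in E_i\cap H$ (i.e. if there are two triangles in $\Diamond(\varepsilon)^*$, all partial derivatives of order $\le d_i$ of the two polynomial pieces agree on $\varepsilon$). Hierarchical basis. $B^1_{\boldsymbol n}=\{\mathcal B_{\boldsymbol n}(\cdot-\boldsymbol v):\boldsymbol v\in\mathbb Z^2\}$ and $B^{\ell+1}_{\boldsymbol n}=\{\beta(2\,\cdot):\beta\in B^\ell_{\boldsymbol n}\}$.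 The active box splines on $M^\ell$ are $B^\ell_{\boldsymbol n}(M^\ell)=\{\beta|_{M^\ell}:\beta\in B^\ell_{\boldsymbol n},\ \mathrm{supp}\,\beta\cap\mathcal M^\ell\ne\emptyset\}$ (restriction to $M^\ell$ meaning restriction to $\mathcal M^\ell$). $K^\ell$ consists of those active box splines $\beta$ of level $\ell$ (i.e. $\beta\in B^\ell_{\boldsymbol n}$ with $\mathrm{supp}\,\beta\cap\mathcal M^\ell\neq\emptyset$) satisfying $\mathrm{supp}\,\beta\cap\mathcal M^{\ell-1}=\emptyset$; the elements of $K=\bigcup_{\ell=1}^NK^\ell$ are regarded as functions on $\Omega$ by restricting the box splines to $\Omega$. Admissibility. A vertex $\nu$ of $G^\ell$ on the boundary of $M^\ell$ is over-concave if, of the six triangles of $G^\ell$ having $\nu$ as a vertex, exactly one is not in $M^\ell$. Two triangles $\triangle,\triangle'\in M^\ell$ are kissing triangles if $\overline\triangle\cap\overline{\triangle'}=\{\nu\}$ for a single vertex $\nu$ of $G^\ell$. $M^\ell$ is admissible with respect to level $\ell$ if the support of every $\beta\in B^\ell_{\boldsymbol n}(M^\ell)$ is a connected set and $M^\ell$ has no over-concave vertices and no kissing triangles. *)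

theory Defs
  imports "HOL-Analysis.Analysis" "HOL-Library.Function_Algebras"
begin

section \<open>The real vector space of functions\<close>

definition fscale :: "real \<Rightarrow> ('a \<Rightarrow> real) \<Rightarrow> ('a \<Rightarrow> real)"
  where "fscale c f = (\<lambda>x. c * f x)"

interpretation fun_vs: vector_space "fscale :: real \<Rightarrow> ('a \<Rightarrow> real) \<Rightarrow> ('a \<Rightarrow> real)"
  by unfold_locales (auto simp: fscale_def fun_eq_iff algebra_simps)


section \<open>Three-directional grids\<close>

type_synonym point = "real \<times> real"

definition dir :: "3 \<Rightarrow> point"
  where "dir i = (if i = 1 then (1, 0) else if i = 2 then (0, 1) else (1, 1))"

definition int_lattice :: "point set"
  where "int_lattice = {(of_int i, of_int j) | i j. True}"

text \<open>The open triangles cut out by the lines \<open>x = k\<close>, \<open>y = k\<close>, \<open>x - y = k\<close>.\<close>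

definition base_triangles :: "point set set"
  where "base_triangles =
    (\<Union>v\<in>int_lattice. {interior (convex hull {v, v + dir 1, v + dir 3}),
                   interior (convex hull {v, v + dir 2, v + dir 3})})"

text \<open>Levels are counted from 1; level \<open>l\<close> is the base grid scaled by \<open>(1/2) ^ (l - 1)\<close>.\<close>

definition grid_vertices :: "nat \<Rightarrow> point set"
  where "grid_vertices l = (\<lambda>v. (1/2) ^ (l - 1) *\<^sub>R v) ` int_lattice"

definition triangles :: "nat \<Rightarrow> point set set"
  where "triangles l = (\<lambda>T. (\<lambda>x. (1/2) ^ (l - 1) *\<^sub>R x) ` T) ` base_triangles"

definition tri_vertices :: "point set \<Rightarrow> point set"
  where "tri_vertices T = {v. v extreme_point_of closure T}"

text \<open>Edges are relatively open segments. A segment determines its length, hence its level, so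
  edges of different levels are different sets.\<close>

definition tri_edges :: "point set \<Rightarrow> point set set"
  where "tri_edges T = {open_segment a b | a b. a \<in> tri_vertices T \<and> b \<in> tri_vertices T \<and> a \<noteq> b}"

definition edge_type :: "3 \<Rightarrow> point set \<Rightarrow> bool"
  where "edge_type i e \<longleftrightarrow> (\<exists>a b c. e = open_segment a b \<and> c \<noteq> 0 \<and> b - a = c *\<^sub>R dir i)"


section \<open>Multicell domains\<close>

text \<open>A multicell domain is a set of cells (triangles, edges, singleton vertices), each of them a
  set of points; \<open>hat T\<close> is the triangle \<open>T\<close> together with its edges and vertices.\<close>

definition hat :: "point set \<Rightarrow> point set set"
  where "hat T = {T} \<union> tri_edges T \<union> {{v} | v. v \<in> tri_vertices T}"

definition multicell :: "nat \<Rightarrow> point set set \<Rightarrow> bool"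
  where "multicell l M \<longleftrightarrow> (\<exists>\<T>. finite \<T> \<and> \<T> \<subseteq> triangles l \<and> M = \<Union> (hat ` \<T>))"

definition all_triangles :: "point set set"
  where "all_triangles = (\<Union>l\<in>{1..}. triangles l)"

definition region :: "point set set \<Rightarrow> point set"
  where "region M = \<Union> (closure ` (M \<inter> all_triangles))"

definition hierarchical_domain :: "nat \<Rightarrow> (nat \<Rightarrow> point set set) \<Rightarrow> point set \<Rightarrow> bool"
  where "hierarchical_domain N M \<Omega> \<longleftrightarrow>
    N \<ge> 1 \<and> M 0 = {} \<and> (\<forall>l\<in>{1..N}. multicell l (M l)) \<and>
    (\<forall>l\<in>{1..N}. region (M (l - 1)) \<subseteq> region (M l)) \<and>
    region (M N) = \<Omega> \<and>
    (\<exists>\<E>. \<E> \<subseteq> \<Union> (tri_edges ` triangles N) \<and> frontier \<Omega> = \<Union> (closure ` \<E>))"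

definition diff_region :: "(nat \<Rightarrow> point set set) \<Rightarrow> nat \<Rightarrow> point set"
  where "diff_region M l = closure (region (M l) - region (M (l - 1)))"

definition diff_cells :: "(nat \<Rightarrow> point set set) \<Rightarrow> nat \<Rightarrow> point set set"
  where "diff_cells M l = \<Union> (hat ` {T \<in> triangles l. T \<subseteq> diff_region M l})"

definition hier_cells :: "nat \<Rightarrow> (nat \<Rightarrow> point set set) \<Rightarrow> point set set"
  where "hier_cells N M = (\<Union>l\<in>{1..N}. diff_cells M l)"


section \<open>Box splines\<close>

definition affine_on :: "point set \<Rightarrow> (point \<Rightarrow> real) \<Rightarrow> bool"
  where "affine_on T f \<longleftrightarrow> (\<exists>a b c. \<forall>(x, y)\<in>T. f (x, y) = a * x + b * y + c)"

definition is_courant_hat :: "(point \<Rightarrow> real) \<Rightarrow> bool"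
  where "is_courant_hat f \<longleftrightarrow>
    continuous_on UNIV f \<and> (\<forall>T\<in>base_triangles. affine_on T f) \<and>
    f (1, 1) = 1 \<and> (\<forall>v\<in>int_lattice - {(1, 1)}. f v = 0)"

definition courant_hat :: "point \<Rightarrow> real"
  where "courant_hat = (THE f. is_courant_hat f)"

definition dir_avg :: "point \<Rightarrow> (point \<Rightarrow> real) \<Rightarrow> point \<Rightarrow> real"
  where "dir_avg u f = (\<lambda>x. integral {0..1} (\<lambda>t. f (x - t *\<^sub>R u)))"

text \<open>The recursion, run in a fixed order of directions; \<open>box_spline_rec\<close> below shows that it
  holds in every direction. Meant for multiplicities \<open>n $ i \<ge> 1\<close>.\<close>

definition box_spline :: "nat ^ 3 \<Rightarrow> point \<Rightarrow> real"
  where "box_spline n =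
    (dir_avg (dir 1) ^^ (n $ 1 - 1)) ((dir_avg (dir 2) ^^ (n $ 2 - 1))
      ((dir_avg (dir 3) ^^ (n $ 3 - 1)) courant_hat))"

definition box_splines :: "nat ^ 3 \<Rightarrow> nat \<Rightarrow> (point \<Rightarrow> real) set"
  where "box_splines n l = {\<lambda>x. box_spline n (2 ^ (l - 1) *\<^sub>R x - v) | v. v \<in> int_lattice}"

text \<open>Bivariate polynomials are represented by polynomial functions. The condition on \<open>p\<close> holds
  for one triangle \<open>T\<close> iff it holds for all of them.\<close>

definition local_polys :: "nat ^ 3 \<Rightarrow> (point \<Rightarrow> real) set"
  where "local_polys n =
    {p. real_polynomial_function p \<and>
        (\<forall>T\<in>base_triangles. \<exists>g\<in>fun_vs.span (box_splines n 1). \<forall>x\<in>T. p x = g x)}"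


section \<open>Hierarchical spline space\<close>

definition pderiv_x :: "(point \<Rightarrow> real) \<Rightarrow> point \<Rightarrow> real"
  where "pderiv_x f = (\<lambda>(x, y). deriv (\<lambda>s. f (s, y)) x)"

definition pderiv_y :: "(point \<Rightarrow> real) \<Rightarrow> point \<Rightarrow> real"
  where "pderiv_y f = (\<lambda>(x, y). deriv (\<lambda>s. f (x, s)) y)"

definition contact :: "nat \<Rightarrow> (point \<Rightarrow> real) \<Rightarrow> point set \<Rightarrow> point set \<Rightarrow> point set \<Rightarrow> bool"
  where "contact k f T T' e \<longleftrightarrow>
    (\<exists>p p'. real_polynomial_function p \<and> real_polynomial_function p' \<and>
       (\<forall>x\<in>T. f x = p x) \<and> (\<forall>x\<in>T'. f x = p' x) \<and>
       (\<forall>i j. i + j \<le> k \<longrightarrow>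
          (\<forall>x\<in>e. (pderiv_x ^^ i) ((pderiv_y ^^ j) p) x = (pderiv_x ^^ i) ((pderiv_y ^^ j) p') x)))"

text \<open>Functions on \<open>\<Omega>\<close> are represented by functions on the plane that vanish outside \<open>\<Omega>\<close>.\<close>

definition restr :: "point set \<Rightarrow> (point \<Rightarrow> real) \<Rightarrow> point \<Rightarrow> real"
  where "restr \<Omega> f = (\<lambda>x. if x \<in> \<Omega> then f x else 0)"

definition piecewise_polys ::
    "point set \<Rightarrow> point set set \<Rightarrow> (point \<Rightarrow> real) set \<Rightarrow> (point \<Rightarrow> real) set"
  where "piecewise_polys \<Omega> H V =
    {f. (\<forall>x. x \<notin> \<Omega> \<longrightarrow> f x = 0) \<and> continuous_on \<Omega> f \<and>
        (\<forall>T \<in> H \<inter> all_triangles. \<exists>p\<in>V. \<forall>x\<in>T. f x = p x)}"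

text \<open>At an edge of level \<open>l\<close> the contact condition is imposed on the two adjacent triangles of
  \<open>M l\<close>, which need not be cells of the hierarchical domain: one of them may be part of a triangle
  of a coarser level.\<close>

definition spline_space ::
    "nat ^ 3 \<Rightarrow> nat \<Rightarrow> (nat \<Rightarrow> point set set) \<Rightarrow> (point \<Rightarrow> real) set \<Rightarrow> (point \<Rightarrow> real) set"
  where "spline_space d N M V =
    {f \<in> piecewise_polys (region (M N)) (hier_cells N M) V.
       \<forall>i. \<forall>e \<in> hier_cells N M. edge_type i e \<longrightarrow>
         (\<forall>l\<in>{1..N}. \<forall>T \<in> M l \<inter> triangles l. \<forall>T' \<in> M l \<inter> triangles l.
            T \<noteq> T' \<and> e \<in> tri_edges T \<and> e \<in> tri_edges T' \<longrightarrow> contact (d $ i) f T T' e)}"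


section \<open>Hierarchical basis\<close>

definition active :: "nat ^ 3 \<Rightarrow> nat \<Rightarrow> point set set \<Rightarrow> (point \<Rightarrow> real) set"
  where "active n l M = {\<beta> \<in> box_splines n l. support_on UNIV \<beta> \<inter> region M \<noteq> {}}"

definition hier_basis_level ::
    "nat ^ 3 \<Rightarrow> (nat \<Rightarrow> point set set) \<Rightarrow> nat \<Rightarrow> (point \<Rightarrow> real) set"
  where "hier_basis_level n M l =
    {\<beta> \<in> active n l (M l). support_on UNIV \<beta> \<inter> region (M (l - 1)) = {}}"

definition hier_basis ::
    "nat ^ 3 \<Rightarrow> nat \<Rightarrow> (nat \<Rightarrow> point set set) \<Rightarrow> (point \<Rightarrow> real) set"
  where "hier_basis n N M = (\<Union>l\<in>{1..N}. restr (region (M N)) ` hier_basis_level n M l)"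


section \<open>Admissibility\<close>

definition over_concave :: "nat \<Rightarrow> point set set \<Rightarrow> point \<Rightarrow> bool"
  where "over_concave l M v \<longleftrightarrow>
    v \<in> grid_vertices l \<and> v \<in> frontier (region M) \<and>
    card {T \<in> triangles l. v \<in> tri_vertices T \<and> T \<notin> M} = 1"

definition linked_at :: "nat \<Rightarrow> point set set \<Rightarrow> point \<Rightarrow> (point set \<times> point set) set"
  where "linked_at l M v =
    {(A, B). A \<in> M \<inter> triangles l \<and> B \<in> M \<inter> triangles l \<and>
             v \<in> tri_vertices A \<and> v \<in> tri_vertices B \<and> tri_edges A \<inter> tri_edges B \<noteq> {}}"

text \<open>Two triangles that meet only in a vertex \<open>v\<close> kiss unless they are linked, around \<open>v\<close>, by a
  chain of triangles of \<open>M\<close> consecutive ones of which share an edge. Without the proviso any three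
  consecutive triangles around a vertex would contain a kissing pair, and so would the four
  subtriangles of any refined triangle.\<close>

definition kissing :: "nat \<Rightarrow> point set set \<Rightarrow> point set \<Rightarrow> point set \<Rightarrow> bool"
  where "kissing l M T T' \<longleftrightarrow>
    T \<in> M \<inter> triangles l \<and> T' \<in> M \<inter> triangles l \<and>
    (\<exists>v\<in>grid_vertices l. closure T \<inter> closure T' = {v} \<and> (T, T') \<notin> (linked_at l M v)\<^sup>*)"

lemma kissing_touch:
  assumes "kissing l M T T'"
  shows "\<exists>v\<in>grid_vertices l. closure T \<inter> closure T' = {v}"
  using assms by (auto simp: kissing_def)

definition admissible :: "nat ^ 3 \<Rightarrow> nat \<Rightarrow> point set set \<Rightarrow> bool"
  where "admissible n l M \<longleftrightarrow>
    (\<forall>\<beta> \<in> active n l M. connected (support_on (region M) \<beta>)) \<and>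
    (\<nexists>v. over_concave l M v) \<and> (\<nexists>T T'. kissing l M T T')"


section \<open>Well-definedness of the Courant hat function and recursion for box splines\<close>

definition courant_formula :: "point \<Rightarrow> real"
  where "courant_formula = (\<lambda>(x, y). max 0 (1 - max \<bar>x - 1\<bar> (max \<bar>y - 1\<bar> \<bar>x - y\<bar>)))"

lemma base_triangle_closure:
  assumes "T \<in> base_triangles"
  obtains v u where "v \<in> int_lattice" "u = dir 1 \<or> u = dir 2"
    "T \<subseteq> convex hull {v, v + u, v + dir 3}" "closure T = convex hull {v, v + u, v + dir 3}"
proof -
  obtain v u where v: "v \<in> int_lattice" "u = dir 1 \<or> u = dir 2"
    and T: "T = interior (convex hull {v, v + u, v + dir 3})"
  proof -
    from assms obtain v where "v \<in> int_lattice" "T = interior (convex hull {v, v + dir 1, v + dir 3})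
        \<or> T = interior (convex hull {v, v + dir 2, v + dir 3})"
      unfolding base_triangles_def by blast
    thus ?thesis using that by blast
  qed
  let ?S = "{v, v + u, v + dir 3}"
  have nc: "\<not> collinear ?S"
  proof
    assume "collinear ?S"
    hence "collinear {0, u, dir 3}"
      by (subst (asm) insert_commute) (simp add: collinear_3)
    thus False using v(2)
      unfolding collinear_lemma by (auto simp: dir_def zero_prod_def)
  qed
  have "DIM(point) = 2" by simp
  from interior_convex_hull_3_minimal[OF nc this]
  have "(1/3) *\<^sub>R v + (1/3) *\<^sub>R (v + u) + (1/3) *\<^sub>R (v + dir 3) \<in> interior (convex hull ?S)"
    by (auto intro!: exI[of _ "1/3"])
  hence "interior (convex hull ?S) \<noteq> {}" by blast
  moreover have "closed (convex hull ?S)"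
    by (simp add: compact_convex_hull compact_imp_closed)
  ultimately have "closure T = convex hull ?S"
    unfolding T by (simp add: convex_closure_interior convex_convex_hull)
  moreover have "T \<subseteq> convex hull ?S" unfolding T by (rule interior_subset)
  ultimately show ?thesis using that v by blast
qed

lemma courant_formula_zero:
  assumes "x \<le> 0 \<or> 2 \<le> x \<or> y \<le> 0 \<or> 2 \<le> y"
  shows "courant_formula (x, y) = 0"
proof -
  have "1 \<le> \<bar>x - 1\<bar> \<or> 1 \<le> \<bar>y - 1\<bar>"
    using assms by (auto simp: abs_if)
  hence "1 \<le> max \<bar>x - 1\<bar> (max \<bar>y - 1\<bar> \<bar>x - y\<bar>)"
    by (meson max.coboundedI1 max.coboundedI2)
  hence "1 - max \<bar>x - 1\<bar> (max \<bar>y - 1\<bar> \<bar>x - y\<bar>) \<le> 0"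
    by (simp only: diff_le_0_iff_le)
  thus ?thesis unfolding courant_formula_def prod.case by (rule max_absorb1)
qed

lemma courant_formula_interp:
  fixes i j :: int and s t :: real
  assumes st: "0 \<le> t" "t \<le> s" "s \<le> 1"
  shows "courant_formula (of_int i + s, of_int j + t) =
      (1 - s) * courant_formula (of_int i, of_int j)
    + (s - t) * courant_formula (of_int i + 1, of_int j)
    + t * courant_formula (of_int i + 1, of_int j + 1)"
    (is ?A)
    and "courant_formula (of_int i + t, of_int j + s) =
      (1 - s) * courant_formula (of_int i, of_int j)
    + (s - t) * courant_formula (of_int i, of_int j + 1)
    + t * courant_formula (of_int i + 1, of_int j + 1)"
    (is ?B)
proof -
  have zero: "?A \<and> ?B"
    if "real_of_int i \<le> -1 \<or> real_of_int i \<ge> 2 \<or> real_of_int j \<le> -1 \<or> real_of_int j \<ge> 2"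
    using that st by (elim disjE) (simp_all add: courant_formula_zero)
  have vals: "courant_formula (0, 0) = 0" "courant_formula (0, 1) = 0"
      "courant_formula (1, 0) = 0" "courant_formula (0, 2) = 0" "courant_formula (2, 0) = 0"
      "courant_formula (1, 2) = 0" "courant_formula (2, 1) = 0" "courant_formula (2, 2) = 0"
      "courant_formula (1, 1) = 1"
    by (simp_all add: courant_formula_def)
  consider "i \<le> -1 \<or> i \<ge> 2 \<or> j \<le> -1 \<or> j \<ge> 2"
    | "i = 0" "j = 0" | "i = 0" "j = 1" | "i = 1" "j = 0" | "i = 1" "j = 1"
    by fastforce
  hence "?A \<and> ?B"
  proof cases
    case 1
    thus ?thesis by (intro zero) (elim disjE; simp)
  next
    case 2
    have "courant_formula (s, t) = t" "courant_formula (t, s) = t"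
      using st by (auto simp: courant_formula_def)
    thus ?thesis by (simp add: 2 vals)
  next
    case 3
    have "courant_formula (s, 1 + t) = s - t" "courant_formula (t, 1 + s) = 0"
      using st by (auto simp: courant_formula_def)
    thus ?thesis by (simp add: 3 vals)
  next
    case 4
    have "courant_formula (1 + s, t) = 0" "courant_formula (1 + t, s) = s - t"
      using st by (auto simp: courant_formula_def)
    thus ?thesis by (simp add: 4 vals)
  next
    case 5
    have "courant_formula (1 + s, 1 + t) = 1 - s" "courant_formula (1 + t, 1 + s) = 1 - s"
      using st by (auto simp: courant_formula_def)
    thus ?thesis by (simp add: 5 vals)
  qed
  thus ?A ?B by auto
qed

lemma hull_coords:
  assumes "z \<in> convex hull {v, v + u, v + dir 3}" "u = dir 1 \<or> u = dir 2"
  obtains s t :: real where "0 \<le> t" "t \<le> s" "s \<le> 1" "z = v + (s - t) *\<^sub>R u + t *\<^sub>R dir 3"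
proof -
  obtain a b where "0 \<le> a" "0 \<le> b" "a + b \<le> 1" "z = v + a *\<^sub>R u + b *\<^sub>R dir 3"
    using assms by (auto simp: convex_hull_3_alt)
  thus ?thesis using that[of b "a + b"] by auto
qed

lemma courant_formula_int:
  assumes "v \<in> int_lattice - {(1, 1)}"
  shows "courant_formula v = 0"
proof -
  obtain i j :: int where v: "v = (of_int i, of_int j)" and "\<not> (i = 1 \<and> j = 1)"
    using assms by (auto simp: int_lattice_def)
  hence "i \<le> 0 \<or> 2 \<le> i \<or> j \<le> 0 \<or> 2 \<le> j" by fastforce
  hence "real_of_int i \<le> 0 \<or> 2 \<le> real_of_int i \<or> real_of_int j \<le> 0 \<or> 2 \<le> real_of_int j"
    by (elim disjE; simp)
  thus ?thesis unfolding v by (rule courant_formula_zero)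
qed

lemma is_courant_hat_formula: "is_courant_hat courant_formula"
  unfolding is_courant_hat_def
proof (intro conjI ballI)
  show "continuous_on UNIV courant_formula"
    unfolding courant_formula_def case_prod_beta by (intro continuous_intros)
next
  fix T assume "T \<in> base_triangles"
  then obtain v u where v: "v \<in> int_lattice" "u = dir 1 \<or> u = dir 2"
    and T: "T \<subseteq> convex hull {v, v + u, v + dir 3}"
    by (rule base_triangle_closure)
  obtain i j :: int where ij: "v = (of_int i, of_int j)" using v(1) by (auto simp: int_lattice_def)
  let ?c = courant_formula
  define A B C where "A = ?c v" and "B = ?c (v + u)" and "C = ?c (v + dir 3)"
  have *: "?c (v + (s - t) *\<^sub>R u + t *\<^sub>R dir 3) = (1 - s) * A + (s - t) * B + t * C"
    if "0 \<le> t" "t \<le> s" "s \<le> 1" for s t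
    using v(2) courant_formula_interp[OF that, of i j]
    by (auto simp: ij dir_def A_def B_def C_def algebra_simps)
  have "\<exists>a b c. \<forall>z\<in>T. ?c z = a * fst z + b * snd z + c"
  proof (cases "u = dir 1")
    case True
    show ?thesis
    proof (intro exI ballI)
      fix z assume "z \<in> T"
      then obtain s t where "0 \<le> t" "t \<le> s" "s \<le> 1" and z: "z = v + (s - t) *\<^sub>R u + t *\<^sub>R dir 3"
        using hull_coords[OF subsetD[OF T \<open>z \<in> T\<close>] v(2)] by metis
      hence "?c z = (1 - s) * A + (s - t) * B + t * C" using * by simp
      also have "\<dots> = (B - A) * fst z + (C - B) * snd z + (A - (B - A) * i - (C - B) * j)"
        by (simp add: z ij True dir_def algebra_simps)
      finally show "?c z = (B - A) * fst z + (C - B) * snd z + (A - (B - A) * i - (C - B) * j)" .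
    qed
  next
    case False
    hence u: "u = dir 2" using v by auto
    show ?thesis
    proof (intro exI ballI)
      fix z assume "z \<in> T"
      then obtain s t where "0 \<le> t" "t \<le> s" "s \<le> 1" and z: "z = v + (s - t) *\<^sub>R u + t *\<^sub>R dir 3"
        using hull_coords[OF subsetD[OF T \<open>z \<in> T\<close>] v(2)] by metis
      hence "?c z = (1 - s) * A + (s - t) * B + t * C" using * by simp
      also have "\<dots> = (C - B) * fst z + (B - A) * snd z + (A - (C - B) * i - (B - A) * j)"
        by (simp add: z ij u dir_def algebra_simps)
      finally show "?c z = (C - B) * fst z + (B - A) * snd z + (A - (C - B) * i - (B - A) * j)" .
    qed
  qed
  thus "affine_on T ?c" unfolding affine_on_def by fastforce
next
  show "courant_formula (1, 1) = 1" by (simp add: courant_formula_def)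
  show "courant_formula v = 0" if "v \<in> int_lattice - {(1, 1)}" for v
    using that by (rule courant_formula_int)
qed

lemma is_courant_hat_unique:
  assumes f: "is_courant_hat f" and g: "is_courant_hat g"
  shows "f = g"
proof
  fix z :: point
  define i j where "i = \<lfloor>fst z\<rfloor>" and "j = \<lfloor>snd z\<rfloor>"
  define v :: point where "v = (of_int i, of_int j)"
  define p q where "p = fst z - i" and "q = snd z - j"
  have pq: "0 \<le> p" "p \<le> 1" "0 \<le> q" "q \<le> 1"
    unfolding p_def q_def i_def j_def by linarith+
  have z: "z = v + (p, q)" by (simp add: p_def q_def v_def prod_eq_iff)
  have v: "v \<in> int_lattice" by (auto simp: v_def int_lattice_def)
  obtain u where u: "u = dir 1 \<or> u = dir 2" and zin: "z \<in> convex hull {v, v + u, v + dir 3}"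
  proof (cases "q \<le> p")
    case True
    have "z = v + (p - q) *\<^sub>R (v + dir 1 - v) + q *\<^sub>R (v + dir 3 - v)" by (simp add: z dir_def)
    thus ?thesis using that[of "dir 1"] True pq unfolding convex_hull_3_alt
      by (smt (verit, best) mem_Collect_eq)
  next
    case False
    have "z = v + (q - p) *\<^sub>R (v + dir 2 - v) + p *\<^sub>R (v + dir 3 - v)" by (simp add: z dir_def)
    thus ?thesis using that[of "dir 2"] False pq unfolding convex_hull_3_alt
      by (smt (verit, best) mem_Collect_eq)
  qed
  define T where "T = interior (convex hull {v, v + u, v + dir 3})"
  have T: "T \<in> base_triangles" using v u by (auto simp: base_triangles_def T_def)
  have clT: "closure T = convex hull {v, v + u, v + dir 3}"
  proof -
    have "interior (convex hull {v, v + u, v + dir 3}) \<noteq> {}"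
    proof
      assume "interior (convex hull {v, v + u, v + dir 3}) = {}"
      hence "T = {}" by (simp add: T_def)
      thus False using base_triangle_closure[OF T]
        by (metis closure_empty convex_hull_eq_empty insert_not_empty)
    qed
    moreover have "closed (convex hull {v, v + u, v + dir 3})"
      by (simp add: compact_convex_hull compact_imp_closed)
    ultimately show ?thesis
      unfolding T_def by (simp add: convex_closure_interior convex_convex_hull)
  qed
  obtain a b c where fa: "\<forall>(x, y)\<in>T. f (x, y) = a * x + b * y + c"
    using f T by (auto simp: is_courant_hat_def affine_on_def)
  obtain a' b' c' where ga: "\<forall>(x, y)\<in>T. g (x, y) = a' * x + b' * y + c'"
    using g T by (auto simp: is_courant_hat_def affine_on_def)
  define h where "h = (\<lambda>x. f x - g x)"
  define A B C where "A = a - a'" and "B = b - b'" and "C = c - c'"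
  have cont: "continuous_on UNIV h"
    using f g unfolding h_def is_courant_hat_def by (intro continuous_intros) auto
  have "h x - (A * fst x + B * snd x + C) = 0" if "x \<in> closure T" for x
  proof (rule continuous_constant_on_closure[OF _ _ that])
    show "continuous_on (closure T) (\<lambda>x. h x - (A * fst x + B * snd x + C))"
      by (intro continuous_intros continuous_on_subset[OF cont]) auto
    fix x assume "x \<in> T"
    thus "h x - (A * fst x + B * snd x + C) = 0"
      using bspec[OF fa, of x] bspec[OF ga, of x]
      by (cases x) (auto simp: h_def A_def B_def C_def algebra_simps)
  qed
  hence h: "h x = A * fst x + B * snd x + C" if "x \<in> convex hull {v, v + u, v + dir 3}" for x
    using that clT by fastforce
  have h0: "h x = 0" if "x \<in> int_lattice" for x
    using that f g by (cases "x = (1, 1)") (auto simp: h_def is_courant_hat_def)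
  have "v + u \<in> int_lattice" "v + dir 3 \<in> int_lattice"
    using u by (auto simp: v_def int_lattice_def dir_def intro: exI[of _ "_ + 1"])
      (metis of_int_1 of_int_add)+
  hence "h v = 0" "h (v + u) = 0" "h (v + dir 3) = 0" using v h0 by auto
  hence vals: "A * fst v + B * snd v + C = 0" "A * fst (v + u) + B * snd (v + u) + C = 0"
      "A * fst (v + dir 3) + B * snd (v + dir 3) + C = 0"
    using h by (simp_all add: hull_inc)
  hence "A = 0 \<and> B = 0 \<and> C = 0"
    using u by (auto simp: dir_def algebra_simps)
  hence "h z = 0" using h[OF zin] by simp
  thus "f z = g z" by (simp add: h_def)
qed

lemma is_courant_hat_courant_hat: "is_courant_hat courant_hat"
  unfolding courant_hat_def
  by (rule theI[of is_courant_hat]) (auto intro: is_courant_hat_formula is_courant_hat_unique)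

lemma courant_hat_eq: "courant_hat = courant_formula"
  by (rule is_courant_hat_unique[OF is_courant_hat_courant_hat is_courant_hat_formula])

lemma continuous_courant_hat: "continuous_on UNIV courant_hat"
  using is_courant_hat_courant_hat by (simp add: is_courant_hat_def)

lemma continuous_dir_avg:
  assumes "continuous_on UNIV f"
  shows "continuous_on UNIV (dir_avg u f)"
proof -
  have "continuous_on (UNIV \<times> cbox 0 1) (\<lambda>(x, t). f (x - t *\<^sub>R u))"
    unfolding case_prod_beta
    by (rule continuous_on_compose2[OF assms]) (auto intro!: continuous_intros)
  from integral_continuous_on_param[OF this] show ?thesis
    by (simp add: dir_avg_def)
qed

lemma dir_avg_commute:
  assumes "continuous_on UNIV f"
  shows "dir_avg u (dir_avg w f) = dir_avg w (dir_avg u f)"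
proof
  fix x :: point
  have "continuous_on (cbox (0, 0) (1, 1)) (\<lambda>(s, t). f (x - s *\<^sub>R u - t *\<^sub>R w))"
    unfolding case_prod_beta
    by (rule continuous_on_compose2[OF assms]) (auto intro!: continuous_intros)
  from integral_swap_continuous[OF this]
  show "dir_avg u (dir_avg w f) x = dir_avg w (dir_avg u f) x"
    by (simp add: dir_avg_def algebra_simps)
qed

lemma continuous_dir_avg_funpow:
  assumes "continuous_on UNIV f"
  shows "continuous_on UNIV ((dir_avg u ^^ k) f)"
  by (induction k) (auto intro: assms continuous_dir_avg)

lemma dir_avg_funpow_commute:
  assumes "continuous_on UNIV f"
  shows "(dir_avg u ^^ k) (dir_avg w f) = dir_avg w ((dir_avg u ^^ k) f)"
  by (induction k) (auto simp: dir_avg_commute continuous_dir_avg_funpow assms)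

lemma box_spline_one:
  assumes "\<forall>i. n $ i = 1"
  shows "box_spline n = courant_hat"
  using assms by (simp add: box_spline_def)

lemma box_spline_rec:
  assumes "2 \<le> n $ i"
  shows "box_spline n x = integral {0..1} (\<lambda>t. box_spline (n - axis i 1) (x - t *\<^sub>R dir i))"
proof -
  have pow: "(dir_avg u ^^ (n $ i - 1)) f = dir_avg u ((dir_avg u ^^ (n $ i - 1 - 1)) f)" for u f
  proof -
    have "n $ i - 1 = Suc (n $ i - 1 - 1)" using assms by simp
    thus ?thesis by (metis comp_apply funpow.simps(2))
  qed
  note cont = continuous_courant_hat continuous_dir_avg_funpow
  consider "i = 1" | "i = 2" | "i = 3" using exhaust_3 by blast
  hence "box_spline n = dir_avg (dir i) (box_spline (n - axis i 1))"
  proof cases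
    case 1
    thus ?thesis using pow by (simp add: box_spline_def axis_def)
  next
    case 2
    thus ?thesis using pow by (simp add: box_spline_def axis_def dir_avg_funpow_commute cont)
  next
    case 3
    thus ?thesis using pow by (simp add: box_spline_def axis_def dir_avg_funpow_commute cont)
  qed
  thus ?thesis by (simp add: dir_avg_def)
qed

end

theory Submission
  imports Defs
begin

text \<open>On a triangle the pieces of the level box splines span the joint kernel of the operators
  \<open>D_i^(n_i) D_j^(n_j)\<close>, \<open>i \<noteq> j\<close>, which is invariant under scaling. Differentiation along
  \<open>dir k\<close> lowers \<open>n_k\<close> and turns the coefficients \<open>c v\<close> of a spline into the differences
  \<open>c v - c (v - dir k)\<close>; by induction on \<open>n\<close>, contact of order \<open>d_i\<close> of two pieces along an
  edge of type \<open>i\<close> forces their coefficients to agree on all box splines that are nonzero on both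
  sides. Hence the local coefficients of a function in the spline space propagate through the
  connected support of every active box spline, as there are no kissing triangles, and the function
  is a spline on the whole region of a level. Subtracting, level by level, the spline found on the
  current region leaves a function that vanishes there; by local linear independence its next
  expansion only involves box splines whose supports avoid that region.\<close>

section \<open>Directional derivatives of polynomial functions\<close>

text \<open>The pieces allowed on every level are those of the unscaled box splines, so a coarse
  spline has to be recognised on finer triangles. No refinement equation is used for this: the
  kernel is stable under \<open>z \<mapsto> r z + a\<close>, and both inclusions rely on that. The
  obstacle lies in the induction on \<open>n\<close>. A function is recovered from directional
  derivatives only if two of them are known. When a single multiplicity n_k exceeds 1, only D_k is
  available, and it does not see the condition D_i D_j p = 0 for the other two directions. Hence a
  recurring dichotomy: with two raised directions integrate along both; with one use an explicit
  description, namely differences of univariate ramps for the pieces and coefficients depending on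
  one linear form for the edges. The number d_i is what survives the induction: a derivative
  transverse to an edge costs one order of contact and a derivative along it none, just as d_i drops
  by one when a transverse multiplicity is lowered and stays fixed when n_i is.\<close>

abbreviation poly2 :: "(point \<Rightarrow> real) \<Rightarrow> bool"
  where "poly2 \<equiv> real_polynomial_function"

lemmas poly2_linear = real_polynomial_function.intros(1)
  and poly2_const = real_polynomial_function.intros(2)
  and poly2_add = real_polynomial_function.intros(3)
  and poly2_mult = real_polynomial_function.intros(4)

text \<open>Differentiability along one line only: a box spline with \<open>n $ k \<ge> 2\<close>
  has a derivative along \<open>dir k\<close> everywhere, but may have kinks in transverse
  directions, so a Frechet derivative would be too much to ask.\<close>

definition has_dird :: "(point \<Rightarrow> real) \<Rightarrow> point \<Rightarrow> real \<Rightarrow> point \<Rightarrow> bool"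
  where "has_dird f u D z \<longleftrightarrow> ((\<lambda>h. f (z + h *\<^sub>R u)) has_real_derivative D) (at 0)"

definition dird :: "point \<Rightarrow> (point \<Rightarrow> real) \<Rightarrow> point \<Rightarrow> real"
  where "dird u f = (\<lambda>z. deriv (\<lambda>h. f (z + h *\<^sub>R u)) 0)"

lemma has_dird_imp_dird: "has_dird f u D z \<Longrightarrow> dird u f z = D"
  unfolding has_dird_def dird_def by (rule DERIV_imp_deriv)

lemma has_dird_const [simp]: "has_dird (\<lambda>_. c) u 0 z"
  by (simp add: has_dird_def)

lemma has_dird_linear:
  assumes "bounded_linear f"
  shows "has_dird f u (f u) z"
proof -
  interpret bounded_linear f by fact
  show ?thesis unfolding has_dird_def add scaleR by (auto intro!: derivative_eq_intros)
qed

lemma has_dird_add: "has_dird f u D z \<Longrightarrow> has_dird g u E z \<Longrightarrow> has_dird (\<lambda>x. f x + g x) u (D + E) z"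
  unfolding has_dird_def by (rule DERIV_add)

lemma has_dird_diff: "has_dird f u D z \<Longrightarrow> has_dird g u E z \<Longrightarrow> has_dird (\<lambda>x. f x - g x) u (D - E) z"
  unfolding has_dird_def by (rule DERIV_diff)

lemma has_dird_cmult: "has_dird f u D z \<Longrightarrow> has_dird (\<lambda>x. c * f x) u (c * D) z"
  unfolding has_dird_def by (rule DERIV_cmult)

lemma has_dird_mult:
  "has_dird f u D z \<Longrightarrow> has_dird g u E z \<Longrightarrow> has_dird (\<lambda>x. f x * g x) u (D * g z + E * f z) z"
  unfolding has_dird_def using DERIV_mult by fastforce

lemma has_dird_sum:
  "(\<And>i. i \<in> A \<Longrightarrow> has_dird (f i) u (D i) z) \<Longrightarrow> has_dird (\<lambda>x. \<Sum>i\<in>A. f i x) u (\<Sum>i\<in>A. D i) z"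
  unfolding has_dird_def by (rule DERIV_sum)

lemma has_dird_local:
  assumes "open S" "z \<in> S" "\<And>x. x \<in> S \<Longrightarrow> f x = g x" "has_dird f u D z"
  shows "has_dird g u D z"
proof -
  have "((\<lambda>h. z + h *\<^sub>R u) \<longlongrightarrow> z) (nhds 0)"
    by (auto intro!: tendsto_eq_intros filterlim_ident)
  hence "\<forall>\<^sub>F h in nhds 0. z + h *\<^sub>R u \<in> S"
    using assms(1,2) by (metis topological_tendstoD)
  hence "\<forall>\<^sub>F h in nhds 0. f (z + h *\<^sub>R u) = g (z + h *\<^sub>R u)"
    by eventually_elim (use assms(3) in auto)
  from DERIV_cong_ev[OF refl this refl] show ?thesis using assms(4) unfolding has_dird_def by simp
qed

lemma has_dird_along:
  assumes "has_dird f u D (z + t *\<^sub>R u)"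
  shows "((\<lambda>h. f (z + h *\<^sub>R u)) has_real_derivative D) (at t)"
  using assms DERIV_shift[of "\<lambda>h. f (z + h *\<^sub>R u)" D 0 t]
  unfolding has_dird_def by (simp add: algebra_simps)

lemma poly2_derivative: "poly2 p \<Longrightarrow> \<exists>p'. poly2 p' \<and> (\<forall>z. has_dird p u (p' z) z)"
proof (induction p rule: real_polynomial_function.induct)
  case (linear f)
  thus ?case using has_dird_linear by blast
next
  case (const c)
  thus ?case using has_dird_const by blast
next
  case (add f g)
  then obtain f' g' where "poly2 f'" "poly2 g'" "\<forall>z. has_dird f u (f' z) z" "\<forall>z. has_dird g u (g' z) z"
    by blast
  thus ?case by (intro exI[of _ "\<lambda>z. f' z + g' z"] conjI poly2_add) (auto intro: has_dird_add)
next
  case (mult f g)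
  then obtain f' g' where "poly2 f'" "poly2 g'" "\<forall>z. has_dird f u (f' z) z" "\<forall>z. has_dird g u (g' z) z"
    by blast
  with mult show ?case
    by (intro exI[of _ "\<lambda>z. f' z * g z + g' z * f z"] conjI poly2_add poly2_mult)
      (auto intro: has_dird_mult)
qed

lemma poly2_dird [intro]: "poly2 p \<Longrightarrow> poly2 (dird u p)"
  and has_dird_poly2: "poly2 p \<Longrightarrow> has_dird p u (dird u p z) z"
proof -
  assume "poly2 p"
  then obtain p' where p': "poly2 p'" "\<forall>z. has_dird p u (p' z) z" using poly2_derivative by blast
  moreover from p' have "dird u p = p'" using has_dird_imp_dird by blast
  ultimately show "poly2 (dird u p)" "has_dird p u (dird u p z) z" by (blast, metis)
qed

lemma dird_const [simp]: "dird u (\<lambda>_. c) = (\<lambda>_. 0)"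
  by (rule ext) (rule has_dird_imp_dird, simp)

lemma dird_linear: "bounded_linear f \<Longrightarrow> dird u f = (\<lambda>_. f u)"
  by (rule ext) (rule has_dird_imp_dird, rule has_dird_linear)

lemma dird_add: "poly2 f \<Longrightarrow> poly2 g \<Longrightarrow> dird u (\<lambda>x. f x + g x) = (\<lambda>x. dird u f x + dird u g x)"
  by (rule ext) (intro has_dird_imp_dird has_dird_add has_dird_poly2)

lemma dird_diff: "poly2 f \<Longrightarrow> poly2 g \<Longrightarrow> dird u (\<lambda>x. f x - g x) = (\<lambda>x. dird u f x - dird u g x)"
  by (rule ext) (intro has_dird_imp_dird has_dird_diff has_dird_poly2)

lemma dird_cmult: "poly2 f \<Longrightarrow> dird u (\<lambda>x. c * f x) = (\<lambda>x. c * dird u f x)"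
  by (rule ext) (intro has_dird_imp_dird has_dird_cmult has_dird_poly2)

lemma dird_mult:
  "poly2 f \<Longrightarrow> poly2 g \<Longrightarrow> dird u (\<lambda>x. f x * g x) = (\<lambda>x. dird u f x * g x + dird u g x * f x)"
  by (rule ext) (intro has_dird_imp_dird has_dird_mult has_dird_poly2)

lemma dird_commute: "poly2 p \<Longrightarrow> dird u (dird w p) = dird w (dird u p)"
proof (induction p rule: real_polynomial_function.induct)
  case (linear f)
  thus ?case by (simp add: dird_linear)
next
  case (mult f g)
  hence "poly2 (\<lambda>z. dird v f z * g z)" "poly2 (\<lambda>z. dird v g z * f z)" for v
    by (intro poly2_mult poly2_dird; simp)+
  with mult show ?case
    by (simp add: dird_mult dird_add poly2_dird fun_eq_iff)
qed (simp_all add: dird_add poly2_dird)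

lemma dird_direction:
  assumes "poly2 p"
  shows "dird (a *\<^sub>R u + b *\<^sub>R w) p = (\<lambda>z. a * dird u p z + b * dird w p z)"
  using assms
proof (induction p rule: real_polynomial_function.induct)
  case (linear f)
  hence "f (a *\<^sub>R u + b *\<^sub>R w) = a * f u + b * f w"
    by (simp add: bounded_linear.linear linear_add linear_scale)
  thus ?case using linear by (simp add: dird_linear)
qed (simp_all add: dird_add dird_mult algebra_simps fun_eq_iff)

lemma dird_affine:
  assumes "poly2 p"
  shows "dird u (\<lambda>z. p (r *\<^sub>R z + a)) = (\<lambda>z. r * dird u p (r *\<^sub>R z + a))"
proof
  fix z
  have "((\<lambda>h. p ((r *\<^sub>R z + a) + (r * h) *\<^sub>R u)) has_real_derivative dird u p (r *\<^sub>R z + a) * r) (at 0)"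
  proof (rule DERIV_chain2[where f = "\<lambda>t. p ((r *\<^sub>R z + a) + t *\<^sub>R u)"])
    show "((\<lambda>t. p (r *\<^sub>R z + a + t *\<^sub>R u)) has_real_derivative dird u p (r *\<^sub>R z + a)) (at (r * 0))"
      using has_dird_poly2[OF assms, of u "r *\<^sub>R z + a"] by (simp add: has_dird_def)
  qed (auto intro!: derivative_eq_intros)
  hence "has_dird (\<lambda>z. p (r *\<^sub>R z + a)) u (r * dird u p (r *\<^sub>R z + a)) z"
    unfolding has_dird_def by (simp add: algebra_simps)
  thus "dird u (\<lambda>z. p (r *\<^sub>R z + a)) z = r * dird u p (r *\<^sub>R z + a)" by (rule has_dird_imp_dird)
qed

lemma poly2_affine: "poly2 p \<Longrightarrow> poly2 (\<lambda>z. p (r *\<^sub>R z + a))"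
proof (induction p rule: real_polynomial_function.induct)
  case (linear f)
  hence "(\<lambda>z. f (r *\<^sub>R z + a)) = (\<lambda>z. r * f z + f a)"
    by (simp add: bounded_linear.linear linear_add linear_scale)
  thus ?case using linear by (simp add: poly2_add poly2_mult poly2_const poly2_linear)
qed (auto intro: poly2_add poly2_mult)

lemma pderiv_x_eq: "pderiv_x = dird (dir 1)"
proof (intro ext, clarify)
  fix f :: "point \<Rightarrow> real" and x y :: real
  have "((\<lambda>s. f (s, y)) has_real_derivative D) (at x) \<longleftrightarrow>
        ((\<lambda>h. f ((x, y) + h *\<^sub>R dir 1)) has_real_derivative D) (at 0)" for D
    using DERIV_shift[of "\<lambda>s. f (s, y)" D 0 x] by (simp add: dir_def add.commute)
  thus "pderiv_x f (x, y) = dird (dir 1) f (x, y)"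
    by (simp add: pderiv_x_def dird_def deriv_def)
qed

lemma pderiv_y_eq: "pderiv_y = dird (dir 2)"
proof (intro ext, clarify)
  fix f :: "point \<Rightarrow> real" and x y :: real
  have "((\<lambda>s. f (x, s)) has_real_derivative D) (at y) \<longleftrightarrow>
        ((\<lambda>h. f ((x, y) + h *\<^sub>R dir 2)) has_real_derivative D) (at 0)" for D
    using DERIV_shift[of "\<lambda>s. f (x, s)" D 0 y] by (simp add: dir_def add.commute)
  thus "pderiv_y f (x, y) = dird (dir 2) f (x, y)"
    by (simp add: pderiv_y_def dird_def deriv_def)
qed

lemma poly2_along: "poly2 p \<Longrightarrow> real_polynomial_function (\<lambda>t::real. p (a + t *\<^sub>R u))"
proof (induction p rule: real_polynomial_function.induct)
  case (linear f)
  hence "(\<lambda>t. f (a + t *\<^sub>R u)) = (\<lambda>t. f a + t * f u)"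
    by (simp add: bounded_linear.linear linear_add linear_scale)
  moreover have "real_polynomial_function (\<lambda>t::real. t)"
    by (intro real_polynomial_function.intros(1) bounded_linear_ident)
  ultimately show ?case by (simp add: real_polynomial_function.intros)
qed (auto intro: real_polynomial_function.intros)

lemma poly_zero_on_interval:
  assumes "real_polynomial_function (f :: real \<Rightarrow> real)" "a < b" "\<And>t. a < t \<Longrightarrow> t < b \<Longrightarrow> f t = 0"
  shows "f t = 0"
proof -
  obtain c m where f: "f = (\<lambda>x. \<Sum>i\<le>m. c i * x ^ i)"
    using real_polynomial_function_imp_sum[OF assms(1)] by blast
  have "infinite {a<..<b}" using assms(2) by (simp add: infinite_Ioo)
  moreover have "{a<..<b} \<subseteq> {x. (\<Sum>i\<le>m. c i * x ^ i) = 0}" using assms(3) f by auto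
  ultimately have "infinite {x. (\<Sum>i\<le>m. c i * x ^ i) = 0}" using finite_subset by blast
  hence "\<forall>i\<le>m. c i = 0" using polyfun_finite_roots[of c m] by blast
  thus ?thesis by (simp add: f)
qed

text \<open>On the line from a point of \<open>S\<close> to an arbitrary \<open>w\<close> the
  polynomial becomes univariate and vanishes for small parameters, hence also at parameter 1, which
  is \<open>w\<close>.\<close>

lemma poly2_zero:
  assumes "poly2 p" "open S" "S \<noteq> {}" "\<And>z. z \<in> S \<Longrightarrow> p z = 0"
  shows "p = (\<lambda>_. 0)"
proof
  fix w
  obtain z where z: "z \<in> S" using assms(3) by blast
  let ?g = "\<lambda>t. p (z + t *\<^sub>R (w - z))"
  have "((\<lambda>t. z + t *\<^sub>R (w - z)) \<longlongrightarrow> z) (nhds 0)"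
    by (auto intro!: tendsto_eq_intros filterlim_ident)
  hence "\<forall>\<^sub>F t in nhds 0. z + t *\<^sub>R (w - z) \<in> S"
    using assms(2) z by (metis topological_tendstoD)
  then obtain e where e: "e > 0" "\<And>t. \<bar>t\<bar> < e \<Longrightarrow> z + t *\<^sub>R (w - z) \<in> S"
    unfolding eventually_nhds_metric by (auto simp: dist_real_def)
  have "?g t = 0" for t
    by (rule poly_zero_on_interval[OF poly2_along[OF assms(1)], of "-e" e]) (use e assms(4) in auto)
  from this[of 1] show "p w = 0" by simp
qed

lemma poly2_eq:
  assumes "poly2 p" "poly2 q" "open S" "S \<noteq> {}" "\<And>z. z \<in> S \<Longrightarrow> p z = q z"
  shows "p = q"
  using poly2_zero[of "\<lambda>z. p z - q z" S] assms
  by (metis (no_types, lifting) eq_iff_diff_eq_0 ext real_polynomial_function_diff)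

text \<open>Knowing a directional derivative of a spline \<open>f\<close> on one triangle determines
  that derivative of its polynomial piece in the whole plane.\<close>

lemma dird_eq_on_open:
  assumes "poly2 p" "poly2 q" "open S" "S \<noteq> {}" "\<And>z. z \<in> S \<Longrightarrow> f z = p z"
    "\<And>z. z \<in> S \<Longrightarrow> has_dird f u (q z) z"
  shows "dird u p = q"
proof (rule poly2_eq[OF poly2_dird[OF assms(1)] assms(2-4)])
  fix z assume z: "z \<in> S"
  have "has_dird p u (q z) z"
    by (rule has_dird_local[OF assms(3) z assms(5) assms(6)[OF z]])
  thus "dird u p z = q z" by (rule has_dird_imp_dird)
qed

lemma continuous_on_poly2: "poly2 p \<Longrightarrow> continuous_on S p"
  by (simp add: continuous_real_polymonial_function continuous_at_imp_continuous_on)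

section \<open>Functions with polynomial directional derivatives\<close>

text \<open>Any two of the three directions form a basis of the plane; with the dual coordinates
  \<open>X\<close> and \<open>Y\<close> all ordered pairs are handled by one argument from here
  on.\<close>

lemma dir_coordinates:
  assumes "i \<noteq> j"
  obtains X Y :: "point \<Rightarrow> real" where "bounded_linear X" "bounded_linear Y"
    "\<And>z. z = X z *\<^sub>R dir i + Y z *\<^sub>R dir j"
    "X (dir i) = 1" "X (dir j) = 0" "Y (dir i) = 0" "Y (dir j) = 1"
proof -
  have lin: "bounded_linear (\<lambda>z::point. fst z)" "bounded_linear (\<lambda>z::point. snd z)"
    "bounded_linear (\<lambda>z::point. fst z - snd z)" "bounded_linear (\<lambda>z::point. snd z - fst z)"
    by (intro bounded_linear_sub bounded_linear_fst bounded_linear_snd)+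
  have "i = 1 \<or> i = 2 \<or> i = 3" "j = 1 \<or> j = 2 \<or> j = 3" using exhaust_3 by auto
  thus ?thesis
    using assms that[OF lin(1) lin(2)] that[OF lin(2) lin(1)] that[OF lin(3) lin(2)]
      that[OF lin(2) lin(3)] that[OF lin(4) lin(1)] that[OF lin(1) lin(4)]
    by (elim disjE) (simp_all add: dir_def)
qed

lemma const_along_segment:
  assumes "convex S" "a \<in> S" "a + r *\<^sub>R u \<in> S" "\<And>z. z \<in> S \<Longrightarrow> has_dird f u 0 z"
  shows "f (a + r *\<^sub>R u) = f a"
proof -
  have "a + t *\<^sub>R u \<in> S" if t: "t \<in> closed_segment 0 r" for t
  proof -
    obtain s where "0 \<le> s" "s \<le> 1" "t = s * r"
      using t unfolding closed_segment_def by fastforce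
    moreover have "(1 - s) *\<^sub>R a + s *\<^sub>R (a + r *\<^sub>R u) \<in> S"
      using \<open>0 \<le> s\<close> \<open>s \<le> 1\<close> assms by (intro convexD) auto
    ultimately show ?thesis by (simp add: algebra_simps)
  qed
  hence "((\<lambda>t. f (a + t *\<^sub>R u)) has_field_derivative 0) (at t within closed_segment 0 r)"
    if "t \<in> closed_segment 0 r" for t
    using has_dird_along[OF assms(4)] that by (blast intro: has_field_derivative_at_within)
  hence "\<exists>c. \<forall>t\<in>closed_segment 0 r. f (a + t *\<^sub>R u) = c"
    using has_field_derivative_zero_constant[OF convex_closed_segment, of 0 r "\<lambda>t. f (a + t *\<^sub>R u)"]
    by blast
  thus ?thesis by (metis add.right_neutral ends_in_segment(1,2) scaleR_zero_left)
qed

text \<open>A point \<open>w\<close> near \<open>z\<close> is to be reached by a leg along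
  \<open>u\<close> and a second leg in another direction. The corner between the legs must stay
  inside a ball on which the derivatives are known, so \<open>w\<close> is confined to a smaller
  ball.\<close>

lemma small_zigzag:
  assumes "open S" "z \<in> S" "bounded_linear Y"
  obtains e d where "e > 0" "d > 0" "ball z e \<subseteq> S" "d \<le> e"
    "\<And>w. w \<in> ball z d \<Longrightarrow> z + Y (w - z) *\<^sub>R u \<in> ball z e"
proof -
  obtain e where e: "e > 0" "ball z e \<subseteq> S" using assms(1,2) open_contains_ball by blast
  interpret bounded_linear Y by fact
  have "((\<lambda>w. z + Y (w - z) *\<^sub>R u) \<longlongrightarrow> z + Y (z - z) *\<^sub>R u) (nhds z)"
    by (intro tendsto_intros tendsto filterlim_ident)
  hence "((\<lambda>w. z + Y (w - z) *\<^sub>R u) \<longlongrightarrow> z) (nhds z)" by (simp add: zero)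
  hence "\<forall>\<^sub>F w in nhds z. z + Y (w - z) *\<^sub>R u \<in> ball z e"
    using e(1) by (metis centre_in_ball open_ball topological_tendstoD)
  then obtain d where "d > 0" "\<And>w. dist w z < d \<Longrightarrow> z + Y (w - z) *\<^sub>R u \<in> ball z e"
    unfolding eventually_nhds_metric by blast
  thus ?thesis using that[of e "min d e"] e by (auto simp: dist_commute)
qed

text \<open>Two directional derivatives do not give differentiability, so the function is followed
  along two-leg paths: it is constant on small balls, and connectedness does the rest.\<close>

lemma const_of_two_dird:
  assumes "i \<noteq> j" "open S" "connected S"
    "\<And>z. z \<in> S \<Longrightarrow> has_dird f (dir i) 0 z" "\<And>z. z \<in> S \<Longrightarrow> has_dird f (dir j) 0 z"
  obtains c where "\<And>z. z \<in> S \<Longrightarrow> f z = c"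
proof -
  obtain X Y where XY: "bounded_linear X" "bounded_linear Y"
    "\<And>z::point. z = X z *\<^sub>R dir i + Y z *\<^sub>R dir j"
    using dir_coordinates[OF assms(1)] by metis
  have XY': "Y z *\<^sub>R dir j + X z *\<^sub>R dir i = z" for z
    by (metis XY(3) add.commute)
  have "f constant_on S"
  proof (rule locally_constant_imp_constant[OF assms(3)])
    fix a assume a: "a \<in> S"
    obtain e d where ed: "e > 0" "d > 0" "ball a e \<subseteq> S" "d \<le> e"
        "\<And>w. w \<in> ball a d \<Longrightarrow> a + Y (w - a) *\<^sub>R dir j \<in> ball a e"
      using small_zigzag[OF assms(2) a XY(2)] by metis
    have "f w = f a" if w: "w \<in> ball a d" for w
    proof -
      let ?b = "a + Y (w - a) *\<^sub>R dir j"
      have in_ball: "a \<in> ball a e" "?b \<in> ball a e" "w \<in> ball a e" 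
    using ed(1) ed(5)[OF w] w subset_ball[OF ed(4)] by (simp, blast, blast)
      have "f ?b = f a"
        by (rule const_along_segment[OF convex_ball in_ball(1,2)]) (use ed(3) assms(5) in blast)
      moreover have "?b + X (w - a) *\<^sub>R dir i = w" by (simp add: add.assoc XY')
      moreover have "f (?b + X (w - a) *\<^sub>R dir i) = f ?b"
        by (rule const_along_segment[OF convex_ball in_ball(2)])
          (use ed(3) assms(4) in_ball(3) calculation(2) in \<open>simp, blast\<close>)
      ultimately show ?thesis by simp
    qed
    moreover have "ball a d \<subseteq> S" using ed(3,4) by (meson dual_order.trans subset_ball)
    hence "openin (top_of_set S) (ball a d)" using assms(2) by (simp add: openin_open_eq)
    ultimately show "\<exists>V. openin (top_of_set S) V \<and> a \<in> V \<and> (\<forall>x\<in>V. f x = f a)"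
      using centre_in_ball[of a d] ed(2) by blast
  qed
  thus ?thesis using that unfolding constant_on_def by blast
qed

text \<open>Monomials in adapted coordinates can be integrated termwise. The span contains the
  coordinates and the constants and is closed under products, which takes one induction for each
  factor.\<close>

lemma poly2_monomial_span:
  assumes XY: "bounded_linear X" "bounded_linear Y" "\<And>z. z = X z *\<^sub>R u + Y z *\<^sub>R w"
    and p: "poly2 p"
  shows "p \<in> fun_vs.span {\<lambda>z. X z ^ a * Y z ^ b | a b. True}" (is "_ \<in> fun_vs.span ?M")
  using p
proof (induction p rule: real_polynomial_function.induct)
  case (linear f)
  hence "f (X z *\<^sub>R u + Y z *\<^sub>R w) = X z * f u + Y z * f w" for z
    by (simp add: bounded_linear.linear linear_add linear_scale)
  hence "f z = X z * f u + Y z * f w" for z by (metis XY(3))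
  hence "f z = (fscale (f u) X + fscale (f w) Y) z" for z
    unfolding fscale_def plus_fun_apply by (metis mult.commute)
  hence f: "f = fscale (f u) X + fscale (f w) Y" by (rule ext)
  moreover have "X \<in> ?M" by (rule CollectI, rule exI[of _ 1], rule exI[of _ 0]) simp
  moreover have "Y \<in> ?M" by (rule CollectI, rule exI[of _ 0], rule exI[of _ 1]) simp
  ultimately have "fscale (f u) X + fscale (f w) Y \<in> fun_vs.span ?M"
    by (intro fun_vs.span_add fun_vs.span_base fun_vs.span_scale)
  with f show ?case by simp
next
  case (const c)
  have "(\<lambda>_. c) = fscale c (\<lambda>z. X z ^ 0 * Y z ^ 0)" by (simp add: fscale_def)
  moreover have "(\<lambda>z. X z ^ 0 * Y z ^ 0) \<in> ?M" by blast
  ultimately show ?case by (simp only: fun_vs.span_base fun_vs.span_scale)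
next
  case (add f g)
  thus ?case using fun_vs.span_add[of f _ g] by (simp add: plus_fun_def)
next
  case (mult f g)
  have mono: "(\<lambda>z. m z * g z) \<in> fun_vs.span ?M" if "m \<in> ?M" for m
    using mult.IH(2)
  proof (induction rule: fun_vs.span_induct_alt)
    case base
    show ?case using fun_vs.span_zero by (simp add: zero_fun_def)
  next
    case (step c h k)
    from that step(1) obtain a b a' b' where "m = (\<lambda>z. X z ^ a * Y z ^ b)" "h = (\<lambda>z. X z ^ a' * Y z ^ b')"
      by blast
    hence "(\<lambda>z. m z * h z) = (\<lambda>z. X z ^ (a + a') * Y z ^ (b + b'))" by (simp add: fun_eq_iff power_add)
    hence "(\<lambda>z. m z * h z) \<in> fun_vs.span ?M" by (intro fun_vs.span_base) blast
    hence "fscale c (\<lambda>z. m z * h z) + (\<lambda>z. m z * k z) \<in> fun_vs.span ?M"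
      using step by (intro fun_vs.span_add fun_vs.span_scale)
    moreover have "fscale c (\<lambda>z. m z * h z) + (\<lambda>z. m z * k z) = (\<lambda>z. m z * (fscale c h + k) z)"
      by (simp add: fscale_def fun_eq_iff algebra_simps)
    ultimately show ?case by simp
  qed
  show ?case using mult.IH(1)
  proof (induction rule: fun_vs.span_induct_alt)
    case base
    show ?case using fun_vs.span_zero by (simp add: zero_fun_def)
  next
    case (step c h k)
    hence "fscale c (\<lambda>z. h z * g z) + (\<lambda>z. k z * g z) \<in> fun_vs.span ?M"
      using mono by (intro fun_vs.span_add fun_vs.span_scale) auto
    moreover have "fscale c (\<lambda>z. h z * g z) + (\<lambda>z. k z * g z) = (\<lambda>z. (fscale c h + k) z * g z)"
      by (simp add: fscale_def fun_eq_iff algebra_simps)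
    ultimately show ?case by simp
  qed
qed

lemma poly2_antiderivative:
  assumes p: "poly2 p"
  obtains q where "poly2 q" "dird (dir i) q = p"
proof -
  obtain j :: 3 where "i \<noteq> j" 
    using that[of 1] that[of 2] by (cases "i = 1") auto
  then obtain X Y where XY: "bounded_linear X" "bounded_linear Y"
    "\<And>z::point. z = X z *\<^sub>R dir i + Y z *\<^sub>R dir j" and 1: "X (dir i) = 1" "Y (dir i) = 0"
    using dir_coordinates by metis
  have "p \<in> fun_vs.span {\<lambda>z. X z ^ a * Y z ^ b | a b. True}"
    by (rule poly2_monomial_span[OF XY p])
  hence "\<exists>q. poly2 q \<and> dird (dir i) q = p"
  proof (induction rule: fun_vs.span_induct_alt)
    case base
    have "poly2 (\<lambda>_. 0)" by blast
    thus ?case by (metis dird_const zero_fun_def)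
  next
    case (step c h k)
    then obtain a b where h: "h = (\<lambda>z. X z ^ a * Y z ^ b)" by blast
    obtain q where q: "poly2 q" "dird (dir i) q = k" using step by blast
    \<comment> \<open>The primitive of the monomial along \<open>dir i\<close>, where
      \<open>X (dir i) = 1\<close> and \<open>Y (dir i) = 0\<close>.\<close>
    let ?q = "\<lambda>z. X z ^ Suc a * (Y z ^ b * (1 / real (Suc a)))"
    have pX: "poly2 X" "poly2 Y" using XY by auto
    have pw: "poly2 (\<lambda>z. X z ^ Suc a)" "poly2 (\<lambda>z. Y z ^ b)" "poly2 (\<lambda>z. Y z ^ b * (1 / real (Suc a)))"
      using pX poly2_mult[OF _ poly2_const] by blast+
    have pq: "poly2 ?q" by (rule poly2_mult[OF pw(1,3)])
    have "has_dird (\<lambda>z. X z ^ k) (dir i) (real k * X z ^ (k - 1)) z" for z k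
      unfolding has_dird_def using XY(1) 1
      by (auto intro!: derivative_eq_intros simp: bounded_linear.linear linear_add linear_scale)
    hence dX: "dird (dir i) (\<lambda>z. X z ^ Suc a) = (\<lambda>z. real (Suc a) * X z ^ a)"
      
      by (intro ext) (metis diff_Suc_1 has_dird_imp_dird)
    have "has_dird (\<lambda>z. Y z ^ k * c) (dir i) 0 z" for z k c
      unfolding has_dird_def using XY(2) 1
      by (auto intro!: derivative_eq_intros simp: bounded_linear.linear linear_add linear_scale)
    hence dY: "dird (dir i) (\<lambda>z. Y z ^ b * (1 / real (Suc a))) = (\<lambda>_. 0)"
      using has_dird_imp_dird by blast
    have dq: "dird (dir i) ?q = h"
      unfolding dird_mult[OF pw(1,3)] dX dY h by (simp add: fun_eq_iff)
    have "poly2 (\<lambda>z. c * ?q z)" by (intro poly2_mult poly2_const pq)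
    moreover have "dird (dir i) (\<lambda>z. c * ?q z + q z) = fscale c h + k"
      using dird_add[OF \<open>poly2 (\<lambda>z. c * ?q z)\<close> q(1)] dird_cmult[OF pq, of "dir i" c]
      by (simp only: dq q(2)) (simp add: fscale_def fun_eq_iff)
    ultimately show ?case using q(1) 
      by (intro exI[of _ "\<lambda>z. c * ?q z + q z"] conjI poly2_add)
  qed
  thus ?thesis using that by blast
qed

text \<open>The integration step for the induction on \<open>n\<close>: the candidate is the
  integral of the two derivatives along a two-leg path. Compatibility of \<open>p\<close> and
  \<open>q\<close> comes from the existence of \<open>f\<close>.\<close>

lemma poly2_of_two_dird:
  assumes ij: "i \<noteq> j" and S: "open S" "connected S" "S \<noteq> {}" and pq: "poly2 p" "poly2 q"
    and fi: "\<And>z. z \<in> S \<Longrightarrow> has_dird f (dir i) (p z) z"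
    and fj: "\<And>z. z \<in> S \<Longrightarrow> has_dird f (dir j) (q z) z"
  obtains P where "poly2 P" "\<And>z. z \<in> S \<Longrightarrow> f z = P z" "dird (dir i) P = p" "dird (dir j) P = q"
proof -
  obtain X Y where XY: "bounded_linear X" "bounded_linear Y"
    "\<And>z::point. z = X z *\<^sub>R dir i + Y z *\<^sub>R dir j"
    using dir_coordinates[OF ij] by metis
  have XY': "Y z *\<^sub>R dir j + X z *\<^sub>R dir i = z" for z
    by (metis XY(3) add.commute)
  obtain a where a: "a \<in> S" using S by blast
  obtain A B where A: "poly2 A" "dird (dir i) A = p" and B: "poly2 B" "dird (dir j) B = q"
    using poly2_antiderivative pq by metis
  interpret Y: bounded_linear Y by (rule XY)
  have lin: "poly2 (\<lambda>z. G (a + Y (z - a) *\<^sub>R dir j))" if "poly2 G" for G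
  proof -
    have "polynomial_function (\<lambda>z. Y (z - a))"
      unfolding real_polynomial_function_eq[symmetric] Y.diff
      by (intro real_polynomial_function_diff poly2_linear poly2_const XY)
    moreover have "polynomial_function (\<lambda>t::real. a + t *\<^sub>R dir j)"
      by (intro polynomial_function_add polynomial_function_const polynomial_function_bounded_linear
          bounded_linear_scaleR_left)
    ultimately have "polynomial_function ((\<lambda>t. a + t *\<^sub>R dir j) \<circ> (\<lambda>z. Y (z - a)))"
      by (rule polynomial_function_compose)
    hence "polynomial_function (G \<circ> ((\<lambda>t. a + t *\<^sub>R dir j) \<circ> (\<lambda>z. Y (z - a))))"
      using that polynomial_function_compose real_polynomial_function_eq by blast
    thus ?thesis by (simp add: o_def real_polynomial_function_eq)
  qed
  \<comment> \<open>From \<open>a\<close> along \<open>dir j\<close> to the corner, using the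
    primitive \<open>B\<close> of \<open>q\<close>, then along \<open>dir i\<close> to
    \<open>z\<close>, using the primitive \<open>A\<close> of \<open>p\<close>.\<close>
  define P where "P = (\<lambda>z. f a + (B (a + Y (z - a) *\<^sub>R dir j) - B a) + (A z - A (a + Y (z - a) *\<^sub>R dir j)))"
  have P: "poly2 P" unfolding P_def
    by (intro poly2_add real_polynomial_function_diff poly2_const lin A B)
  obtain e d where ed: "e > 0" "d > 0" "ball a e \<subseteq> S" "d \<le> e"
        "\<And>w. w \<in> ball a d \<Longrightarrow> a + Y (w - a) *\<^sub>R dir j \<in> ball a e"
    using small_zigzag[OF S(1) a XY(2)] by metis
  have loc: "f w = P w" if w: "w \<in> ball a d" for w
  proof -
    let ?b = "a + Y (w - a) *\<^sub>R dir j"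
    have in_ball: "a \<in> ball a e" "?b \<in> ball a e" "w \<in> ball a e" 
    using ed(1) ed(5)[OF w] w subset_ball[OF ed(4)] by (simp, blast, blast)
    have "(\<lambda>z. f z - B z) ?b = (\<lambda>z. f z - B z) a"
    proof (rule const_along_segment[OF convex_ball in_ball(1,2)])
      fix z assume "z \<in> ball a e"
      hence "has_dird f (dir j) (q z) z" using fj ed by blast
      from has_dird_diff[OF this has_dird_poly2[OF B(1)]]
      show "has_dird (\<lambda>z. f z - B z) (dir j) 0 z" by (simp add: B)
    qed
    moreover have wb: "?b + X (w - a) *\<^sub>R dir i = w" by (simp add: add.assoc XY')
    moreover have "(\<lambda>z. f z - A z) (?b + X (w - a) *\<^sub>R dir i) = (\<lambda>z. f z - A z) ?b"
    proof (rule const_along_segment[OF convex_ball in_ball(2)])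
      show "?b + X (w - a) *\<^sub>R dir i \<in> ball a e" using in_ball(3) wb by simp
      fix z assume "z \<in> ball a e"
      hence "has_dird f (dir i) (p z) z" using fi ed by blast
      from has_dird_diff[OF this has_dird_poly2[OF A(1)]]
      show "has_dird (\<lambda>z. f z - A z) (dir i) 0 z" by (simp add: A)
    qed
    ultimately show ?thesis unfolding P_def by simp
  qed
  have ne: "ball a d \<noteq> {}" using ed(2) by simp
  have d_S: "ball a d \<subseteq> S" by (rule order_trans[OF subset_ball[OF ed(4)] ed(3)])
  have Pi: "dird (dir i) P = p"
    by (rule dird_eq_on_open[OF P pq(1) open_ball ne loc fi]) (use d_S in auto)
  have Pj: "dird (dir j) P = q"
    by (rule dird_eq_on_open[OF P pq(2) open_ball ne loc fj]) (use d_S in auto)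
  \<comment> \<open>The path argument only reaches a ball around \<open>a\<close>; on the whole
    connected set \<open>f - P\<close> is constant, and its value at \<open>a\<close> is 0.\<close>
  have "\<exists>c. \<forall>z\<in>S. f z - P z = c"
  proof (rule const_of_two_dird[OF ij S(1,2), of "\<lambda>z. f z - P z"])
    fix z assume z: "z \<in> S"
    show "has_dird (\<lambda>z. f z - P z) (dir i) 0 z"
      using has_dird_diff[OF fi[OF z] has_dird_poly2[OF P]] by (simp add: Pi)
    show "has_dird (\<lambda>z. f z - P z) (dir j) 0 z"
      using has_dird_diff[OF fj[OF z] has_dird_poly2[OF P]] by (simp add: Pj)
  qed blast
  then obtain c where c: "\<forall>z\<in>S. f z - P z = c" by blast
  have "c = 0" using bspec[OF c a] loc[of a] ed by simp
  hence "f z = P z" if "z \<in> S" for z using c that by auto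
  thus ?thesis using that P Pi Pj by blast
qed

section \<open>Vanishing order along a set\<close>

text \<open>The recursion mirrors the induction on \<open>n\<close>, which takes off one derivative
  at a time. The partial derivatives that occur in \<open>contact\<close> are recovered in
  \<open>vanishing_iff\<close>.\<close>

primrec vanishing :: "nat \<Rightarrow> point set \<Rightarrow> (point \<Rightarrow> real) \<Rightarrow> bool" where
  "vanishing 0 e q \<longleftrightarrow> (\<forall>z\<in>e. q z = 0)"
| "vanishing (Suc m) e q \<longleftrightarrow> (\<forall>z\<in>e. q z = 0) \<and> vanishing m e (dird (dir 1) q) \<and> vanishing m e (dird (dir 2) q)"

lemma vanishing_zero: "vanishing m e q \<Longrightarrow> z \<in> e \<Longrightarrow> q z = 0"
  by (cases m) auto

lemma vanishing_Suc: "vanishing (Suc m) e q \<Longrightarrow> vanishing m e q"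
proof (induction m arbitrary: q)
  case (Suc m)
  show ?case using Suc.prems Suc.IH[of "dird (dir 1) q"] Suc.IH[of "dird (dir 2) q"] by simp
qed simp

lemma vanishing_null: "vanishing m e (\<lambda>_. 0)"
  by (induction m) auto

lemma vanishing_add: "poly2 p \<Longrightarrow> poly2 q \<Longrightarrow> vanishing m e p \<Longrightarrow> vanishing m e q \<Longrightarrow> vanishing m e (\<lambda>z. p z + q z)"
proof (induction m arbitrary: p q)
  case (Suc m)
  show ?case using Suc.prems Suc.IH[OF poly2_dird poly2_dird] by (simp add: dird_add)
qed simp

lemma vanishing_cmult: "poly2 p \<Longrightarrow> vanishing m e p \<Longrightarrow> vanishing m e (\<lambda>z. c * p z)"
proof (induction m arbitrary: p)
  case (Suc m)
  show ?case using Suc.prems Suc.IH[OF poly2_dird] by (simp add: dird_cmult)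
qed simp

lemma vanishing_diff: "poly2 p \<Longrightarrow> poly2 q \<Longrightarrow> vanishing m e p \<Longrightarrow> vanishing m e q \<Longrightarrow> vanishing m e (\<lambda>z. p z - q z)"
proof (induction m arbitrary: p q)
  case (Suc m)
  show ?case using Suc.prems Suc.IH[OF poly2_dird poly2_dird] by (simp add: dird_diff)
qed simp

lemma dird_dir_3: "poly2 q \<Longrightarrow> dird (dir 3) q = (\<lambda>z. dird (dir 1) q z + dird (dir 2) q z)"
  using dird_direction[of q 1 "dir 1" 1 "dir 2"] by (simp add: dir_def)

lemma vanishing_dird: "poly2 q \<Longrightarrow> vanishing (Suc m) e q \<Longrightarrow> vanishing m e (dird (dir k) q)"
  using exhaust_3[of k] by (auto simp: dird_dir_3 intro!: vanishing_add)

lemma vanishing_affine: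
  assumes "poly2 q" "vanishing m e q" "\<And>z. z \<in> e' \<Longrightarrow> r *\<^sub>R z + a \<in> e"
  shows "vanishing m e' (\<lambda>z. q (r *\<^sub>R z + a))"
  using assms
proof (induction m arbitrary: q)
  case (Suc m)
  thus ?case
    by (auto simp: dird_affine intro!: vanishing_cmult[OF poly2_affine])
qed auto

text \<open>Relative openness along \<open>dir i\<close>, as for an open edge of type
  \<open>i\<close>: identities on such a set may be differentiated along
  \<open>dir i\<close>.\<close>

definition tangential :: "3 \<Rightarrow> point set \<Rightarrow> bool"
  where "tangential i e \<longleftrightarrow> (\<forall>z\<in>e. \<forall>\<^sub>F h in nhds 0. z + h *\<^sub>R dir i \<in> e)"

lemma dird_tangential:
  assumes "poly2 q" "tangential i e" "\<And>z. z \<in> e \<Longrightarrow> q z = 0" "z \<in> e"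
  shows "dird (dir i) q z = 0"
proof -
  have "\<forall>\<^sub>F h in nhds 0. z + h *\<^sub>R dir i \<in> e" using assms by (auto simp: tangential_def)
  hence ev: "\<forall>\<^sub>F h in nhds 0. 0 = q (z + h *\<^sub>R dir i)"
    by eventually_elim (use assms(3) in auto)
  have "((\<lambda>h. q (z + h *\<^sub>R dir i)) has_real_derivative 0) (at 0)"
    using DERIV_cong_ev[OF refl ev refl, of 0] by simp
  thus ?thesis using has_dird_imp_dird has_dird_def by blast
qed

text \<open>Derivatives along the edge cost no order: every partial derivative in question vanishes
  on the edge, hence so does its tangential derivative, and derivatives commute.\<close>

lemma vanishing_tangential:
  assumes "poly2 q" "tangential i e" "vanishing m e q"
  shows "vanishing m e (dird (dir i) q)"
  using assms(1,3)
proof (induction m arbitrary: q)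
  case 0
  thus ?case using dird_tangential[OF _ assms(2)] by auto
next
  case (Suc m)
  have "\<forall>z\<in>e. dird (dir i) q z = 0"
    using dird_tangential[OF Suc.prems(1) assms(2)] vanishing_zero[OF Suc.prems(2)] by blast
  moreover have "vanishing m e (dird (dir 1) (dird (dir i) q))" "vanishing m e (dird (dir 2) (dird (dir i) q))"
    using Suc by (simp_all add: dird_commute[OF Suc.prems(1), of _ "dir i"] poly2_dird)
  ultimately show ?case by simp
qed

text \<open>Regains the order that a transverse derivative costs. The tangential derivative is
  controlled because \<open>q\<close> vanishes on \<open>e\<close>, the transverse one by
  hypothesis, and the two directions span the plane.\<close>

lemma vanishing_of_transverse:
  assumes "poly2 q" "tangential i e" "i \<noteq> j" "\<And>z. z \<in> e \<Longrightarrow> q z = 0" "vanishing m e (dird (dir j) q)"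
  shows "vanishing (Suc m) e q"
  using assms(1,4,5)
proof (induction m arbitrary: q)
  have comb: "vanishing m e (dird (dir k) q)"
    if q: "poly2 q" and vi: "vanishing m e (dird (dir i) q)" and vj: "vanishing m e (dird (dir j) q)" for q k m
  proof -
    obtain X Y where XY: "\<And>z::point. z = X z *\<^sub>R dir i + Y z *\<^sub>R dir j"
      using dir_coordinates[OF assms(3)] by metis
    have "dird (dir k) q = (\<lambda>z. X (dir k) * dird (dir i) q z + Y (dir k) * dird (dir j) q z)"
      using dird_direction[OF q] XY[of "dir k"] by metis
    thus ?thesis using vi vj q by (auto intro!: vanishing_add vanishing_cmult)
  qed
  {
    case 0
    have "vanishing 0 e (dird (dir i) q)" using dird_tangential[OF 0(1) assms(2)] 0(2) by auto
    thus ?case using comb[OF 0(1) _ 0(3)] 0(2) by auto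
  next
    case (Suc m)
    have z: "dird (dir i) q z = 0" if "z \<in> e" for z
      using dird_tangential[OF Suc(2) assms(2) Suc(3) that] .
    \<comment> \<open>The induction hypothesis is applied to the tangential derivative of
      \<open>q\<close>; its transverse derivative is a mixed one and inherits its order from
      \<open>dird (dir j) q\<close>.\<close>
    have "vanishing m e (dird (dir i) (dird (dir j) q))"
      using vanishing_tangential[OF _ assms(2) vanishing_Suc[OF Suc(4)]] Suc(2) by blast
    hence "vanishing m e (dird (dir j) (dird (dir i) q))" by (simp add: dird_commute[OF Suc(2)])
    hence "vanishing (Suc m) e (dird (dir i) q)" using Suc.IH[of "dird (dir i) q"] Suc(2) z by blast
    thus ?case using comb[OF Suc(2) _ Suc(4)] Suc(3) by auto
  }
qed

section \<open>Iterated derivatives and the contact condition\<close>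

lemma dird_power_commute:
  "poly2 q \<Longrightarrow> (dird u ^^ j) (dird w q) = dird w ((dird u ^^ j) q) \<and> poly2 ((dird u ^^ j) q)"
  by (induction j) (auto simp: dird_commute)

lemma poly2_dird_power [intro]: "poly2 q \<Longrightarrow> poly2 ((dird u ^^ j) q)"
  using dird_power_commute by blast

lemma dird_power_zero: "(dird u ^^ j) (\<lambda>_. 0) = (\<lambda>_. 0)"
  by (induction j) auto

lemma dird_power_add:
  "poly2 p \<Longrightarrow> poly2 q \<Longrightarrow> (dird u ^^ j) (\<lambda>z. p z + q z) = (\<lambda>z. (dird u ^^ j) p z + (dird u ^^ j) q z)"
  by (induction j) (simp_all add: dird_add poly2_dird_power)

lemma dird_power_diff:
  "poly2 p \<Longrightarrow> poly2 q \<Longrightarrow> (dird u ^^ j) (\<lambda>z. p z - q z) = (\<lambda>z. (dird u ^^ j) p z - (dird u ^^ j) q z)"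
  by (induction j) (simp_all add: dird_diff poly2_dird_power)

lemma dird_power_cmult:
  "poly2 p \<Longrightarrow> (dird u ^^ j) (\<lambda>z. c * p z) = (\<lambda>z. c * (dird u ^^ j) p z)"
  by (induction j) (simp_all add: dird_cmult poly2_dird_power)

lemma dird_power_affine:
  "poly2 p \<Longrightarrow> (dird u ^^ j) (\<lambda>z. p (r *\<^sub>R z + a)) = (\<lambda>z. r ^ j * (dird u ^^ j) p (r *\<^sub>R z + a))"
proof (induction j)
  case (Suc j)
  have "poly2 (\<lambda>z. (dird u ^^ j) p (r *\<^sub>R z + a))" using Suc.prems by (intro poly2_affine) blast
  thus ?case using Suc by (simp add: dird_cmult dird_affine poly2_dird_power mult.assoc mult.left_commute)
qed simp

text \<open>By commutation every word in the two derivatives can be sorted into the form in which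
  \<open>contact\<close> states its partial derivatives.\<close>

lemma vanishing_iff:
  assumes "poly2 q"
  shows "vanishing m e q \<longleftrightarrow>
    (\<forall>i j. i + j \<le> m \<longrightarrow> (\<forall>z\<in>e. (dird (dir 1) ^^ i) ((dird (dir 2) ^^ j) q) z = 0))"
  using assms
proof (induction m arbitrary: q)
  case (Suc m)
  let ?D = "\<lambda>i j q. (dird (dir 1) ^^ i) ((dird (dir 2) ^^ j) q)"
  have D1: "?D i j (dird (dir 1) q) = ?D (Suc i) j q" for i j
    using dird_power_commute[OF Suc(2)] by (simp add: funpow_Suc_right del: funpow.simps)
  have D2: "?D i j (dird (dir 2) q) = ?D i (Suc j) q" for i j
    by (simp add: funpow_Suc_right del: funpow.simps)
  have IH: "vanishing m e (dird (dir 1) q) \<longleftrightarrow> (\<forall>i j. i + j \<le> m \<longrightarrow> (\<forall>z\<in>e. ?D (Suc i) j q z = 0))"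
    "vanishing m e (dird (dir 2) q) \<longleftrightarrow> (\<forall>i j. i + j \<le> m \<longrightarrow> (\<forall>z\<in>e. ?D i (Suc j) q z = 0))"
    using Suc.IH[OF poly2_dird[OF Suc(2)]] by (simp_all only: D1 D2)
  show ?case
  proof
    assume v: "vanishing (Suc m) e q"
    show "\<forall>i j. i + j \<le> Suc m \<longrightarrow> (\<forall>z\<in>e. ?D i j q z = 0)"
    proof (intro allI impI)
      fix i j assume ij: "i + j \<le> Suc m"
      consider "i = 0" "j = 0" | i' where "i = Suc i'" | j' where "j = Suc j'"
        by (metis old.nat.exhaust)
      thus "\<forall>z\<in>e. ?D i j q z = 0"
      proof cases
        case 1
        thus ?thesis using v by simp
      next
        case 2
        thus ?thesis using v ij IH(1) by (auto simp del: funpow.simps)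
      next
        case 3
        thus ?thesis using v ij IH(2) by (auto simp del: funpow.simps)
      qed
    qed
  next
    assume a: "\<forall>i j. i + j \<le> Suc m \<longrightarrow> (\<forall>z\<in>e. ?D i j q z = 0)"
    have "\<forall>z\<in>e. q z = 0" using a[rule_format, of 0 0] by simp
    thus "vanishing (Suc m) e q" unfolding vanishing.simps IH using a by (metis add_Suc add_Suc_right Suc_le_mono)
  qed
qed simp

lemma contact_iff:
  "contact k f T T' e \<longleftrightarrow> (\<exists>p p'. poly2 p \<and> poly2 p' \<and> (\<forall>z\<in>T. f z = p z) \<and> (\<forall>z\<in>T'. f z = p' z) \<and>
     vanishing k e (\<lambda>z. p z - p' z))"
proof -
  have "vanishing k e (\<lambda>z. p z - p' z) \<longleftrightarrow> (\<forall>i j. i + j \<le> k \<longrightarrow>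
      (\<forall>x\<in>e. (pderiv_x ^^ i) ((pderiv_y ^^ j) p) x = (pderiv_x ^^ i) ((pderiv_y ^^ j) p') x))"
    if "poly2 p" "poly2 p'" for p p'
    unfolding pderiv_x_eq pderiv_y_eq vanishing_iff[OF real_polynomial_function_diff[OF that]]
    by (simp add: dird_power_diff poly2_dird_power that)
  thus ?thesis by (simp add: contact_def cong: conj_cong)
qed

section \<open>Lattice points, linear forms and triangles\<close>

definition lat :: "int \<times> int \<Rightarrow> point"
  where "lat v = (of_int (fst v), of_int (snd v))"

definition idir :: "3 \<Rightarrow> int \<times> int"
  where "idir i = (if i = 1 then (1, 0) else if i = 2 then (0, 1) else (1, 1))"

text \<open>The lines of type \<open>i\<close> are the level sets of \<open>form i\<close> at integers.\<close>

definition form :: "3 \<Rightarrow> point \<Rightarrow> real"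
  where "form i z = (if i = 1 then snd z else if i = 2 then fst z else fst z - snd z)"

definition iform :: "3 \<Rightarrow> int \<times> int \<Rightarrow> int"
  where "iform i v = (if i = 1 then snd v else if i = 2 then fst v else fst v - snd v)"

lemma lat_add: "lat (v + w) = lat v + lat w" and lat_diff: "lat (v - w) = lat v - lat w"
  by (auto simp: lat_def)

lemma lat_idir [simp]: "lat (idir k) = dir k"
  by (auto simp: lat_def idir_def dir_def)

lemma lat_eq_iff [simp]: "lat v = lat w \<longleftrightarrow> v = w"
  by (auto simp: lat_def prod_eq_iff)

lemma form_add: "form j (z + w) = form j z + form j w"
  and form_diff: "form j (z - w) = form j z - form j w"
  and form_scale: "form j (r *\<^sub>R z) = r * form j z"
  by (auto simp: form_def algebra_simps)

lemma form_lat: "form j (lat v) = of_int (iform j v)"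
  by (auto simp: form_def iform_def lat_def)

lemma iform_add: "iform j (v + w) = iform j v + iform j w"
  and iform_diff: "iform j (v - w) = iform j v - iform j w"
  by (auto simp: iform_def)

lemma form_dir: "form j (dir k) = of_int (iform j (idir k))"
  by (metis form_lat lat_idir)

lemma iform_idir:
  "iform 1 (idir 1) = 0" "iform 1 (idir 2) = 1" "iform 1 (idir 3) = 1"
  "iform 2 (idir 1) = 1" "iform 2 (idir 2) = 0" "iform 2 (idir 3) = 1"
  "iform 3 (idir 1) = 1" "iform 3 (idir 2) = - 1" "iform 3 (idir 3) = 0"
  by (simp_all add: iform_def idir_def)

lemma iform_self [simp]: "iform i (idir i) = 0"
  using exhaust_3[of i] by (auto simp: iform_idir)

lemma iform_other: "i \<noteq> j \<Longrightarrow> iform i (idir j) = 1 \<or> iform i (idir j) = - 1"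
  using exhaust_3[of i] exhaust_3[of j] by (auto simp: iform_idir)

lemma all_3_index: "(\<forall>i::3. P i) \<longleftrightarrow> P 1 \<and> P 2 \<and> P 3"
  by (metis exhaust_3)

lemma form_inj: "i \<noteq> j \<Longrightarrow> form i z = form i w \<Longrightarrow> form j z = form j w \<Longrightarrow> z = w"
  using exhaust_3[of i] exhaust_3[of j] by (auto simp: form_def prod_eq_iff)

lemma iform_inj: "i \<noteq> j \<Longrightarrow> iform i z = iform i w \<Longrightarrow> iform j z = iform j w \<Longrightarrow> z = w"
  using exhaust_3[of i] exhaust_3[of j] by (auto simp: iform_def prod_eq_iff)

lemma int_lattice_eq: "int_lattice = range lat"
proof -
  have "(of_int i, of_int j) = lat (i, j)" for i j by (simp add: lat_def)
  thus ?thesis unfolding int_lattice_def image_def by (metis UNIV_I surj_pair)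
qed

lemma bounded_linear_form: "bounded_linear (form j)"
proof -
  have "bounded_linear (\<lambda>z::point. fst z)" "bounded_linear (\<lambda>z::point. snd z)"
    "bounded_linear (\<lambda>z::point. fst z - snd z)"
    by (intro bounded_linear_sub bounded_linear_fst bounded_linear_snd)+
  moreover have "form 1 = snd" "form 2 = fst" "form 3 = (\<lambda>z. fst z - snd z)"
    by (auto simp: form_def)
  ultimately show ?thesis using exhaust_3[of j] by metis
qed

lemma continuous_form [continuous_intros]: "continuous_on S (form j)"
  by (rule linear_continuous_on[OF bounded_linear_form])

text \<open>A triangle is the intersection of three unit strips, one between neighbouring lines of
  each type, and is named by three integers. Adjacency, vertices and supports thereby become
  inequalities between integers.\<close>

definition cell :: "(3 \<Rightarrow> int) \<Rightarrow> point set"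
  where "cell k = {z. \<forall>j. of_int (k j) < form j z \<and> form j z < of_int (k j) + 1}"

definition ccell :: "(3 \<Rightarrow> int) \<Rightarrow> point set"
  where "ccell k = {z. \<forall>j. of_int (k j) \<le> form j z \<and> form j z \<le> of_int (k j) + 1}"

text \<open>Strips 1 and 2 cut out a unit square, and the diagonal strip 3 meets its interior in one
  of two triangles: below the diagonal for the first value, above it for the second. All other index
  triples give empty cells.\<close>

definition valid :: "(3 \<Rightarrow> int) \<Rightarrow> bool"
  where "valid k \<longleftrightarrow> k 3 = k 2 - k 1 \<or> k 3 = k 2 - k 1 - 1"

lemma cell_subset_ccell: "cell k \<subseteq> ccell k"
  by (auto simp: cell_def ccell_def less_imp_le)

lemma open_cell: "open (cell k)"
  unfolding cell_def all_3_index Collect_conj_eq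
  by (intro open_Int open_Collect_less continuous_intros)

lemma closed_ccell: "closed (ccell k)"
  unfolding ccell_def all_3_index Collect_conj_eq
  by (intro closed_Int closed_Collect_le continuous_intros)

lemma convex_form_set: "convex {z. \<forall>j. form j z \<in> A j}" if "\<And>j. convex (A j)" for A :: "3 \<Rightarrow> real set"
  unfolding convex_alt using that by (simp add: form_add form_scale convex_alt)

lemma convex_cell: "convex (cell k)" and convex_ccell: "convex (ccell k)"
  using convex_form_set[of "\<lambda>j. {of_int (k j) <..< of_int (k j) + 1}"]
    convex_form_set[of "\<lambda>j. {of_int (k j) .. of_int (k j) + 1}"]
  by (simp_all add: cell_def ccell_def)

lemma connected_cell: "connected (cell k)"
  by (rule convex_connected[OF convex_cell])

lemma valid_of_nonempty:
  assumes "z \<in> cell k" shows "valid k"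
proof -
  have "real_of_int (k 3) < of_int (k 2) + 1 - of_int (k 1)"
       "of_int (k 2) - of_int (k 1) - 1 < real_of_int (k 3) + 1"
    using assms by (auto simp: cell_def form_def all_3_index)
  hence "k 3 < k 2 + 1 - k 1" "k 2 - k 1 - 1 < k 3 + 1" by linarith+
  thus ?thesis by (auto simp: valid_def)
qed

lemma cell_nonempty: "valid k \<Longrightarrow> cell k \<noteq> {}"
proof -
  assume "valid k"
  hence "(of_int (k 2) + 2/3, of_int (k 1) + 1/3) \<in> cell k \<or> (of_int (k 2) + 1/3, of_int (k 1) + 2/3) \<in> cell k"
    by (auto simp: valid_def cell_def form_def all_3_index)
  thus ?thesis by blast
qed

lemma cell_disjoint:
  assumes "z \<in> cell k" "z \<in> cell l" shows "k = l"
proof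
  fix j
  have "real_of_int (k j) < of_int (l j) + 1" "real_of_int (l j) < of_int (k j) + 1"
    using assms by (auto simp: cell_def intro: less_trans)
  thus "k j = l j" by linarith
qed

lemma form_direction: obtains w where "form j w = 1"
proof -
  have "form 1 (0, 1) = 1" "form 2 (1, 0) = 1" "form 3 (1, 0) = 1" by (simp_all add: form_def)
  thus ?thesis using that exhaust_3[of j] by metis
qed

text \<open>An interior point may be moved a little both ways in a direction with
  \<open>form j w = 1\<close>, which excludes equality in the bounds on
  \<open>form j\<close>.\<close>

lemma interior_ccell: "interior (ccell k) = cell k"
proof
  show "cell k \<subseteq> interior (ccell k)"
    by (rule interior_maximal[OF cell_subset_ccell open_cell])
  show "interior (ccell k) \<subseteq> cell k"
  proof
    fix z assume z: "z \<in> interior (ccell k)"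
    have "of_int (k j) < form j z \<and> form j z < of_int (k j) + 1" for j
    proof -
      obtain w where w: "form j w = 1" by (rule form_direction)
      have "((\<lambda>h. z + h *\<^sub>R w) \<longlongrightarrow> z) (at_right 0)" "((\<lambda>h. z - h *\<^sub>R w) \<longlongrightarrow> z) (at_right 0)"
        by (auto intro!: tendsto_eq_intros)
      hence "\<forall>\<^sub>F h in at_right 0. z + h *\<^sub>R w \<in> interior (ccell k)"
        "\<forall>\<^sub>F h in at_right 0. z - h *\<^sub>R w \<in> interior (ccell k)"
        using z open_interior topological_tendstoD by metis+
      moreover have "\<forall>\<^sub>F h in at_right (0::real). h > 0" by (simp add: eventually_at_right_less)
      ultimately have "\<forall>\<^sub>F h in at_right 0. h > 0 \<and> z + h *\<^sub>R w \<in> interior (ccell k) \<and> z - h *\<^sub>R w \<in> interior (ccell k)"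
        by eventually_elim simp
      then obtain h where "h > 0" "z + h *\<^sub>R w \<in> interior (ccell k)" "z - h *\<^sub>R w \<in> interior (ccell k)"
        using eventually_happens'[of "at_right (0::real)"] by (metis (no_types, lifting) trivial_limit_at_right_real)
      hence "h > 0" "z + h *\<^sub>R w \<in> ccell k" "z - h *\<^sub>R w \<in> ccell k" using interior_subset by blast+
      thus ?thesis using w by (auto simp: ccell_def form_add form_diff form_scale dest!: spec[of _ j])
    qed
    thus "z \<in> cell k" by (simp add: cell_def)
  qed
qed

lemma closure_cell:
  assumes "valid k" shows "closure (cell k) = ccell k"
proof -
  have "interior (ccell k) \<noteq> {}" using cell_nonempty[OF assms] by (simp add: interior_ccell)
  hence "closure (interior (ccell k)) = closure (ccell k)"
    by (rule convex_closure_interior[OF convex_ccell])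
  thus ?thesis by (simp add: interior_ccell closed_ccell closure_closed)
qed

lemma convex_hull_ccell:
  assumes "valid k" "a = (k 2, k 1)" "u = (if k 3 = k 2 - k 1 then dir 1 else dir 2)"
  shows "convex hull {lat a, lat a + u, lat a + dir 3} = ccell k"
proof -
  have u: "u = dir 1 \<or> u = dir 2" using assms(3) by auto
  show ?thesis
  proof (intro equalityI subsetI)
    fix z assume "z \<in> convex hull {lat a, lat a + u, lat a + dir 3}"
    then obtain s t where "0 \<le> t" "t \<le> s" "s \<le> 1" and z: "z = lat a + (s - t) *\<^sub>R u + t *\<^sub>R dir 3"
      using hull_coords u by metis
    thus "z \<in> ccell k"
      using assms by (auto simp: ccell_def all_3_index form_def lat_def dir_def valid_def split: if_splits)
  next
    fix z assume z: "z \<in> ccell k"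
    define p q where "p = fst z - of_int (k 2)" and "q = snd z - of_int (k 1)"
    have zl: "z = lat a + (p, q)" by (simp add: assms(2) lat_def p_def q_def prod_eq_iff)
    have pq: "0 \<le> p" "p \<le> 1" "0 \<le> q" "q \<le> 1"
      "k 3 = k 2 - k 1 \<Longrightarrow> q \<le> p" "k 3 = k 2 - k 1 - 1 \<Longrightarrow> p \<le> q"
      using z by (auto simp: ccell_def all_3_index form_def p_def q_def)
    have "\<exists>\<alpha> \<beta>. 0 \<le> \<alpha> \<and> 0 \<le> \<beta> \<and> \<alpha> + \<beta> \<le> 1 \<and> (p, q) = \<alpha> *\<^sub>R u + \<beta> *\<^sub>R dir 3"
    proof (cases "k 3 = k 2 - k 1")
      case True
      thus ?thesis using pq assms(3)
        by (intro exI[of _ "p - q"] exI[of _ q]) (auto simp: dir_def)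
    next
      case False
      thus ?thesis using pq assms(1,3)
        by (intro exI[of _ "q - p"] exI[of _ p]) (auto simp: dir_def valid_def)
    qed
    thus "z \<in> convex hull {lat a, lat a + u, lat a + dir 3}"
      unfolding convex_hull_3_alt zl by (auto simp: add.assoc)
  qed
qed

lemma base_triangles_eq: "base_triangles = cell ` {k. valid k}"
proof (intro equalityI subsetI)
  fix T assume "T \<in> base_triangles"
  then obtain v where v: "T = interior (convex hull {lat v, lat v + dir 1, lat v + dir 3})
        \<or> T = interior (convex hull {lat v, lat v + dir 2, lat v + dir 3})"
    unfolding base_triangles_def int_lattice_eq UN_iff by blast
  define k1 k2 :: "3 \<Rightarrow> int" where "k1 = (\<lambda>j. iform j v)" and "k2 = (\<lambda>j. if j = 3 then iform j v - 1 else iform j v)"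
  have "convex hull {lat v, lat v + dir 1, lat v + dir 3} = ccell k1"
    by (rule convex_hull_ccell) (auto simp: k1_def iform_def valid_def)
  moreover have "convex hull {lat v, lat v + dir 2, lat v + dir 3} = ccell k2"
    by (rule convex_hull_ccell) (auto simp: k2_def iform_def valid_def)
  moreover have "valid k1" "valid k2" by (auto simp: k1_def k2_def iform_def valid_def)
  ultimately have "T = cell k1 \<or> T = cell k2" using v interior_ccell by metis
  thus "T \<in> cell ` {k. valid k}" using \<open>valid k1\<close> \<open>valid k2\<close> by blast
next
  fix T assume "T \<in> cell ` {k. valid k}"
  then obtain k where k: "valid k" "T = cell k" by blast
  let ?a = "lat (k 2, k 1)"
  have "T = interior (convex hull {?a, ?a + (if k 3 = k 2 - k 1 then dir 1 else dir 2), ?a + dir 3})"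
    using convex_hull_ccell[OF k(1) refl refl] k(2) interior_ccell[of k] by simp
  moreover have "?a \<in> int_lattice" unfolding int_lattice_eq by blast
  ultimately show "T \<in> base_triangles"
    unfolding base_triangles_def by (intro UN_I[of ?a]) (simp_all split: if_splits)
qed

lemma ccell_cover:
  obtains k where "valid k" "z \<in> ccell k" "k 1 = \<lfloor>snd z\<rfloor>" "k 2 = \<lfloor>fst z\<rfloor>"
proof -
  define k :: "3 \<Rightarrow> int" where
    "k j = (if j = 1 then \<lfloor>snd z\<rfloor> else if j = 2 then \<lfloor>fst z\<rfloor> else
            if frac (snd z) \<le> frac (fst z) then \<lfloor>fst z\<rfloor> - \<lfloor>snd z\<rfloor> else \<lfloor>fst z\<rfloor> - \<lfloor>snd z\<rfloor> - 1)" for j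
  have "valid k" by (auto simp: k_def valid_def)
  moreover have "z \<in> ccell k"
    unfolding ccell_def all_3_index mem_Collect_eq k_def form_def frac_def
    by (auto; linarith)
  ultimately show ?thesis using that by (simp add: k_def)
qed

section \<open>Box splines\<close>

text \<open>With \<open>hi\<close>, the extreme values of \<open>form j\<close> on the zonotope
  spanned by \<open>n $ k\<close> copies of each \<open>dir k\<close>, outside of which the box
  spline vanishes. A direction contributes to the upper or to the lower bound according to the sign
  of \<open>iform j (idir k)\<close>; the only negative sign is that of \<open>idir 2\<close> under
  form 3.\<close>

definition lo :: "nat ^ 3 \<Rightarrow> 3 \<Rightarrow> int"
  where "lo n j = (if j = 3 then - int (n $ 2) else 0)"

definition hi :: "nat ^ 3 \<Rightarrow> 3 \<Rightarrow> int"
  where "hi n j = (if j = 1 then int (n $ 2 + n $ 3) else if j = 2 then int (n $ 1 + n $ 3) else int (n $ 1))"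

definition ones :: "nat ^ 3"
  where "ones = (\<chi> i. 1)"

lemma ones_nth [simp]: "ones $ i = 1"
  by (simp add: ones_def)

lemma lower_nth: "(n - axis k 1) $ i = (if i = k then n $ i - 1 else (n :: nat ^ 3) $ i)"
  by (auto simp: axis_def)

lemmas lower_nth_simps = lower_nth lower_nth[unfolded One_nat_def]

lemma lower_ge_1:
  assumes "\<forall>i. (n :: nat ^ 3) $ i \<ge> 1" "n $ k \<ge> 2"
  shows "\<forall>i. (n - axis k 1) $ i \<ge> 1"
  using assms by (auto simp: axis_def)

text \<open>The induction hypothesis is available for every direction that can be lowered, since
  some proofs below use two of them in the same step.\<close>

lemma box_induct [consumes 1, case_names one step]:
  fixes n :: "nat ^ 3"
  assumes "\<forall>i. n $ i \<ge> 1" "P ones"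
    "\<And>n k. \<forall>i. n $ i \<ge> 1 \<Longrightarrow> n $ k \<ge> 2 \<Longrightarrow> (\<And>k. n $ k \<ge> 2 \<Longrightarrow> P (n - axis k 1)) \<Longrightarrow> P n"
  shows "P n"
  using assms(1)
proof (induction "n $ 1 + n $ 2 + n $ 3" arbitrary: n rule: less_induct)
  case less
  show ?case
  proof (cases "\<exists>k. n $ k \<ge> 2")
    case True
    then obtain k where k: "n $ k \<ge> 2" by blast
    show ?thesis
    proof (rule assms(3)[OF less(2) k])
      fix k assume "n $ k \<ge> 2"
      thus "P (n - axis k 1)"
        by (intro less(1) lower_ge_1[OF less(2)])
          (use exhaust_3[of k] in \<open>auto simp: lower_nth_simps simp del: vector_minus_component\<close>)
    qed
  next
    case False
    hence "n = ones" using less(2) by (simp add: vec_eq_iff) (metis not_less_eq_eq numeral_2_eq_2 le_antisym)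
    thus ?thesis using assms(2) by simp
  qed
qed

lemma lo_lower: "n $ k \<ge> 2 \<Longrightarrow> lo n j = lo (n - axis k 1) j + min 0 (iform j (idir k))"
  and hi_lower: "n $ k \<ge> 2 \<Longrightarrow> hi n j = hi (n - axis k 1) j + max 0 (iform j (idir k))"
  using exhaust_3[of j] exhaust_3[of k]
  by (elim disjE; simp add: lo_def hi_def lower_nth_simps iform_idir del: vector_minus_component)+

lemma box_spline_ones: "box_spline ones = courant_hat"
  by (rule box_spline_one) simp

lemma box_spline_lower: "n $ k \<ge> 2 \<Longrightarrow> box_spline n = dir_avg (dir k) (box_spline (n - axis k 1))"
  by (rule ext) (simp add: box_spline_rec[of n k] dir_avg_def)

lemma continuous_box_spline: "continuous_on UNIV (box_spline n)"
  unfolding box_spline_def by (intro continuous_dir_avg_funpow continuous_courant_hat)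

text \<open>Averaging along \<open>dir k\<close> reads values at points where \<open>form j\<close>
  is shifted by at most \<open>iform j (idir k)\<close>, and the bounds grow by just this
  amount.\<close>

lemma box_spline_zero:
  assumes "\<forall>i. n $ i \<ge> 1" "form j z \<le> of_int (lo n j) \<or> of_int (hi n j) \<le> form j z"
  shows "box_spline n z = 0"
  using assms
proof (induction n arbitrary: z rule: box_induct)
  case one
  have "(snd z \<le> 0 \<or> 2 \<le> snd z) \<or> (fst z \<le> 0 \<or> 2 \<le> fst z) \<or> (fst z - snd z \<le> - 1 \<or> 1 \<le> fst z - snd z)"
    using one exhaust_3[of j] by (elim disjE[of "j = 1"] disjE[of "j = 2"]) (simp_all add: lo_def hi_def form_def)
  hence "1 \<le> \<bar>fst z - 1\<bar> \<or> 1 \<le> \<bar>snd z - 1\<bar> \<or> 1 \<le> \<bar>fst z - snd z\<bar>"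
    by linarith
  hence "1 \<le> max \<bar>fst z - 1\<bar> (max \<bar>snd z - 1\<bar> \<bar>fst z - snd z\<bar>)"
    by (meson max.coboundedI1 max.coboundedI2)
  hence "1 - max \<bar>fst z - 1\<bar> (max \<bar>snd z - 1\<bar> \<bar>fst z - snd z\<bar>) \<le> 0"
    by (simp only: diff_le_0_iff_le)
  thus ?case unfolding box_spline_ones courant_hat_eq courant_formula_def case_prod_beta
    by (rule max_absorb1)
next
  case (step n k)
  let ?n = "n - axis k 1"
  have "box_spline ?n (z - t *\<^sub>R dir k) = 0" if t: "t \<in> {0..1}" for t
  proof (rule step.IH[OF step.hyps(2)])
    have f: "form j (z - t *\<^sub>R dir k) = form j z - t * of_int (iform j (idir k))"
      by (simp add: form_diff form_scale form_dir)
    define m where "m = iform j (idir k)"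
    have "m = 0 \<or> m = 1 \<or> m = - 1"
      unfolding m_def using iform_other[of j k] iform_self[of k] by (cases "j = k") simp_all
    hence "of_int (min 0 m) \<le> t * of_int m" "t * of_int m \<le> of_int (max 0 m)"
      using t by auto
    thus "form j (z - t *\<^sub>R dir k) \<le> of_int (lo ?n j) \<or> of_int (hi ?n j) \<le> form j (z - t *\<^sub>R dir k)"
      using step.prems
    proof (elim disjE)
      assume "form j z \<le> of_int (lo n j)"
      hence "form j z \<le> of_int (lo ?n j) + of_int (min 0 m)"
        by (simp only: lo_lower[OF step.hyps(2)] m_def of_int_add)
      thus ?thesis using \<open>of_int (min 0 m) \<le> t * of_int m\<close> unfolding f m_def[symmetric] by linarith
    next
      assume "of_int (hi n j) \<le> form j z"
      hence "of_int (hi ?n j) + of_int (max 0 m) \<le> form j z"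
        by (simp only: hi_lower[OF step.hyps(2)] m_def of_int_add)
      thus ?thesis using \<open>t * of_int m \<le> of_int (max 0 m)\<close> unfolding f m_def[symmetric] by linarith
    qed
  qed
  hence "integral {0..1} (\<lambda>t. box_spline ?n (z - t *\<^sub>R dir k)) = integral {0..1} (\<lambda>t::real. 0)"
    by (intro Henstock_Kurzweil_Integration.integral_cong) blast
  thus ?case by (simp add: box_spline_lower[OF step.hyps(2)] dir_avg_def)
qed

text \<open>Along the line through \<open>z\<close> the average is a difference
  \<open>G h - G (h - 1)\<close> of values of a primitive, so continuity of \<open>f\<close> is
  enough.\<close>

lemma has_dird_dir_avg:
  assumes "continuous_on UNIV f"
  shows "has_dird (dir_avg u f) u (f z - f (z - u)) z"
proof -
  define \<phi> where "\<phi> s = f (z + s *\<^sub>R u)" for s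
  have c: "continuous_on S \<phi>" for S
    unfolding \<phi>_def by (rule continuous_on_compose2[OF assms]) (auto intro!: continuous_intros)
  \<comment> \<open>For \<open>\<bar>h\<bar> < 1\<close> and \<open>t\<close> in the unit interval,
    \<open>h - t\<close> lies between -2 and 1, safely inside the interval from -3 to 3.\<close>
  obtain G where G: "\<And>x. x \<in> {-3..3} \<Longrightarrow> (G has_vector_derivative \<phi> x) (at x within {-3..3})"
    using antiderivative_continuous[OF c] by blast
  have G': "(G has_real_derivative \<phi> x) (at x)" if "-3 < x" "x < 3" for x
    using G[of x] that at_within_Icc_at[of "-3" x 3]
    by (simp add: has_real_derivative_iff_has_vector_derivative)
  have eq: "dir_avg u f (z + h *\<^sub>R u) = G h - G (h - 1)" if "\<bar>h\<bar> < 1" for h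
  proof -
    have "((\<lambda>t. \<phi> (h - t)) has_integral (- G (h - 1)) - (- G (h - 0))) {0..1}"
    proof (rule fundamental_theorem_of_calculus)
      fix t :: real assume t: "t \<in> {0..1}"
      have "(G has_real_derivative \<phi> (h - t)) (at (h - t))" by (rule G') (use t that in auto)
      hence "((\<lambda>t. - G (h - t)) has_real_derivative \<phi> (h - t)) (at t)"
        by (auto intro!: derivative_eq_intros DERIV_chain'[where g = G])
      thus "((\<lambda>t. - G (h - t)) has_vector_derivative \<phi> (h - t)) (at t within {0..1})"
        by (simp add: has_real_derivative_iff_has_vector_derivative has_vector_derivative_at_within)
    qed simp
    moreover have "\<phi> (h - t) = f (z + h *\<^sub>R u - t *\<^sub>R u)" for t by (simp add: \<phi>_def algebra_simps)
    ultimately show ?thesis by (simp add: dir_avg_def integral_unique)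
  qed
  have "((\<lambda>h. G h - G (h - 1)) has_real_derivative \<phi> 0 - \<phi> (0 - 1)) (at 0)"
  proof (rule DERIV_diff)
    show "(G has_real_derivative \<phi> 0) (at 0)" by (rule G') simp_all
    have "(G has_real_derivative \<phi> (- 1)) (at (0 + - 1))" using G'[of "- 1"] by simp
    thus "((\<lambda>h. G (h - 1)) has_real_derivative \<phi> (0 - 1)) (at 0)"
      unfolding DERIV_shift by simp
  qed
  moreover have ev: "\<forall>\<^sub>F h in nhds 0. G h - G (h - 1) = dir_avg u f (z + h *\<^sub>R u)"
    unfolding eventually_nhds_metric by (rule exI[of _ 1]) (simp add: eq dist_real_def)
  ultimately have "((\<lambda>h. dir_avg u f (z + h *\<^sub>R u)) has_real_derivative \<phi> 0 - \<phi> (0 - 1)) (at 0)"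
    by (simp only: DERIV_cong_ev[OF refl ev refl])
  thus ?thesis by (simp add: has_dird_def \<phi>_def)
qed

section \<open>Series of translates of a box spline\<close>

text \<open>Coefficients are arbitrary, possibly with infinite support. At each point only the
  finitely many translates that are nonzero there are summed, so no question of convergence
  arises.\<close>

definition spl :: "nat ^ 3 \<Rightarrow> (int \<times> int \<Rightarrow> real) \<Rightarrow> point \<Rightarrow> real"
  where "spl n c z = (\<Sum>v | box_spline n (z - lat v) \<noteq> 0. c v * box_spline n (z - lat v))"

lemma active_bounds:
  assumes "\<forall>i. n $ i \<ge> 1" "box_spline n (z - lat v) \<noteq> 0"
  shows "of_int (lo n j) < form j z - of_int (iform j v)" "form j z - of_int (iform j v) < of_int (hi n j)"
proof -
  have "\<not> (form j (z - lat v) \<le> of_int (lo n j) \<or> of_int (hi n j) \<le> form j (z - lat v))"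
    using box_spline_zero[OF assms(1)] assms(2) by blast
  thus "of_int (lo n j) < form j z - of_int (iform j v)" "form j z - of_int (iform j v) < of_int (hi n j)"
    by (simp_all add: form_diff form_lat)
qed

text \<open>One finite index set serving a whole ball turns the series into a finite sum there,
  which gives continuity and the interchange with the averaging integral.\<close>

lemma common_support:
  assumes "\<forall>i. n $ i \<ge> 1"
  obtains F where "finite F" "\<And>z v. norm z \<le> R \<Longrightarrow> box_spline n (z - lat v) \<noteq> 0 \<Longrightarrow> v \<in> F"
proof -
  define K where "K = \<lceil>\<bar>R\<bar> + hi n 1 + hi n 2\<rceil>"
  have "v \<in> {-K..K} \<times> {-K..K}" if z: "norm z \<le> R" "box_spline n (z - lat v) \<noteq> 0" for z v
  proof -
    have "\<bar>fst z\<bar> \<le> norm z" "\<bar>snd z\<bar> \<le> norm z"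
      using norm_fst_le[of "fst z" "snd z"] norm_snd_le[of "snd z" "fst z"] by simp_all
    moreover have "0 < snd z - of_int (snd v)" "snd z - of_int (snd v) < hi n 1"
      "0 < fst z - of_int (fst v)" "fst z - of_int (fst v) < hi n 2"
      using active_bounds[OF assms z(2), of 1] active_bounds[OF assms z(2), of 2]
      by (simp_all add: lo_def form_def iform_def)
    moreover have "hi n 1 \<ge> 0" "hi n 2 \<ge> 0" by (simp_all add: hi_def)
    ultimately have "\<bar>of_int (fst v)\<bar> \<le> \<bar>R\<bar> + hi n 1 + hi n 2" "\<bar>of_int (snd v)\<bar> \<le> \<bar>R\<bar> + hi n 1 + hi n 2"
      using z(1) by linarith+
    hence "\<bar>fst v\<bar> \<le> K" "\<bar>snd v\<bar> \<le> K" unfolding K_def by linarith+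
    thus ?thesis by (cases v) auto
  qed
  thus ?thesis using that[of "{-K..K} \<times> {-K..K}"] by blast
qed

lemma finite_active_at:
  assumes "\<forall>i. n $ i \<ge> 1" shows "finite {v. box_spline n (z - lat v) \<noteq> 0}"
proof -
  obtain F where "finite F" "\<And>w v. norm w \<le> norm z \<Longrightarrow> box_spline n (w - lat v) \<noteq> 0 \<Longrightarrow> v \<in> F"
    using common_support[OF assms] by metis
  thus ?thesis by (metis (mono_tags, lifting) finite_subset mem_Collect_eq order_refl subsetI)
qed

lemma spl_eq:
  assumes "finite F" "\<And>v. box_spline n (z - lat v) \<noteq> 0 \<Longrightarrow> c v \<noteq> 0 \<Longrightarrow> v \<in> F" "\<forall>i. n $ i \<ge> 1"
  shows "spl n c z = (\<Sum>v\<in>F. c v * box_spline n (z - lat v))"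
  unfolding spl_def
  by (rule sum.mono_neutral_cong) (use assms finite_active_at in auto)

lemma spl_cong: "(\<And>v. box_spline n (z - lat v) \<noteq> 0 \<Longrightarrow> c v = d v) \<Longrightarrow> spl n c z = spl n d z"
  unfolding spl_def by (rule sum.cong) auto

lemma spl_add: "spl n (\<lambda>v. c v + d v) z = spl n c z + spl n d z"
  and spl_diff: "spl n (\<lambda>v. c v - d v) z = spl n c z - spl n d z"
  by (simp_all add: spl_def sum.distrib sum_subtractf sum_distrib_left algebra_simps)

lemma spl_shift: "spl n c (z - lat a) = spl n (\<lambda>v. c (v - a)) z"
  unfolding spl_def
  by (rule sum.reindex_bij_witness[of _ "\<lambda>v. v - a" "\<lambda>v. v + a"])
    (auto simp: lat_add lat_diff algebra_simps)

lemma continuous_box_spline_line: "continuous_on S (\<lambda>t. box_spline n (z - lat v - t *\<^sub>R u))"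
  by (rule continuous_on_compose2[OF continuous_box_spline]) (auto intro!: continuous_intros)

lemma continuous_spl:
  assumes "\<forall>i. n $ i \<ge> 1"
  shows "continuous_on UNIV (spl n c)"
proof -
  have "isCont (spl n c) z" for z
  proof -
    obtain F where F: "finite F" "\<And>w v. norm w \<le> norm z + 1 \<Longrightarrow> box_spline n (w - lat v) \<noteq> 0 \<Longrightarrow> v \<in> F"
      using common_support[OF assms] by metis
    have "norm w \<le> norm z + 1" if "w \<in> ball z 1" for w
      using that norm_triangle_ineq2[of w z] by (simp add: dist_norm norm_minus_commute)
    hence "spl n c w = (\<Sum>v\<in>F. c v * box_spline n (w - lat v))" if "w \<in> ball z 1" for w
      by (intro spl_eq[OF F(1) _ assms] F(2)) (use that in auto)
    moreover have "continuous_on (ball z 1) (\<lambda>w. \<Sum>v\<in>F. c v * box_spline n (w - lat v))"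
      by (intro continuous_intros continuous_on_compose2[OF continuous_box_spline]) auto
    ultimately have "continuous_on (ball z 1) (spl n c)" using continuous_on_cong by (metis (no_types, lifting))
    thus ?thesis by (simp add: continuous_on_eq_continuous_at)
  qed
  thus ?thesis by (simp add: continuous_at_imp_continuous_on)
qed

lemma spl_lower:
  assumes n: "\<forall>i. n $ i \<ge> 1" and k: "n $ k \<ge> 2"
  shows "spl n c = dir_avg (dir k) (spl (n - axis k 1) c)"
proof
  fix z :: point
  let ?n = "n - axis k 1" and ?R = "norm z + norm (dir k)"
  obtain F where F: "finite F" "\<And>w v. norm w \<le> ?R \<Longrightarrow> box_spline n (w - lat v) \<noteq> 0 \<Longrightarrow> v \<in> F"
    using common_support[OF n] by metis
  obtain F' where F': "finite F'" "\<And>w v. norm w \<le> ?R \<Longrightarrow> box_spline ?n (w - lat v) \<noteq> 0 \<Longrightarrow> v \<in> F'"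
    using common_support[OF lower_ge_1[OF n k]] by metis
  have le: "norm (z - t *\<^sub>R dir k) \<le> ?R" if "t \<in> {0..1}" for t
    using that norm_triangle_ineq4[of z "t *\<^sub>R dir k"] mult_left_le_one_le[of "norm (dir k)" t]
    by (auto simp: abs_of_nonneg)
  have "dir_avg (dir k) (spl ?n c) z
      = integral {0..1} (\<lambda>t. \<Sum>v\<in>F \<union> F'. c v * box_spline ?n (z - lat v - t *\<^sub>R dir k))"
    unfolding dir_avg_def
  proof (rule Henstock_Kurzweil_Integration.integral_cong)
    fix t :: real assume t: "t \<in> {0..1}"
    have "spl ?n c (z - t *\<^sub>R dir k) = (\<Sum>v\<in>F \<union> F'. c v * box_spline ?n (z - t *\<^sub>R dir k - lat v))"
      by (rule spl_eq[OF _ _ lower_ge_1[OF n k]]) (use F(1) F' le[OF t] in auto)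
    thus "spl ?n c (z - t *\<^sub>R dir k) = (\<Sum>v\<in>F \<union> F'. c v * box_spline ?n (z - lat v - t *\<^sub>R dir k))"
      by (simp add: algebra_simps)
  qed
  also have "\<dots> = (\<Sum>v\<in>F \<union> F'. integral {0..1} (\<lambda>t. c v * box_spline ?n (z - lat v - t *\<^sub>R dir k)))"
    using F(1) F'(1)
    by (intro integral_sum integrable_continuous_real continuous_intros continuous_box_spline_line) auto
  also have "\<dots> = (\<Sum>v\<in>F \<union> F'. c v * box_spline n (z - lat v))"
    by (simp add: box_spline_lower[OF k] dir_avg_def)
  also have "\<dots> = spl n c z"

    by (rule spl_eq[OF _ _ n, symmetric]) (use F F'(1) in \<open>auto intro: F(2)[of z]\<close>)
  finally show "spl n c z = dir_avg (dir k) (spl ?n c) z" by simp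
qed

definition nabla :: "3 \<Rightarrow> (int \<times> int \<Rightarrow> real) \<Rightarrow> int \<times> int \<Rightarrow> real"
  where "nabla k c = (\<lambda>v. c v - c (v - idir k))"

lemma has_dird_spl:
  assumes "\<forall>i. n $ i \<ge> 1" "n $ k \<ge> 2"
  shows "has_dird (spl n c) (dir k) (spl (n - axis k 1) (nabla k c) z) z"
proof -
  let ?s = "spl (n - axis k 1)"
  have "has_dird (spl n c) (dir k) (?s c z - ?s c (z - dir k)) z"
    unfolding spl_lower[OF assms]
    by (rule has_dird_dir_avg[OF continuous_spl[OF lower_ge_1[OF assms]]])
  moreover have "?s c (z - dir k) = ?s (\<lambda>v. c (v - idir k)) z"
    using spl_shift[of "n - axis k 1" c z "idir k"] by simp
  ultimately show ?thesis by (simp add: nabla_def spl_diff)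
qed

text \<open>Indices whose zonotope strips overlap those of the triangle. That these are exactly the
  box splines not vanishing identically on it is known only after local independence, in
  \<open>box_spline_nonzero\<close>.\<close>

definition act :: "nat ^ 3 \<Rightarrow> (3 \<Rightarrow> int) \<Rightarrow> (int \<times> int) set"
  where "act n k = {v. \<forall>j. lo n j \<le> k j - iform j v \<and> k j - iform j v < hi n j}"

lemma mem_act:
  assumes "\<forall>i. n $ i \<ge> 1" "z \<in> cell k" "box_spline n (z - lat v) \<noteq> 0"
  shows "v \<in> act n k"
proof -
  have "lo n j \<le> k j - iform j v \<and> k j - iform j v < hi n j" for j
  proof -
    have "of_int (k j) < form j z" "form j z < of_int (k j) + 1" using assms(2) by (auto simp: cell_def)
    hence "real_of_int (lo n j) < of_int (k j) + 1 - of_int (iform j v)"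
      "real_of_int (k j) - of_int (iform j v) < of_int (hi n j)"
      using active_bounds[OF assms(1,3), of j] by linarith+
    thus ?thesis by linarith
  qed
  thus ?thesis by (simp add: act_def)
qed

lemma spl_cong_act:
  assumes "\<forall>i. n $ i \<ge> 1" "z \<in> cell k" "\<And>v. v \<in> act n k \<Longrightarrow> c v = d v"
  shows "spl n c z = spl n d z"
  by (rule spl_cong) (use mem_act[OF assms(1,2)] assms(3) in blast)

lemma courant_hat_lat: "courant_hat (lat v) = (if v = (1, 1) then 1 else 0)"
proof (cases "v = (1, 1)")
  case True
  thus ?thesis by (simp add: courant_hat_eq courant_formula_def lat_def)
next
  case False
  moreover have "(1, 1) = lat (1, 1)" by (simp add: lat_def)
  ultimately have "lat v \<in> int_lattice - {(1, 1)}" by (simp add: int_lattice_eq)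
  thus ?thesis using False by (simp add: courant_hat_eq courant_formula_int)
qed

text \<open>A series of hat functions interpolates linearly on each triangle. The hat is centred at
  \<open>(1, 1)\<close>, so the value at the vertex \<open>u\<close> is the coefficient of the index
  \<open>u - (1, 1)\<close>; hence the offsets by one.\<close>

lemma spl_ones:
  assumes "valid k" "z \<in> ccell k"
  shows "k 3 = k 2 - k 1 \<Longrightarrow> spl ones c z =
      (1 - (fst z - k 2)) * c (k 2 - 1, k 1 - 1) + ((fst z - k 2) - (snd z - k 1)) * c (k 2, k 1 - 1)
      + (snd z - k 1) * c (k 2, k 1)"
    and "k 3 = k 2 - k 1 - 1 \<Longrightarrow> spl ones c z =
      (1 - (snd z - k 1)) * c (k 2 - 1, k 1 - 1) + ((snd z - k 1) - (fst z - k 2)) * c (k 2 - 1, k 1)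
      + (fst z - k 2) * c (k 2, k 1)"
proof -
  define s t where "s = fst z - k 2" and "t = snd z - k 1"
  have st: "0 \<le> s" "s \<le> 1" "0 \<le> t" "t \<le> 1" "k 3 = k 2 - k 1 \<Longrightarrow> t \<le> s" "k 3 = k 2 - k 1 - 1 \<Longrightarrow> s \<le> t"
    using assms(2) by (auto simp: ccell_def all_3_index form_def s_def t_def)
  have z: "z - lat v = (of_int (k 2 - fst v) + s, of_int (k 1 - snd v) + t)" for v
    by (simp add: lat_def s_def t_def prod_eq_iff)
  have cf: "courant_formula (of_int i, of_int j) = (if i = 1 \<and> j = 1 then 1 else 0)"
     "courant_formula (of_int i + 1, of_int j) = (if i = 0 \<and> j = 1 then 1 else 0)"
     "courant_formula (of_int i, of_int j + 1) = (if i = 1 \<and> j = 0 then 1 else 0)"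
     "courant_formula (of_int i + 1, of_int j + 1) = (if i = 0 \<and> j = 0 then 1 else 0)" for i j
    using courant_hat_lat[of "(i, j)"] courant_hat_lat[of "(i + 1, j)"] courant_hat_lat[of "(i, j + 1)"]
      courant_hat_lat[of "(i + 1, j + 1)"] by (auto simp: courant_hat_eq lat_def)
  show "spl ones c z = (1 - (fst z - k 2)) * c (k 2 - 1, k 1 - 1)
      + ((fst z - k 2) - (snd z - k 1)) * c (k 2, k 1 - 1) + (snd z - k 1) * c (k 2, k 1)"
    if k3: "k 3 = k 2 - k 1"
  proof -
    let ?F = "{(k 2 - 1, k 1 - 1), (k 2, k 1 - 1), (k 2, k 1)}"
    have B: "box_spline ones (z - lat v) = (1 - s) * (if v = (k 2 - 1, k 1 - 1) then 1 else 0)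
        + (s - t) * (if v = (k 2, k 1 - 1) then 1 else 0) + t * (if v = (k 2, k 1) then 1 else 0)" for v
      unfolding z box_spline_ones courant_hat_eq courant_formula_interp(1)[OF st(3) st(5)[OF k3] st(2)] cf
      by (cases v) auto
    have "spl ones c z = (\<Sum>v\<in>?F. c v * box_spline ones (z - lat v))"
      by (rule spl_eq) (auto simp: B split: if_splits)
    thus ?thesis by (simp add: B s_def t_def mult.commute)
  qed
  show "spl ones c z = (1 - (snd z - k 1)) * c (k 2 - 1, k 1 - 1)
      + ((snd z - k 1) - (fst z - k 2)) * c (k 2 - 1, k 1) + (fst z - k 2) * c (k 2, k 1)"
    if k3: "k 3 = k 2 - k 1 - 1"
  proof -
    let ?F = "{(k 2 - 1, k 1 - 1), (k 2 - 1, k 1), (k 2, k 1)}"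
    have B: "box_spline ones (z - lat v) = (1 - t) * (if v = (k 2 - 1, k 1 - 1) then 1 else 0)
        + (t - s) * (if v = (k 2 - 1, k 1) then 1 else 0) + s * (if v = (k 2, k 1) then 1 else 0)" for v
      unfolding z box_spline_ones courant_hat_eq courant_formula_interp(2)[OF st(1) st(6)[OF k3] st(4)] cf
      by (cases v) auto
    have "spl ones c z = (\<Sum>v\<in>?F. c v * box_spline ones (z - lat v))"
      by (rule spl_eq) (auto simp: B split: if_splits)
    thus ?thesis by (simp add: B s_def t_def mult.commute)
  qed
qed

lemma spl_affine:
  assumes "valid k" "z \<in> ccell k" "\<And>v. c v = \<alpha> * (of_int (fst v) + 1) + \<beta> * (of_int (snd v) + 1) + \<gamma>"
  shows "spl ones c z = \<alpha> * fst z + \<beta> * snd z + \<gamma>"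
proof (cases "k 3 = k 2 - k 1")
  case True
  show ?thesis unfolding spl_ones(1)[OF assms(1,2) True] assms(3) by (simp add: algebra_simps)
next
  case False
  hence "k 3 = k 2 - k 1 - 1" using assms(1) by (auto simp: valid_def)
  show ?thesis unfolding spl_ones(2)[OF assms(1,2) \<open>k 3 = k 2 - k 1 - 1\<close>] assms(3)
    by (simp add: algebra_simps)
qed

text \<open>Partition of unity: it holds for the hats, and averaging keeps constants.\<close>

lemma spl_const:
  assumes "\<forall>i. n $ i \<ge> 1" shows "spl n (\<lambda>_. g) z = g"
  using assms
proof (induction n arbitrary: z rule: box_induct)
  case one
  obtain k where "valid k" "z \<in> ccell k" using ccell_cover by metis
  thus ?case using spl_affine[of k z "\<lambda>_. g" 0 0 g] by simp
next
  case (step n k)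
  thus ?case by (simp add: spl_lower dir_avg_def)
qed

text \<open>For hats the series is the piecewise linear interpolant of \<open>g\<close> in the
  single variable \<open>form k\<close>. Averaging in any direction commutes with translation along
  \<open>dir k\<close>, so the invariance survives.\<close>

lemma spl_line_invariant:
  assumes "\<forall>i. n $ i \<ge> 1" shows "spl n (\<lambda>v. g (iform k v)) (z - t *\<^sub>R dir k) = spl n (\<lambda>v. g (iform k v)) z"
  using assms
proof (induction n arbitrary: z t rule: box_induct)
  case one
  \<comment> \<open>The value of \<open>iform k\<close> at the centre \<open>(1, 1)\<close> of the
    hat: 0 for the diagonal form, 1 for the other two.\<close>
  let ?d = "if k = 3 then 0 else 1"
  define \<Lambda> where "\<Lambda> x = (1 - frac x) * g (\<lfloor>x\<rfloor> - ?d) + frac x * g (\<lfloor>x\<rfloor> - ?d + 1)" for x :: real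
  have "spl ones (\<lambda>v. g (iform k v)) z = \<Lambda> (form k z)" for z
  proof -
    obtain l where l: "valid l" "z \<in> ccell l" "l 1 = \<lfloor>snd z\<rfloor>" "l 2 = \<lfloor>fst z\<rfloor>" using ccell_cover by metis
    have fr: "snd z - of_int (l 1) = frac (snd z)" "fst z - of_int (l 2) = frac (fst z)"
      by (simp_all add: l frac_def)
    have k: "k = 1 \<or> k = 2 \<or> k = 3" by (rule exhaust_3)
    show ?thesis
    proof (cases "l 3 = l 2 - l 1")
      case True
      have d: "fst z - snd z = of_int (l 2 - l 1) + (frac (fst z) - frac (snd z))"
        using fr by simp
      have "0 \<le> frac (fst z) - frac (snd z)"
        using l(2) True d by (auto simp: ccell_def all_3_index form_def)
      moreover have "frac (fst z) - frac (snd z) < 1"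
        using frac_lt_1[of "fst z"] frac_ge_0[of "snd z"] by linarith
      ultimately have c: "\<lfloor>fst z - snd z\<rfloor> = l 2 - l 1"
        using d by (intro floor_unique) linarith+
      have "frac (fst z - snd z) = fst z - snd z - of_int (l 2 - l 1)" by (simp only: frac_def c)
      hence c': "frac (fst z - snd z) = frac (fst z) - frac (snd z)" using d by linarith
      have "spl ones (\<lambda>v. g (iform k v)) z = (1 - frac (fst z)) * g (iform k (l 2 - 1, l 1 - 1))
        + (frac (fst z) - frac (snd z)) * g (iform k (l 2, l 1 - 1)) + frac (snd z) * g (iform k (l 2, l 1))"
        using spl_ones(1)[OF l(1,2) True, of "\<lambda>v. g (iform k v)"] unfolding fr .
      also have "\<dots> = \<Lambda> (form k z)"
        using k
      proof (elim disjE)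
        assume "k = 3"
        show ?thesis unfolding \<open>k = 3\<close> by (simp add: \<Lambda>_def form_def iform_def c c' \<open>k = 3\<close> algebra_simps)
      qed (simp_all add: \<Lambda>_def form_def iform_def l algebra_simps)
      finally show ?thesis .
    next
      case False
      hence l3: "l 3 = l 2 - l 1 - 1" using l(1) by (auto simp: valid_def)
      have "spl ones (\<lambda>v. g (iform k v)) z = (1 - frac (snd z)) * g (iform k (l 2 - 1, l 1 - 1))
        + (frac (snd z) - frac (fst z)) * g (iform k (l 2 - 1, l 1)) + frac (fst z) * g (iform k (l 2, l 1))"
        using spl_ones(2)[OF l(1,2) l3, of "\<lambda>v. g (iform k v)"] unfolding fr .
      also have "\<dots> = \<Lambda> (form k z)"
        using k
      proof (elim disjE)
        assume k: "k = 3"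
        show ?thesis
        \<comment> \<open>On the diagonal \<open>form 3\<close> has already reached the next
          integer, so its floor differs from the one inside the upper triangle.\<close>
        proof (cases "frac (fst z) = frac (snd z)")
          case True
          hence "fst z - snd z = of_int (l 2 - l 1)" using fr by simp
          hence c: "\<lfloor>fst z - snd z\<rfloor> = l 2 - l 1" "frac (fst z - snd z) = 0"
            unfolding frac_def by (simp_all only: floor_of_int)
          show ?thesis unfolding True k by (simp add: \<Lambda>_def form_def iform_def c k left_diff_distrib del: frac_eq_0_iff)
        next
          case False
          have "0 \<le> frac (fst z)" "frac (snd z) < 1" by (simp_all add: frac_lt_1)
          have "fst z - snd z < l 2 - l 1" "l 2 - l 1 - 1 \<le> fst z - snd z"
            using l(2) l3 False fr by (auto simp: ccell_def all_3_index form_def)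
          hence c: "\<lfloor>fst z - snd z\<rfloor> = l 2 - l 1 - 1" by (intro floor_unique) auto
          hence d: "frac (fst z - snd z) = 1 - (frac (snd z) - frac (fst z))"
            unfolding fr[symmetric] by (simp add: frac_def)
          show ?thesis unfolding k by (simp add: \<Lambda>_def form_def iform_def c d k algebra_simps)
        qed
      qed (simp_all add: \<Lambda>_def form_def iform_def l algebra_simps)
      finally show ?thesis .
    qed
  qed
  thus ?case by (simp add: form_diff form_scale form_dir)
next
  case (step n j)
  have "spl (n - axis j 1) (\<lambda>v. g (iform k v)) (z - t *\<^sub>R dir k - s *\<^sub>R dir j)
      = spl (n - axis j 1) (\<lambda>v. g (iform k v)) (z - s *\<^sub>R dir j)" for s
    using step.IH[OF step.hyps(2), of "z - s *\<^sub>R dir j" t] by (simp add: algebra_simps)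
  thus ?case by (simp add: spl_lower[OF step.hyps(1,2)] dir_avg_def)
qed

text \<open>Averaging along \<open>dir k\<close> does nothing to a function that is invariant along
  it.\<close>

lemma spl_line_lower:
  assumes "\<forall>i. n $ i \<ge> 1" "n $ k \<ge> 2"
  shows "spl n (\<lambda>v. g (iform k v)) = spl (n - axis k 1) (\<lambda>v. g (iform k v))"
  unfolding spl_lower[OF assms] dir_avg_def spl_line_invariant[OF lower_ge_1[OF assms], of g k] by simp

section \<open>The local polynomial space as a joint kernel\<close>

abbreviation dpow :: "3 \<Rightarrow> nat \<Rightarrow> (point \<Rightarrow> real) \<Rightarrow> point \<Rightarrow> real"
  where "dpow i m \<equiv> dird (dir i) ^^ m"

definition kpoly :: "nat ^ 3 \<Rightarrow> (point \<Rightarrow> real) set"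
  where "kpoly n = {p. poly2 p \<and> (\<forall>i j. i \<noteq> j \<longrightarrow> dpow i (n $ i) (dpow j (n $ j) p) = (\<lambda>_. 0))}"

lemma kpoly_poly2: "p \<in> kpoly n \<Longrightarrow> poly2 p"
  by (simp add: kpoly_def)

lemma kpoly_diff: "p \<in> kpoly n \<Longrightarrow> q \<in> kpoly n \<Longrightarrow> (\<lambda>z. p z - q z) \<in> kpoly n"
  unfolding kpoly_def mem_Collect_eq
  by (simp add: real_polynomial_function_diff dird_power_diff poly2_dird_power)

lemma kpoly_affine: "p \<in> kpoly n \<Longrightarrow> (\<lambda>z. p (r *\<^sub>R z + a)) \<in> kpoly n"
proof -
  assume p: "p \<in> kpoly n"
  hence pp: "poly2 p" by (rule kpoly_poly2)
  have "dpow i (n $ i) (dpow j (n $ j) (\<lambda>z. p (r *\<^sub>R z + a))) = (\<lambda>_. 0)" if "i \<noteq> j" for i j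
  proof -
    have q: "poly2 (dpow j (n $ j) p)" using pp by blast
    have "dpow i (n $ i) (dpow j (n $ j) p) = (\<lambda>_. 0)" using p that by (simp add: kpoly_def)
    thus ?thesis
      unfolding dird_power_affine[OF pp] dird_power_cmult[OF poly2_affine[OF q]] dird_power_affine[OF q]
      by simp
  qed
  thus ?thesis using poly2_affine[OF pp] by (simp add: kpoly_def)
qed

lemma dpow_dird: "n $ k \<ge> 2 \<Longrightarrow> dpow k ((n - axis k 1) $ k) (dird (dir k) p) = dpow k (n $ k) p" for n :: "nat ^ 3"
proof -
  assume "n $ k \<ge> 2"
  hence "n $ k = Suc ((n - axis k 1) $ k)" by (simp add: lower_nth_simps del: vector_minus_component)
  thus ?thesis by (metis comp_apply funpow_Suc_right)
qed

lemma kpoly_lower: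
  assumes "p \<in> kpoly n" "n $ k \<ge> 2"
  shows "dird (dir k) p \<in> kpoly (n - axis k 1)"
proof -
  let ?n = "n - axis k 1"
  have pp: "poly2 p" using assms(1) by (rule kpoly_poly2)
  have nth: "?n $ i = n $ i" if "i \<noteq> k" for i using that by (simp add: axis_def)
  have K: "dpow i (n $ i) (dpow j (n $ j) p) = (\<lambda>_. 0)" if "i \<noteq> j" for i j
    using assms(1) that by (simp add: kpoly_def)
  have "dpow i (?n $ i) (dpow j (?n $ j) (dird (dir k) p)) = (\<lambda>_. 0)" if ij: "i \<noteq> j" for i j
  proof -
    consider "k = j" | "k = i" "k \<noteq> j" | "k \<noteq> i" "k \<noteq> j" by blast
    thus ?thesis
    proof cases
      case 1
      hence "dpow j (?n $ j) (dird (dir k) p) = dpow j (n $ j) p" using dpow_dird[OF assms(2)] by blast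
      thus ?thesis using K[OF ij] nth[of i] 1 ij by metis
    next
      case 2
      have "dpow j (?n $ j) (dird (dir k) p) = dird (dir k) (dpow j (n $ j) p)"
        using dird_power_commute[OF pp] nth[of j] 2 by simp
      thus ?thesis using dpow_dird[OF assms(2)] K[OF ij] 2 by metis
    next
      case 3
      have "dpow j (?n $ j) (dird (dir k) p) = dird (dir k) (dpow j (n $ j) p)"
        using dird_power_commute[OF pp] nth[of j] 3 by simp
      hence "dpow i (?n $ i) (dpow j (?n $ j) (dird (dir k) p))
          = dird (dir k) (dpow i (n $ i) (dpow j (n $ j) p))"
        using dird_power_commute[OF poly2_dird_power[OF pp]] nth[of i] 3 by simp
      thus ?thesis unfolding K[OF ij] by simp
    qed
  qed
  thus ?thesis using pp by (simp add: kpoly_def poly2_dird del: vector_minus_component)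
qed

text \<open>A pair with a multiplicity of at least 2 is reached through the derivative in that
  direction. A pair with both multiplicities 1 is not, which is why \<open>one\<close> is a separate
  hypothesis.\<close>

lemma kpoly_raise:
  assumes pp: "poly2 p" and n: "\<forall>i. n $ i \<ge> 1"
    and D: "\<And>k. n $ k \<ge> 2 \<Longrightarrow> dird (dir k) p \<in> kpoly (n - axis k 1)"
    and one: "\<And>i j. i \<noteq> j \<Longrightarrow> n $ i = 1 \<Longrightarrow> n $ j = 1 \<Longrightarrow> dird (dir i) (dird (dir j) p) = (\<lambda>_. 0)"
  shows "p \<in> kpoly n"
proof -
  have nth: "(n - axis k 1) $ i = n $ i" if "i \<noteq> k" for i k using that by (simp add: axis_def)
  have "dpow i (n $ i) (dpow j (n $ j) p) = (\<lambda>_. 0)" if ij: "i \<noteq> j" for i j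
  proof -
    consider "n $ i \<ge> 2" | "n $ j \<ge> 2" | "n $ i = 1" "n $ j = 1"
      using n by (metis One_nat_def Suc_1 le_antisym not_less_eq_eq)
    thus ?thesis
    proof cases
      case 1
      let ?n = "n - axis i 1"
      have "dpow i (?n $ i) (dpow j (?n $ j) (dird (dir i) p)) = (\<lambda>_. 0)"
        using D[OF 1] ij by (simp add: kpoly_def del: vector_minus_component)
      moreover have "dpow j (?n $ j) (dird (dir i) p) = dird (dir i) (dpow j (n $ j) p)"
        using dird_power_commute[OF pp] nth[of j i] ij by simp
      ultimately show ?thesis using dpow_dird[OF 1] by metis
    next
      case 2
      let ?n = "n - axis j 1"
      have "dpow i (?n $ i) (dpow j (?n $ j) (dird (dir j) p)) = (\<lambda>_. 0)"
        using D[OF 2] ij by (simp add: kpoly_def del: vector_minus_component)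
      thus ?thesis using dpow_dird[OF 2] nth[of i j] ij by metis
    next
      case 3
      thus ?thesis using one[OF ij] by simp
    qed
  qed
  thus ?thesis using pp by (simp add: kpoly_def)
qed

text \<open>The lowered exponent of D_k is still positive, so the operators containing D_k
  annihilate \<open>p\<close> anyway, and the remaining one is unchanged.\<close>

lemma kpoly_lower_null:
  assumes "p \<in> kpoly n" "dird (dir k) p = (\<lambda>_. 0)" "n $ k \<ge> 2" "\<forall>i. n $ i \<ge> 1"
  shows "p \<in> kpoly (n - axis k 1)"
proof -
  let ?n = "n - axis k 1"
  have pp: "poly2 p" using assms(1) by (rule kpoly_poly2)
  have nth: "?n $ i = n $ i" if "i \<noteq> k" for i using that by (simp add: axis_def)
  obtain m where m: "?n $ k = Suc m"
    using assms(3) by (cases "?n $ k") (auto simp: lower_nth_simps simp del: vector_minus_component)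
  have null: "dpow k (?n $ k) q = (\<lambda>_. 0)" if "dird (dir k) q = (\<lambda>_. 0)" for q
    unfolding m funpow_Suc_right comp_apply that by (rule dird_power_zero)
  have "dpow i (?n $ i) (dpow j (?n $ j) p) = (\<lambda>_. 0)" if ij: "i \<noteq> j" for i j
  proof -
    consider "k = j" | "k = i" | "k \<noteq> i" "k \<noteq> j" by blast
    thus ?thesis
    proof cases
      case 1
      thus ?thesis using null[OF assms(2)] dird_power_zero by metis
    next
      case 2
      have "dird (dir k) (dpow j (?n $ j) p) = dpow j (?n $ j) (dird (dir k) p)"
        using dird_power_commute[OF pp] by metis
      also have "\<dots> = (\<lambda>_. 0)" unfolding assms(2) by (rule dird_power_zero)
      finally show ?thesis using null 2 by metis
    next
      case 3
      thus ?thesis using assms(1) ij nth by (simp add: kpoly_def del: vector_minus_component)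
    qed
  qed
  thus ?thesis using pp by (simp add: kpoly_def del: vector_minus_component)
qed

lemma dird_affine_fun:
  "poly2 (\<lambda>z. \<alpha> * fst z + \<beta> * snd z + \<gamma>)"
  "dird u (\<lambda>z. \<alpha> * fst z + \<beta> * snd z + \<gamma>) = (\<lambda>_. \<alpha> * fst u + \<beta> * snd u)"
proof -
  have lin: "bounded_linear (\<lambda>z::point. fst z)" "bounded_linear (\<lambda>z::point. snd z)"
    by (intro bounded_linear_fst bounded_linear_snd)+
  show "poly2 (\<lambda>z. \<alpha> * fst z + \<beta> * snd z + \<gamma>)"
    by (intro poly2_add poly2_mult poly2_const poly2_linear lin)
  have "has_dird (\<lambda>z. \<alpha> * fst z + \<beta> * snd z + \<gamma>) u (\<alpha> * fst u + \<beta> * snd u + 0) z" for z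
    by (intro has_dird_add has_dird_cmult has_dird_linear lin has_dird_const)
  thus "dird u (\<lambda>z. \<alpha> * fst z + \<beta> * snd z + \<gamma>) = (\<lambda>_. \<alpha> * fst u + \<beta> * snd u)"
    using has_dird_imp_dird by fastforce
qed

lemma poly2_const_of_dird:
  assumes "poly2 p" "dird (dir 1) p = (\<lambda>_. 0)" "dird (dir 2) p = (\<lambda>_. 0)"
  obtains c where "p = (\<lambda>_. c)"
proof -
  have "has_dird p (dir 1) 0 z" "has_dird p (dir 2) 0 z" for z
    using has_dird_poly2[OF assms(1), of _ z] assms(2,3) by metis+
  moreover have "(1::3) \<noteq> 2" by simp
  ultimately show ?thesis using const_of_two_dird[of 1 2 UNIV p] that by (metis UNIV_I ext open_UNIV connected_UNIV)
qed

text \<open>Since D_3 = D_1 + D_2, the vanishing of D_3 D_1 p and D_2 D_1 p gives D_1 D_1 p = 0, and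
  likewise D_2 D_2 p = 0; so both first derivatives are constant.\<close>

lemma kpoly_ones:
  assumes "p \<in> kpoly ones"
  obtains \<alpha> \<beta> \<gamma> where "p = (\<lambda>z. \<alpha> * fst z + \<beta> * snd z + \<gamma>)"
proof -
  have pp: "poly2 p" using assms by (rule kpoly_poly2)
  have K: "dird (dir i) (dird (dir j) p) = (\<lambda>_. 0)" if "i \<noteq> j" for i j
    using assms that by (simp add: kpoly_def)
  have D3: "dird (dir 3) q = (\<lambda>z. dird (dir 1) q z + dird (dir 2) q z)" if "poly2 q" for q
    by (rule dird_dir_3[OF that])
  have K12: "dird (dir 1) (dird (dir 2) p) = (\<lambda>_. 0)" "dird (dir 2) (dird (dir 1) p) = (\<lambda>_. 0)"
    "dird (dir 3) (dird (dir 1) p) = (\<lambda>_. 0)" "dird (dir 3) (dird (dir 2) p) = (\<lambda>_. 0)"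
    by (intro K; simp)+
  have K11: "dird (dir 1) (dird (dir 1) p) = (\<lambda>_. 0)" "dird (dir 2) (dird (dir 2) p) = (\<lambda>_. 0)"
    using K12 D3[OF poly2_dird[OF pp]] by (simp_all add: fun_eq_iff)
  obtain \<alpha> where a: "dird (dir 1) p = (\<lambda>_. \<alpha>)"
    using poly2_const_of_dird[OF poly2_dird[OF pp] K11(1) K12(2)] by blast
  obtain \<beta> where b: "dird (dir 2) p = (\<lambda>_. \<beta>)"
    using poly2_const_of_dird[OF poly2_dird[OF pp] K12(1) K11(2)] by blast
  let ?l = "\<lambda>z. \<alpha> * fst z + \<beta> * snd z + 0"
  have "dird (dir 1) (\<lambda>z. p z - ?l z) = (\<lambda>_. 0)" "dird (dir 2) (\<lambda>z. p z - ?l z) = (\<lambda>_. 0)"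
    unfolding dird_diff[OF pp dird_affine_fun(1)] dird_affine_fun(2) a b by (simp_all add: dir_def)
  then obtain \<gamma> where g: "(\<lambda>z. p z - ?l z) = (\<lambda>_. \<gamma>)"
    using poly2_const_of_dird[OF real_polynomial_function_diff[OF pp dird_affine_fun(1)]] by blast
  have "p z = \<alpha> * fst z + \<beta> * snd z + \<gamma>" for z using fun_cong[OF g, of z] by simp
  thus ?thesis using that by blast
qed

section \<open>Polynomial pieces of a spline\<close>

text \<open>\<open>ramp m\<close> is the primitive of the univariate cardinal B-spline of degree
  \<open>m\<close>. Averaging the hat function repeatedly in a single direction produces differences
  of such functions.\<close>

primrec ramp :: "nat \<Rightarrow> real \<Rightarrow> real" where
  "ramp 0 t = max 0 (min 1 t)"
| "ramp (Suc m) t = integral {0..1} (\<lambda>s. ramp m (t - s))"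

lemma ramp_dir_avg: "dir_avg (dir 1) (\<lambda>z. ramp m (fst z)) = (\<lambda>z. ramp (Suc m) (fst z))"
  by (simp add: dir_avg_def dir_def)

lemma continuous_ramp: "continuous_on UNIV (\<lambda>z::point. ramp m (fst z))"
proof (induction m)
  case 0
  thus ?case by (simp, intro continuous_intros)
next
  case (Suc m)
  from continuous_dir_avg[OF Suc, of "dir 1"] show ?case unfolding ramp_dir_avg .
qed

text \<open>The ramp is treated as a function on the plane that is constant along
  \<open>dir 2\<close>, so that \<open>poly2_of_two_dird\<close> also serves for this univariate
  integration.\<close>

lemma ramp_piece: "\<exists>P. poly2 P \<and> (\<forall>z. of_int a < fst z \<and> fst z < of_int a + 1 \<longrightarrow> ramp m (fst z) = P z)"
proof (induction m arbitrary: a)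
  case 0
  have lin: "poly2 (\<lambda>z. fst z)" by (intro poly2_linear bounded_linear_fst)
  consider "a < 0" | "a = 0" | "a \<ge> 1" by linarith
  thus ?case
  proof cases
    case 1
    hence "of_int a + 1 \<le> (0::real)" by linarith
    hence "ramp 0 (fst z) = 0" if "fst z < of_int a + 1" for z :: point
      using that by (simp add: max_def min_def)
    thus ?thesis using poly2_const by blast
  next
    case 2
    thus ?thesis using lin by (intro exI[of _ fst]) auto
  next
    case 3
    hence "(1::real) \<le> of_int a" by linarith
    hence "ramp 0 (fst z) = 1" if "of_int a < fst z" for z :: point
      using that by (simp add: max_def min_def)
    thus ?thesis using poly2_const by blast
  qed
next
  case (Suc m)
  define S :: "point set" where "S = {z. of_int a < fst z \<and> fst z < of_int a + 1}"
  obtain P where P: "poly2 P" "\<And>z. z \<in> S \<Longrightarrow> ramp m (fst z) = P z"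
    using Suc[of a] by (auto simp: S_def)
  obtain Q where Q: "poly2 Q" "\<And>z. of_int (a - 1) < fst z \<and> fst z < of_int (a - 1) + 1 \<Longrightarrow> ramp m (fst z) = Q z"
    using Suc[of "a - 1"] by blast
  \<comment> \<open>The piece on the unit interval to the left, translated onto \<open>S\<close>;
    the derivative of the average is the difference of the two pieces.\<close>
  define Q' where "Q' = (\<lambda>z. Q (1 *\<^sub>R z + (- dir 1)))"
  have Q': "poly2 Q'" unfolding Q'_def by (rule poly2_affine[OF Q(1)])
  have QS: "ramp m (fst z - 1) = Q' z" if "z \<in> S" for z
    using Q(2)[of "1 *\<^sub>R z + (- dir 1)"] that by (simp add: S_def Q'_def dir_def)
  have S: "open S" "connected S" "S \<noteq> {}"
  proof -
    show "open S" unfolding S_def Collect_conj_eq by (intro open_Int open_Collect_less continuous_intros)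
    have "S = {of_int a <..< of_int a + 1} \<times> UNIV" by (auto simp: S_def)
    hence "convex S" by (simp add: convex_Times)
    thus "connected S" by (rule convex_connected)
    have "(of_int a + 1/2, 0) \<in> S" by (simp add: S_def)
    thus "S \<noteq> {}" by blast
  qed
  have d1: "has_dird (\<lambda>z. ramp (Suc m) (fst z)) (dir 1) ((\<lambda>z. P z - Q' z) z) z" if "z \<in> S" for z
    using has_dird_dir_avg[OF continuous_ramp[of m], of "dir 1" z] unfolding ramp_dir_avg
    by (simp add: P(2)[OF that] QS[OF that, symmetric] dir_def)
  have d2: "has_dird (\<lambda>z. ramp (Suc m) (fst z)) (dir 2) ((\<lambda>_. 0) z) z" for z
    by (simp add: has_dird_def dir_def)
  have ne: "(1::3) \<noteq> 2" by simp
  obtain R where "poly2 R" "\<And>z. z \<in> S \<Longrightarrow> ramp (Suc m) (fst z) = R z"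
    using poly2_of_two_dird[OF ne S real_polynomial_function_diff[OF P(1) Q'] poly2_const d1 d2] by metis
  thus ?case by (auto simp: S_def)
qed

text \<open>Where \<open>X\<close> and \<open>Y\<close> differ by at most 1 the hat splits into
  summands of one coordinate each: the smaller coordinate makes it rise, and the larger one, delayed
  by 1, makes it fall again.\<close>

lemma ramp_hat:
  "max 0 (1 - max \<bar>X - 1\<bar> (max \<bar>Y - 1\<bar> \<bar>X - Y\<bar>)) =
    (if \<bar>X - Y\<bar> \<le> 1 then ramp 0 (min X Y) - ramp 0 (max X Y - 1) else 0)" for X Y :: real
proof -
  have le: "max 0 (1 - max \<bar>X - 1\<bar> (max \<bar>Y - 1\<bar> \<bar>X - Y\<bar>)) =
    (if \<bar>X - Y\<bar> \<le> 1 then max 0 (min 1 Y) - max 0 (min 1 (X - 1)) else 0)" if "Y \<le> X" for X Y :: real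
    using that by (simp add: max_def min_def abs_if)
  show ?thesis
  proof (cases "Y \<le> X")
    case True
    show ?thesis unfolding ramp.simps min_absorb2[OF True] max_absorb1[OF True] by (rule le[OF True])
  next
    case False
    hence XY: "X \<le> Y" by simp
    have ac: "max \<bar>X - 1\<bar> (max \<bar>Y - 1\<bar> \<bar>X - Y\<bar>) = max \<bar>Y - 1\<bar> (max \<bar>X - 1\<bar> \<bar>Y - X\<bar>)"
      by (simp add: max.left_commute abs_minus_commute)
    show ?thesis unfolding ramp.simps min_absorb1[OF XY] max_absorb2[OF XY] ac
      unfolding abs_minus_commute[of X Y] by (rule le[OF XY])
  qed
qed

text \<open>The two transversal coordinates in which repeated averaging along \<open>dir k\<close> is a common shift.\<close>

definition shear :: "3 \<Rightarrow> point \<Rightarrow> real \<times> real"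
  where "shear k z = (if k = 1 then (fst z, fst z - snd z + 1) else
    if k = 2 then (snd z, snd z - fst z + 1) else (fst z, snd z))"

text \<open>Averaging along \<open>dir k\<close> shifts both sheared coordinates by the same amount.
  Their difference and their order do not change, so the average acts on the two ramps
  separately.\<close>

lemma box_spline_single:
  "(dir_avg (dir k) ^^ m) courant_hat z =
     (if \<bar>fst (shear k z) - snd (shear k z)\<bar> \<le> 1 then
        ramp m (min (fst (shear k z)) (snd (shear k z))) - ramp m (max (fst (shear k z)) (snd (shear k z)) - 1)
      else 0)"
proof (induction m arbitrary: z)
  case 0
  have "courant_hat z = max 0 (1 - max \<bar>fst (shear k z) - 1\<bar> (max \<bar>snd (shear k z) - 1\<bar> \<bar>fst (shear k z) - snd (shear k z)\<bar>))"
    using exhaust_3[of k]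
  proof (elim disjE)
    assume "k = 1"
    moreover have "fst z - (fst z - snd z + 1) = snd z - 1" by simp
    ultimately show ?thesis
      by (simp add: courant_hat_eq courant_formula_def case_prod_beta shear_def max.commute)
  next
    assume "k = 2"
    moreover have "snd z - (snd z - fst z + 1) = fst z - 1" by simp
    ultimately show ?thesis
      by (simp add: courant_hat_eq courant_formula_def case_prod_beta shear_def max.commute max.left_commute
          abs_minus_commute)
  next
    assume "k = 3"
    thus ?thesis by (simp add: courant_hat_eq courant_formula_def case_prod_beta shear_def)
  qed
  thus ?case unfolding ramp_hat by simp
next
  case (Suc m)
  let ?X = "fst (shear k z)" and ?Y = "snd (shear k z)"
  have sh: "fst (shear k (z - t *\<^sub>R dir k)) = ?X - t" "snd (shear k (z - t *\<^sub>R dir k)) = ?Y - t" for t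
    using exhaust_3[of k] by (auto simp: shear_def dir_def)
  have mm: "min (?X - t) (?Y - t) = min ?X ?Y - t" "max (?X - t) (?Y - t) - 1 = max ?X ?Y - 1 - t" for t
    by (simp_all add: min_def max_def)
  have int: "(\<lambda>t. ramp m (x - t)) integrable_on {0..1}" for x
  proof (rule integrable_continuous_real)
    have "continuous_on {0..1} (\<lambda>t. (\<lambda>z::point. ramp m (fst z)) (x - t, 0))"
      by (rule continuous_on_compose2[OF continuous_ramp]) (auto intro!: continuous_intros)
    thus "continuous_on {0..1} (\<lambda>t. ramp m (x - t))" by simp
  qed
  have "(dir_avg (dir k) ^^ Suc m) courant_hat z
      = integral {0..1} (\<lambda>t. if \<bar>?X - ?Y\<bar> \<le> 1 then ramp m (min ?X ?Y - t) - ramp m (max ?X ?Y - 1 - t) else 0)"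
    by (cases "\<bar>?X - ?Y\<bar> \<le> 1") (simp_all add: dir_avg_def Suc sh mm)
  thus ?case by (cases "\<bar>?X - ?Y\<bar> \<le> 1") (simp_all add: integral_diff int)
qed

lemma box_spline_single_direction:
  assumes "\<forall>i. i \<noteq> k \<longrightarrow> n $ i = 1"
  shows "box_spline n = (dir_avg (dir k) ^^ (n $ k - 1)) courant_hat"
  using exhaust_3[of k] assms by (auto simp: box_spline_def)

lemma ramp_comp_piece:
  assumes "bounded_linear X" "X (dir j) = 0"
  obtains p where "poly2 p" "\<And>z. of_int a < X z + d \<Longrightarrow> X z + d < of_int a + 1 \<Longrightarrow> ramp m (X z + d) = p z"
    "dird (dir j) p = (\<lambda>_. 0)"
proof -
  obtain P where P: "poly2 P" "\<And>z. of_int a < fst z \<and> fst z < of_int a + 1 \<Longrightarrow> ramp m (fst z) = P z"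
    using ramp_piece by metis
  let ?p = "\<lambda>z. P (X z + d, 0)"
  have "polynomial_function (\<lambda>z. (X z + d) *\<^sub>R dir 1)"
  proof -
    have "polynomial_function (\<lambda>z. X z + d)"
      unfolding real_polynomial_function_eq[symmetric] by (intro poly2_add poly2_const poly2_linear assms(1))
    moreover have "polynomial_function (\<lambda>t::real. t *\<^sub>R dir 1)"
      by (intro polynomial_function_bounded_linear bounded_linear_scaleR_left)
    ultimately have "polynomial_function ((\<lambda>t. t *\<^sub>R dir 1) \<circ> (\<lambda>z. X z + d))"
      by (rule polynomial_function_compose)
    thus ?thesis by (simp add: o_def)
  qed
  hence "polynomial_function (P \<circ> (\<lambda>z. (X z + d) *\<^sub>R dir 1))"
    using P(1) polynomial_function_compose real_polynomial_function_eq by blast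
  hence "poly2 ?p" by (simp add: o_def real_polynomial_function_eq dir_def)
  moreover have "ramp m (X z + d) = ?p z" if "of_int a < X z + d" "X z + d < of_int a + 1" for z
    using P(2)[of "(X z + d, 0)"] that by simp
  moreover have "dird (dir j) ?p = (\<lambda>_. 0)"
  proof
    fix z
    have "X (z + h *\<^sub>R dir j) = X z" for h
      using assms by (simp add: bounded_linear.linear linear_add linear_scale)
    hence "has_dird ?p (dir j) 0 z" by (simp add: has_dird_def)
    thus "dird (dir j) ?p z = 0" by (rule has_dird_imp_dird)
  qed
  ultimately show ?thesis using that[of ?p] by blast
qed

lemma dird_mixed_zero:
  assumes "poly2 p" "poly2 q" "dird u p = (\<lambda>_. 0)" "dird w q = (\<lambda>_. 0)"
  shows "dird u (dird w (\<lambda>z. p z - q z)) = (\<lambda>_. 0)"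
proof -
  have "dird u (dird w p) = (\<lambda>_. 0)"
    using dird_commute[OF assms(1), of u w] assms(3) by simp
  thus ?thesis using assms by (simp add: dird_diff)
qed

lemma index_cover: "i \<noteq> j \<Longrightarrow> i \<noteq> k \<Longrightarrow> j \<noteq> k \<Longrightarrow> l = i \<or> l = j \<or> l = (k :: 3)"
proof -
  assume "i \<noteq> j" "i \<noteq> k" "j \<noteq> k"
  hence "{i, j, k} = UNIV" by (intro card_subset_eq) auto
  thus ?thesis by blast
qed

text \<open>Within one triangle the order of the sheared coordinates and the comparison of their
  distance with 1 are fixed. The box spline is there either zero or a difference of two ramps, one
  constant along \<open>dir i\<close> and the other along \<open>dir j\<close>, which D_i D_j
  annihilates.\<close>

lemma single_piece:
  assumes "\<forall>i. i \<noteq> k \<longrightarrow> n $ i = 1" "i \<noteq> j" "i \<noteq> k" "j \<noteq> k"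
  obtains p where "poly2 p" "\<And>z. z \<in> cell \<kappa> \<Longrightarrow> box_spline n z = p z"
    "dird (dir i) (dird (dir j) p) = (\<lambda>_. 0)"
proof -
  note goal = that
  have main: ?thesis
    if X: "bounded_linear X" "X (dir \<alpha>) = 0" and Y: "bounded_linear Y" "Y (dir \<beta>) = 0"
      and ij: "(\<alpha>, \<beta>) = (i, j) \<or> (\<alpha>, \<beta>) = (j, i)"
      and sh: "\<And>z. shear k z = (X z, Y z + d)"
      and cX: "\<And>z. z \<in> cell \<kappa> \<Longrightarrow> of_int a < X z \<and> X z < of_int a + 1"
      and cY: "\<And>z. z \<in> cell \<kappa> \<Longrightarrow> of_int b < Y z + d \<and> Y z + d < of_int b + 1"
      and dis: "(\<forall>z\<in>cell \<kappa>. \<bar>X z - (Y z + d)\<bar> \<le> 1) \<or> (\<forall>z\<in>cell \<kappa>. 1 \<le> \<bar>X z - (Y z + d)\<bar>)"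
      and cmp: "(\<forall>z\<in>cell \<kappa>. Y z + d \<le> X z) \<or> (\<forall>z\<in>cell \<kappa>. X z \<le> Y z + d)"
    for X Y :: "point \<Rightarrow> real" and \<alpha> \<beta> :: 3 and a b :: int and d :: real
  proof -
    let ?m = "n $ k - 1"
    have B: "box_spline n z = (if \<bar>X z - (Y z + d)\<bar> \<le> 1
        then ramp ?m (min (X z) (Y z + d)) - ramp ?m (max (X z) (Y z + d) - 1) else 0)" for z
      unfolding box_spline_single_direction[OF assms(1)] box_spline_single sh fst_conv snd_conv ..
    \<comment> \<open>The alternatives in \<open>dis\<close> overlap at distance 1; there the two
      ramps have the same argument and cancel.\<close>
    have B0: "box_spline n z = 0" if "1 \<le> \<bar>X z - (Y z + d)\<bar>" for z
    proof (cases "\<bar>X z - (Y z + d)\<bar> = 1")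
      case True
      hence "min (X z) (Y z + d) = max (X z) (Y z + d) - 1" by (auto simp: min_def max_def abs_if split: if_splits)
      thus ?thesis by (simp add: B)
    qed (use that in \<open>simp add: B\<close>)
    have sym: "dird (dir i) (dird (dir j) p) = (\<lambda>_. 0)" if "poly2 p" "dird (dir \<alpha>) (dird (dir \<beta>) p) = (\<lambda>_. 0)" for p
      using that ij dird_commute[OF that(1), of "dir i" "dir j"] by auto
    consider (far) "\<forall>z\<in>cell \<kappa>. 1 \<le> \<bar>X z - (Y z + d)\<bar>" | (ge) "\<forall>z\<in>cell \<kappa>. \<bar>X z - (Y z + d)\<bar> \<le> 1" "\<forall>z\<in>cell \<kappa>. Y z + d \<le> X z" | (le) "\<forall>z\<in>cell \<kappa>. \<bar>X z - (Y z + d)\<bar> \<le> 1" "\<forall>z\<in>cell \<kappa>. X z \<le> Y z + d"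
      using dis cmp by blast
    thus ?thesis
    proof cases
      case far
      show ?thesis by (rule goal[of "\<lambda>_. 0", OF poly2_const]) (use far B0 in auto)
    next
      case ge
      note near = ge(1) and le = ge(2)
      obtain p where p: "poly2 p" "\<And>z. of_int b < Y z + d \<Longrightarrow> Y z + d < of_int b + 1 \<Longrightarrow> ramp ?m (Y z + d) = p z"
          "dird (dir \<beta>) p = (\<lambda>_. 0)"
        using ramp_comp_piece[OF Y, of b d ?m] by metis
      obtain q where q: "poly2 q" "\<And>z. of_int (a - 1) < X z + (- 1) \<Longrightarrow> X z + (- 1) < of_int (a - 1) + 1 \<Longrightarrow> ramp ?m (X z + (- 1)) = q z"
          "dird (dir \<alpha>) q = (\<lambda>_. 0)"
        using ramp_comp_piece[OF X, of "a - 1" "- 1" ?m] by metis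
      have pq: "poly2 (\<lambda>z. p z - q z)" using p(1) q(1) by (rule real_polynomial_function_diff)
      show ?thesis
      proof (rule goal[OF pq _ sym[OF pq]])
        fix z assume z: "z \<in> cell \<kappa>"
        have "ramp ?m (Y z + d) = p z" "ramp ?m (X z + (- 1)) = q z"
          using p(2)[of z] q(2)[of z] cX[OF z] cY[OF z] by simp_all
        moreover have "min (X z) (Y z + d) = Y z + d" "max (X z) (Y z + d) = X z"
          using le z by (simp_all add: min_absorb2 max_absorb1)
        ultimately show "box_spline n z = p z - q z"
          unfolding B if_P[OF bspec[OF near z]] by simp
      next
        show "dird (dir \<alpha>) (dird (dir \<beta>) (\<lambda>z. p z - q z)) = (\<lambda>_. 0)"
          using dird_mixed_zero[OF p(1) q(1) p(3) q(3)] dird_commute[OF pq, of "dir \<alpha>" "dir \<beta>"] by simp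
      qed
    next
      case le
      note near = le(1) and le = le(2)
      obtain q where q: "poly2 q" "\<And>z. of_int (b - 1) < Y z + (d - 1) \<Longrightarrow> Y z + (d - 1) < of_int (b - 1) + 1 \<Longrightarrow> ramp ?m (Y z + (d - 1)) = q z"
          "dird (dir \<beta>) q = (\<lambda>_. 0)"
        using ramp_comp_piece[OF Y, of "b - 1" "d - 1" ?m] by metis
      obtain p where p: "poly2 p" "\<And>z. of_int a < X z + 0 \<Longrightarrow> X z + 0 < of_int a + 1 \<Longrightarrow> ramp ?m (X z + 0) = p z"
          "dird (dir \<alpha>) p = (\<lambda>_. 0)"
        using ramp_comp_piece[OF X, of a 0 ?m] by metis
      have pq: "poly2 (\<lambda>z. p z - q z)" using p(1) q(1) by (rule real_polynomial_function_diff)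
      show ?thesis
      proof (rule goal[OF pq _ sym[OF pq]])
        fix z assume z: "z \<in> cell \<kappa>"
        have "ramp ?m (X z) = p z" "ramp ?m (Y z + d - 1) = q z"
          using p(2)[of z] q(2)[of z] cX[OF z] cY[OF z] by (simp_all add: algebra_simps)
        moreover have "min (X z) (Y z + d) = X z" "max (X z) (Y z + d) = Y z + d"
          using le z by (simp_all add: min_absorb1 max_absorb2)
        ultimately show "box_spline n z = p z - q z"
          unfolding B if_P[OF bspec[OF near z]] by simp
      next
        show "dird (dir \<alpha>) (dird (dir \<beta>) (\<lambda>z. p z - q z)) = (\<lambda>_. 0)"
          by (rule dird_mixed_zero[OF p(1) q(1) p(3) q(3)])
      qed
    qed
  qed
  have cellD: "of_int (\<kappa> l) < form l z \<and> form l z < of_int (\<kappa> l) + 1" if "z \<in> cell \<kappa>" for l z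
    using that by (simp add: cell_def)
  have sgn: "(\<forall>z\<in>cell \<kappa>. of_int c \<le> form l z) \<or> (\<forall>z\<in>cell \<kappa>. form l z \<le> of_int c)" for l c
  proof (cases "c \<le> \<kappa> l")
    case True
    hence "of_int c \<le> form l z" if "z \<in> cell \<kappa>" for z using cellD[OF that, of l] by linarith
    thus ?thesis by blast
  next
    case False
    hence "form l z \<le> of_int c" if "z \<in> cell \<kappa>" for z using cellD[OF that, of l] by linarith
    thus ?thesis by blast
  qed
  \<comment> \<open>The comparison with 1 is decided by the grid lines \<open>c - 1\<close> and
    \<open>c + 1\<close>, neither of which crosses the triangle.\<close>
  have sgn2: "(\<forall>z\<in>cell \<kappa>. \<bar>form l z - of_int c\<bar> \<le> 1) \<or> (\<forall>z\<in>cell \<kappa>. 1 \<le> \<bar>form l z - of_int c\<bar>)" for l c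
    using sgn[of "c - 1" l] sgn[of "c + 1" l] by (elim disjE) (fastforce simp: abs_if)+
  have forms: "form 1 = (\<lambda>z. snd z)" "form 2 = (\<lambda>z. fst z)" "form 3 = (\<lambda>z. fst z - snd z)" by (auto simp: form_def)
  have lin: "bounded_linear (\<lambda>z::point. fst z)" "bounded_linear (\<lambda>z::point. snd z)"
    "bounded_linear (\<lambda>z::point. fst z - snd z)" "bounded_linear (\<lambda>z::point. snd z - fst z)"
    by (intro bounded_linear_sub bounded_linear_fst bounded_linear_snd)+
  have k: "k = 1 \<or> k = 2 \<or> k = 3" by (rule exhaust_3)
  thus ?thesis
  proof (elim disjE)
    assume k: "k = 1"
    \<comment> \<open>For \<open>k = 1\<close> the first sheared coordinate \<open>fst z\<close> is
      constant along \<open>dir 2\<close> and the second, \<open>fst z - snd z + 1\<close>, along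
      \<open>dir 3\<close>. The other two cases are analogous.\<close>
    have ij: "(2, 3) = (i, j) \<or> (2, 3) = (j, i)" using assms(2-4) exhaust_3[of i] exhaust_3[of j] k by auto
    show ?thesis
    proof (rule main[OF lin(1) _ lin(3) _ ij, of 1 "\<kappa> 2" "\<kappa> 3 + 1"])
      show "(\<forall>z\<in>cell \<kappa>. fst z - snd z + 1 \<le> fst z) \<or> (\<forall>z\<in>cell \<kappa>. fst z \<le> fst z - snd z + 1)"
        using sgn[of 1 1] by (simp add: forms)
      show "(\<forall>z\<in>cell \<kappa>. \<bar>fst z - (fst z - snd z + 1)\<bar> \<le> 1) \<or> (\<forall>z\<in>cell \<kappa>. 1 \<le> \<bar>fst z - (fst z - snd z + 1)\<bar>)"
        using sgn2[of 1 1] by (simp add: forms)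
    qed (use cellD[of _ 2] cellD[of _ 3] in \<open>force simp: shear_def k dir_def forms\<close>)+
  next
    assume k: "k = 2"
    have ij: "(1, 3) = (i, j) \<or> (1, 3) = (j, i)" using assms(2-4) exhaust_3[of i] exhaust_3[of j] k by auto
    show ?thesis
    proof (rule main[OF lin(2) _ lin(4) _ ij, of 1 "\<kappa> 1" "- \<kappa> 3"])
      show "(\<forall>z\<in>cell \<kappa>. snd z - fst z + 1 \<le> snd z) \<or> (\<forall>z\<in>cell \<kappa>. snd z \<le> snd z - fst z + 1)"
        using sgn[of 1 2] by (simp add: forms)
      show "(\<forall>z\<in>cell \<kappa>. \<bar>snd z - (snd z - fst z + 1)\<bar> \<le> 1) \<or> (\<forall>z\<in>cell \<kappa>. 1 \<le> \<bar>snd z - (snd z - fst z + 1)\<bar>)"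
        using sgn2[of 2 1] by (simp add: forms)
    qed (use cellD[of _ 1] cellD[of _ 3] in \<open>force simp: shear_def k dir_def forms\<close>)+
  next
    assume k: "k = 3"
    have ij: "(2, 1) = (i, j) \<or> (2, 1) = (j, i)" using assms(2-4) exhaust_3[of i] exhaust_3[of j] k by auto
    show ?thesis
    proof (rule main[OF lin(1) _ lin(2) _ ij, of 0 "\<kappa> 2" "\<kappa> 1"])
      show "(\<forall>z\<in>cell \<kappa>. snd z + 0 \<le> fst z) \<or> (\<forall>z\<in>cell \<kappa>. fst z \<le> snd z + 0)"
        using sgn[of 0 3] by (simp add: forms)
      show "(\<forall>z\<in>cell \<kappa>. \<bar>fst z - (snd z + 0)\<bar> \<le> 1) \<or> (\<forall>z\<in>cell \<kappa>. 1 \<le> \<bar>fst z - (snd z + 0)\<bar>)"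
        using sgn2[of 3 0] by (simp add: forms)
    qed (use cellD[of _ 1] cellD[of _ 2] in \<open>auto simp: shear_def k dir_def forms\<close>)
  qed
qed

lemma finite_act: "finite (act n \<kappa>)"
proof -
  have "v \<in> {\<kappa> 2 - hi n 2 .. \<kappa> 2 - lo n 2} \<times> {\<kappa> 1 - hi n 1 .. \<kappa> 1 - lo n 1}" if "v \<in> act n \<kappa>" for v
  proof -
    have "lo n j \<le> \<kappa> j - iform j v \<and> \<kappa> j - iform j v < hi n j" for j using that by (simp add: act_def)
    from this[of 1] this[of 2] show ?thesis by (cases v) (simp add: iform_def)
  qed
  thus ?thesis by (meson finite_SigmaI finite_atLeastAtMost_int finite_subset subsetI)
qed

lemma spl_act:
  assumes "\<forall>i. n $ i \<ge> 1" "z \<in> cell \<kappa>"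
  shows "spl n c z = (\<Sum>v\<in>act n \<kappa>. c v * box_spline n (z - lat v))"
  by (rule spl_eq[OF finite_act _ assms(1)]) (rule mem_act[OF assms])

lemma dird_sum:
  assumes "finite A" "\<And>i. i \<in> A \<Longrightarrow> poly2 (f i)"
  shows "dird u (\<lambda>z. \<Sum>i\<in>A. f i z) = (\<lambda>z. \<Sum>i\<in>A. dird u (f i) z)"
  by (rule ext) (intro has_dird_imp_dird has_dird_sum has_dird_poly2 assms)

lemma spl_single_piece:
  assumes n: "\<forall>i. n $ i \<ge> 1" and single: "\<forall>i. i \<noteq> k \<longrightarrow> n $ i = 1" and ij: "i \<noteq> j" "i \<noteq> k" "j \<noteq> k"
  obtains p where "poly2 p" "\<And>z. z \<in> cell \<kappa> \<Longrightarrow> spl n c z = p z"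
    "dird (dir i) (dird (dir j) p) = (\<lambda>_. 0)"
proof -
  have "\<exists>q. poly2 q \<and> (\<forall>z\<in>cell \<kappa>. c v * box_spline n (z - lat v) = q z) \<and> dird (dir i) (dird (dir j) q) = (\<lambda>_. 0)" for v
  proof -
    obtain p where p: "poly2 p" "\<And>z. z \<in> cell (\<lambda>j. \<kappa> j - iform j v) \<Longrightarrow> box_spline n z = p z"
        "dird (dir i) (dird (dir j) p) = (\<lambda>_. 0)"
      by (rule single_piece[OF single ij, where \<kappa> = "\<lambda>j. \<kappa> j - iform j v"]) (rule that)
    define p' where "p' = (\<lambda>z. p (1 *\<^sub>R z + (- lat v)))"
    have p': "poly2 p'" unfolding p'_def by (rule poly2_affine[OF p(1)])
    have "z - lat v \<in> cell (\<lambda>j. \<kappa> j - iform j v)" if "z \<in> cell \<kappa>" for z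
      using that by (simp add: cell_def form_diff form_lat algebra_simps)
    hence "\<forall>z\<in>cell \<kappa>. c v * box_spline n (z - lat v) = c v * p' z"
      using p(2) by (simp add: p'_def)
    moreover have "dird (dir j) p' = (\<lambda>z. dird (dir j) p (1 *\<^sub>R z + (- lat v)))"
      unfolding p'_def dird_affine[OF p(1)] by simp
    hence "dird (dir i) (dird (dir j) p') = (\<lambda>_. 0)"
      using dird_affine[OF poly2_dird[OF p(1)], of "dir i" "dir j" 1 "- lat v"] p(3) by simp
    hence "dird (dir i) (dird (dir j) (\<lambda>z. c v * p' z)) = (\<lambda>_. 0)"
      by (simp add: dird_cmult p' poly2_dird)
    ultimately show ?thesis using p' poly2_mult[OF poly2_const p'] by blast
  qed
  then obtain q where q: "\<And>v. poly2 (q v)" "\<And>v z. z \<in> cell \<kappa> \<Longrightarrow> c v * box_spline n (z - lat v) = q v z"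
    "\<And>v. dird (dir i) (dird (dir j) (q v)) = (\<lambda>_. 0)" by metis
  let ?p = "\<lambda>z. \<Sum>v\<in>act n \<kappa>. q v z"
  have "poly2 ?p" using q(1) by (intro real_polynomial_function_sum finite_act)
  moreover have "spl n c z = ?p z" if "z \<in> cell \<kappa>" for z
    unfolding spl_act[OF n that] by (intro sum.cong refl q(2)[OF that])
  moreover have "dird (dir i) (dird (dir j) ?p) = (\<lambda>_. 0)"
    by (simp add: dird_sum finite_act q poly2_dird)
  ultimately show ?thesis using that[of ?p] by blast
qed

text \<open>The pieces of the derivatives are known by induction, and two raised directions suffice
  to integrate them; with a single one the ramps take over. Pairs of multiplicities equal to 1,
  which \<open>kpoly_raise\<close> treats separately, occur only in the second case.\<close>

lemma spl_piece:
  assumes "\<forall>i. n $ i \<ge> 1" "valid \<kappa>"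
  shows "\<exists>p\<in>kpoly n. \<forall>z\<in>cell \<kappa>. spl n c z = p z"
  using assms(1)
proof (induction n arbitrary: c rule: box_induct)
  case one
  have "\<exists>\<alpha> \<beta> \<gamma>. \<forall>z\<in>cell \<kappa>. spl ones c z = \<alpha> * fst z + \<beta> * snd z + \<gamma>"
  proof (cases "\<kappa> 3 = \<kappa> 2 - \<kappa> 1")
    case True
    let ?A = "c (\<kappa> 2 - 1, \<kappa> 1 - 1)" and ?B = "c (\<kappa> 2, \<kappa> 1 - 1)" and ?C = "c (\<kappa> 2, \<kappa> 1)"
    show ?thesis
      by (rule exI[of _ "?B - ?A"], rule exI[of _ "?C - ?B"],
          rule exI[of _ "?A - (?B - ?A) * \<kappa> 2 - (?C - ?B) * \<kappa> 1"])
        (use spl_ones(1)[OF assms(2) subsetD[OF cell_subset_ccell] True, of _ c] in \<open>simp add: algebra_simps\<close>)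
  next
    case False
    hence k3: "\<kappa> 3 = \<kappa> 2 - \<kappa> 1 - 1" using assms(2) by (auto simp: valid_def)
    let ?A = "c (\<kappa> 2 - 1, \<kappa> 1 - 1)" and ?B = "c (\<kappa> 2 - 1, \<kappa> 1)" and ?C = "c (\<kappa> 2, \<kappa> 1)"
    show ?thesis
      by (rule exI[of _ "?C - ?B"], rule exI[of _ "?B - ?A"],
          rule exI[of _ "?A - (?C - ?B) * \<kappa> 2 - (?B - ?A) * \<kappa> 1"])
        (use spl_ones(2)[OF assms(2) subsetD[OF cell_subset_ccell] k3, of _ c] in \<open>simp add: algebra_simps\<close>)
  qed
  then obtain \<alpha> \<beta> \<gamma> where s: "\<forall>z\<in>cell \<kappa>. spl ones c z = \<alpha> * fst z + \<beta> * snd z + \<gamma>" by blast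
  have "(\<lambda>z. \<alpha> * fst z + \<beta> * snd z + \<gamma>) \<in> kpoly ones"
    unfolding kpoly_def by (simp add: dird_affine_fun)
  thus ?case using s by (intro bexI[of _ "\<lambda>z. \<alpha> * fst z + \<beta> * snd z + \<gamma>"])
next
  case (step n k)
  note n = step.hyps(1) and k = step.hyps(2)
  have "\<exists>p. p \<in> kpoly (n - axis l 1) \<and> (\<forall>z\<in>cell \<kappa>. has_dird (spl n c) (dir l) (p z) z)" if l: "n $ l \<ge> 2" for l
  proof -
    obtain p where p: "p \<in> kpoly (n - axis l 1)" "\<forall>z\<in>cell \<kappa>. spl (n - axis l 1) (nabla l c) z = p z"
      using step.IH[OF l] by blast
    have "has_dird (spl n c) (dir l) (p z) z" if "z \<in> cell \<kappa>" for z
      using has_dird_spl[OF n l, of c z] p(2) that by simp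
    thus ?thesis using p(1) by blast
  qed
  then obtain q where q: "\<And>l. n $ l \<ge> 2 \<Longrightarrow> q l \<in> kpoly (n - axis l 1)"
    "\<And>l z. n $ l \<ge> 2 \<Longrightarrow> z \<in> cell \<kappa> \<Longrightarrow> has_dird (spl n c) (dir l) (q l z) z" by metis
  note cell = open_cell connected_cell cell_nonempty[OF assms(2)]
  have "\<exists>P. poly2 P \<and> (\<forall>z\<in>cell \<kappa>. spl n c z = P z) \<and>
    (\<forall>i j. i \<noteq> j \<longrightarrow> n $ i = 1 \<longrightarrow> n $ j = 1 \<longrightarrow> dird (dir i) (dird (dir j) P) = (\<lambda>_. 0))"
  proof (cases "\<exists>l. l \<noteq> k \<and> n $ l \<ge> 2")
    case True
    then obtain l where l: "l \<noteq> k" "n $ l \<ge> 2" by blast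
    obtain P where P: "poly2 P" "\<And>z. z \<in> cell \<kappa> \<Longrightarrow> spl n c z = P z"
      using poly2_of_two_dird[OF l(1) cell kpoly_poly2[OF q(1)[OF l(2)]] kpoly_poly2[OF q(1)[OF k]]
          q(2)[OF l(2)] q(2)[OF k]] by metis
    have no_pair: "\<not> (i \<noteq> j \<and> n $ i = 1 \<and> n $ j = 1)" for i j
    proof
      assume a: "i \<noteq> j \<and> n $ i = 1 \<and> n $ j = 1"
      hence "i \<noteq> k" "i \<noteq> l" "j \<noteq> k" "j \<noteq> l" using k l(2) by auto
      thus False using index_cover[of i j k l] a l(1) by auto
    qed
    show ?thesis by (rule exI[of _ P]) (use P no_pair in auto)
  next
    case False
    have single: "\<forall>i. i \<noteq> k \<longrightarrow> n $ i = 1"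
    proof (intro allI impI)
      fix i assume "i \<noteq> k"
      hence "\<not> n $ i \<ge> 2" using False by blast
      moreover have "n $ i \<ge> 1" using n by blast
      ultimately show "n $ i = 1" by linarith
    qed
    obtain i j where ij: "i \<noteq> j" "i \<noteq> k" "j \<noteq> k"
      using that[of 1 2] that[of 1 3] that[of 2 3] exhaust_3[of k] by auto
    obtain P where P: "poly2 P" "\<And>z. z \<in> cell \<kappa> \<Longrightarrow> spl n c z = P z" "dird (dir i) (dird (dir j) P) = (\<lambda>_. 0)"
      using spl_single_piece[OF n single ij] by metis
    have "dird (dir i') (dird (dir j') P) = (\<lambda>_. 0)" if "i' \<noteq> j'" "n $ i' = 1" "n $ j' = 1" for i' j'
    proof -
      have "i' \<noteq> k" "j' \<noteq> k" using that k by auto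
      hence "(i', j') = (i, j) \<or> (i', j') = (j, i)"
        using index_cover[OF ij, of i'] index_cover[OF ij, of j'] that(1) by blast
      thus ?thesis using P(3) dird_commute[OF P(1), of "dir i" "dir j"] by auto
    qed
    thus ?thesis by (intro exI[of _ P]) (use P in simp)
  qed
  then obtain P where P': "poly2 P \<and> (\<forall>z\<in>cell \<kappa>. spl n c z = P z) \<and>
    (\<forall>i j. i \<noteq> j \<longrightarrow> n $ i = 1 \<longrightarrow> n $ j = 1 \<longrightarrow> dird (dir i) (dird (dir j) P) = (\<lambda>_. 0))" ..
  note P = conjunct1[OF P'] conjunct1[OF conjunct2[OF P']] conjunct2[OF conjunct2[OF P'], rule_format]
  have "dird (dir l) P = q l" if l: "n $ l \<ge> 2" for l
    by (rule dird_eq_on_open[OF P(1) kpoly_poly2[OF q(1)[OF l]] cell(1,3) _ q(2)[OF l]]) (use P(2) in auto)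
  hence "P \<in> kpoly n" using q(1) by (intro kpoly_raise[OF P(1) n _ P(3)]) auto
  thus ?case using P(2) by blast
qed

section \<open>Polynomials in the joint kernel are splines\<close>

text \<open>A two-sided discrete primitive of \<open>b\<close>, normalised to 0 at 0; at least one
  of the two intervals is always empty.\<close>

definition isum :: "(int \<Rightarrow> real) \<Rightarrow> int \<Rightarrow> real"
  where "isum b m = (\<Sum>i\<in>{1..m}. b i) - (\<Sum>i\<in>{m+1..0}. b i)"

lemma isum_step: "isum b m - isum b (m - 1) = b m"
proof (cases "m \<ge> 1")
  case True
  hence "{1..m} = insert m {1..m - 1}" by auto
  thus ?thesis using True by (simp add: isum_def)
next
  case False
  hence "{m..0} = insert m {m + 1..0}" by auto
  thus ?thesis using False by (simp add: isum_def)
qed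

lemma ex_antidifference:
  assumes "\<sigma> = 1 \<or> \<sigma> = - 1"
  obtains C :: "int \<Rightarrow> real" where "\<And>m. C m - C (m - \<sigma>) = b m"
  using assms
proof
  assume "\<sigma> = 1"
  thus ?thesis using that[of "isum b"] isum_step by simp
next
  assume s: "\<sigma> = - 1"
  have "- isum (\<lambda>m. b (m - 1)) m - - isum (\<lambda>m. b (m - 1)) (m - \<sigma>) = b m" for m
    using isum_step[of "\<lambda>m. b (m - 1)" "m + 1"] s by simp
  show ?thesis by (rule that) fact
qed

lemma ex_nabla: obtains c where "nabla k c = b"
proof -
  \<comment> \<open>\<open>\<mu>\<close> is a coordinate that grows by 1 along
    \<open>idir k\<close>. Each lattice line in this direction is represented by its point
    \<open>v - \<tau> (\<mu> v)\<close>, from which \<open>b\<close> is summed up along the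
    line.\<close>
  define \<mu> where "\<mu> v = (if k = 2 then snd v else fst v)" for v :: "int \<times> int"
  define \<tau> where "\<tau> t = (if k = 1 then (t, 0) else if k = 2 then (0, t) else (t, t))" for t :: int
  define c where "c v = isum (\<lambda>t. b (v - \<tau> (\<mu> v) + \<tau> t)) (\<mu> v)" for v
  have sh: "\<mu> (v - idir k) = \<mu> v - 1" "v - idir k - \<tau> (\<mu> v - 1) = v - \<tau> (\<mu> v)" for v
    using exhaust_3[of k] by (auto simp: \<mu>_def \<tau>_def idir_def prod_eq_iff)
  have "nabla k c v = b v" for v
    unfolding nabla_def c_def sh isum_step by simp
  thus ?thesis using that by blast
qed

text \<open>Provides the constants of integration for \<open>kpoly_spl\<close>. A polynomial that is
  constant along \<open>dir k\<close> is produced by coefficients depending on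
  \<open>iform k\<close> alone, for which averaging along \<open>dir k\<close> is trivial and
  integration along another direction is a univariate summation.\<close>

lemma kpoly_line:
  assumes "\<forall>i. n $ i \<ge> 1" "valid \<kappa>" "p \<in> kpoly n" "dird (dir k) p = (\<lambda>_. 0)"
  shows "\<exists>g. \<forall>z\<in>cell \<kappa>. p z = spl n (\<lambda>v. g (iform k v)) z"
  using assms(1,3,4)
proof (induction n arbitrary: p rule: box_induct)
  case one
  obtain \<alpha> \<beta> \<gamma> where p: "p = (\<lambda>z. \<alpha> * fst z + \<beta> * snd z + \<gamma>)" using kpoly_ones[OF one(1)] by blast
  have "\<alpha> * fst (dir k) + \<beta> * snd (dir k) = 0"
    using one(2) unfolding p dird_affine_fun by (metis)
  hence "\<exists>g. \<forall>v. g (iform k v) = \<alpha> * (of_int (fst v) + 1) + \<beta> * (of_int (snd v) + 1) + \<gamma>"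
    using exhaust_3[of k]
  proof (elim disjE)
    assume "k = 1" "\<alpha> * fst (dir k) + \<beta> * snd (dir k) = 0"
    thus ?thesis by (intro exI[of _ "\<lambda>m. \<beta> * (of_int m + 1) + \<gamma>"]) (simp add: dir_def iform_def)
  next
    assume "k = 2" "\<alpha> * fst (dir k) + \<beta> * snd (dir k) = 0"
    thus ?thesis by (intro exI[of _ "\<lambda>m. \<alpha> * (of_int m + 1) + \<gamma>"]) (simp add: dir_def iform_def)
  next
    assume "k = 3" and e: "\<alpha> * fst (dir k) + \<beta> * snd (dir k) = 0"
    hence "\<beta> = - \<alpha>" by (simp add: dir_def)
    with \<open>k = 3\<close> show ?thesis
      by (intro exI[of _ "\<lambda>m. \<alpha> * of_int m + \<gamma>"]) (simp add: iform_def algebra_simps)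
  qed
  then obtain g where g: "\<And>v. g (iform k v) = \<alpha> * (of_int (fst v) + 1) + \<beta> * (of_int (snd v) + 1) + \<gamma>" by blast
  have "p z = spl ones (\<lambda>v. g (iform k v)) z" if "z \<in> cell \<kappa>" for z
    using spl_affine[OF assms(2) subsetD[OF cell_subset_ccell that] g] by (simp add: p)
  thus ?case by blast
next
  case (step n j)
  note n = step.hyps(1) and j = step.hyps(2)
  show ?case
  proof (cases "j = k")
    case True
    have "p \<in> kpoly (n - axis k 1)"
      using kpoly_lower_null[OF step.prems _ n] j True by simp
    then obtain g where "\<forall>z\<in>cell \<kappa>. p z = spl (n - axis k 1) (\<lambda>v. g (iform k v)) z"
      using step.IH[OF j] step.prems(2) True by blast
    hence "\<forall>z\<in>cell \<kappa>. p z = spl n (\<lambda>v. g (iform k v)) z"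
      using spl_line_lower[OF n, of k g] j True by simp
    thus ?thesis by blast
  next
    case False
    have pp: "poly2 p" using step.prems(1) by (rule kpoly_poly2)
    have "dird (dir k) (dird (dir j) p) = (\<lambda>_. 0)"
      using dird_commute[OF pp, of "dir k" "dir j"] step.prems(2) by simp
    then obtain b where b: "\<forall>z\<in>cell \<kappa>. dird (dir j) p z = spl (n - axis j 1) (\<lambda>v. b (iform k v)) z"
      using step.IH[OF j kpoly_lower[OF step.prems(1) j]] by blast
    \<comment> \<open>\<open>idir j\<close> moves \<open>iform k\<close> by one unit up or down, so
      a univariate antidifference suffices.\<close>
    obtain C where C: "\<And>m. C m - C (m - iform k (idir j)) = b m"
      using ex_antidifference[OF iform_other] False by metis
    let ?s = "spl n (\<lambda>v. C (iform k v))"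
    have "nabla j (\<lambda>v. C (iform k v)) = (\<lambda>v. b (iform k v))"
      by (simp add: nabla_def iform_diff C)
    hence dj: "has_dird (\<lambda>z. p z - ?s z) (dir j) 0 z" if "z \<in> cell \<kappa>" for z
      using has_dird_diff[OF has_dird_poly2[OF pp, of "dir j" z] has_dird_spl[OF n j, of "\<lambda>v. C (iform k v)" z]]
        b that by simp
    have "?s (z + h *\<^sub>R dir k) = ?s z" for z h
      using spl_line_invariant[OF n, of C k z "- h"] by simp
    hence "has_dird ?s (dir k) 0 z" for z by (simp add: has_dird_def)
    moreover have "has_dird p (dir k) 0 z" for z
      using has_dird_poly2[OF pp, of "dir k" z] step.prems(2) by simp
    ultimately have dk: "has_dird (\<lambda>z. p z - ?s z) (dir k) 0 z" for z
      using has_dird_diff[of p "dir k" 0 z ?s 0] by simp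
    obtain \<gamma> where g: "\<And>z. z \<in> cell \<kappa> \<Longrightarrow> p z - ?s z = \<gamma>"
      using const_of_two_dird[OF False open_cell connected_cell dj dk] by metis
    have "p z = spl n (\<lambda>v. (\<lambda>m. C m + \<gamma>) (iform k v)) z" if "z \<in> cell \<kappa>" for z
      using g[OF that] by (simp add: spl_add spl_const[OF n])
    thus ?thesis by (intro exI[of _ "\<lambda>m. C m + \<gamma>"]) simp
  qed
qed

text \<open>Coefficients of D_k p are summed along \<open>idir k\<close>. The resulting spline has
  the right derivative along \<open>dir k\<close>, and the remaining error is constant in that
  direction and covered by \<open>kpoly_line\<close>.\<close>

lemma kpoly_spl:
  assumes "\<forall>i. n $ i \<ge> 1" "valid \<kappa>" "p \<in> kpoly n"
  shows "\<exists>c. \<forall>z\<in>cell \<kappa>. p z = spl n c z"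
  using assms(1,3)
proof (induction n arbitrary: p rule: box_induct)
  case one
  obtain \<alpha> \<beta> \<gamma> where p: "p = (\<lambda>z. \<alpha> * fst z + \<beta> * snd z + \<gamma>)" using kpoly_ones[OF one(1)] by blast
  have "p z = spl ones (\<lambda>v. \<alpha> * (of_int (fst v) + 1) + \<beta> * (of_int (snd v) + 1) + \<gamma>) z" if "z \<in> cell \<kappa>" for z
    using spl_affine[OF assms(2) subsetD[OF cell_subset_ccell that] refl] by (simp add: p)
  thus ?case by blast
next
  case (step n k)
  note n = step.hyps(1) and k = step.hyps(2)
  obtain b where b: "\<forall>z\<in>cell \<kappa>. dird (dir k) p z = spl (n - axis k 1) b z"
    using step.IH[OF k kpoly_lower[OF step.prems(1) k]] by blast
  obtain c where c: "nabla k c = b" by (rule ex_nabla)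
  obtain P where P: "P \<in> kpoly n" "\<forall>z\<in>cell \<kappa>. spl n c z = P z" using spl_piece[OF n assms(2)] by blast
  have pp: "poly2 p" "poly2 P" using step.prems(1) P(1) by (auto intro: kpoly_poly2)
  have "dird (dir k) P = dird (dir k) p"
  proof (rule dird_eq_on_open[OF pp(2) poly2_dird[OF pp(1)] open_cell cell_nonempty[OF assms(2)]])
    fix z assume z: "z \<in> cell \<kappa>"
    show "spl n c z = P z" using P(2) z by blast
    show "has_dird (spl n c) (dir k) (dird (dir k) p z) z"
      using has_dird_spl[OF n k, of c z] b z c by simp
  qed
  hence "dird (dir k) (\<lambda>z. p z - P z) = (\<lambda>_. 0)" using pp by (simp add: dird_diff)
  then obtain g where "\<forall>z\<in>cell \<kappa>. p z - P z = spl n (\<lambda>v. g (iform k v)) z"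
    using kpoly_line[OF n assms(2) kpoly_diff[OF step.prems(1) P(1)]] by blast
  hence "p z = spl n (\<lambda>v. c v + g (iform k v)) z" if "z \<in> cell \<kappa>" for z
    using P(2) that by (simp add: spl_add algebra_simps)
  thus ?case by blast
qed

lemma box_splines_eq: "box_splines n l = range (\<lambda>v z. box_spline n (2 ^ (l - 1) *\<^sub>R z - lat v))"
  unfolding box_splines_def int_lattice_eq by blast

lemma span_box_splines_spl:
  assumes "\<forall>i. n $ i \<ge> 1" "f \<in> fun_vs.span (box_splines n l)"
  obtains c where "f = (\<lambda>z. spl n c (2 ^ (l - 1) *\<^sub>R z))"
proof -
  have "\<exists>c. f = (\<lambda>z. spl n c (2 ^ (l - 1) *\<^sub>R z))"
    using assms(2)
  proof (induction rule: fun_vs.span_induct_alt)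
    case base
    show ?case by (rule exI[of _ "\<lambda>_. 0"]) (simp add: spl_def zero_fun_def)
  next
    case (step r h k)
    then obtain v c where h: "h = (\<lambda>z. box_spline n (2 ^ (l - 1) *\<^sub>R z - lat v))"
      and k: "k = (\<lambda>z. spl n c (2 ^ (l - 1) *\<^sub>R z))" unfolding box_splines_eq by blast
    have "spl n (\<lambda>w. if w = v then r else 0) z = r * box_spline n (z - lat v)" for z
      by (subst spl_eq[of "{v}"]) (use assms(1) in \<open>auto split: if_splits\<close>)
    hence "fscale r h + k = (\<lambda>z. spl n (\<lambda>w. (if w = v then r else 0) + c w) (2 ^ (l - 1) *\<^sub>R z))"
      by (simp add: h k spl_add fscale_def fun_eq_iff)
    thus ?case by blast
  qed
  thus ?thesis using that by blast
qed

lemma spl_span_box_splines: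
  assumes "finite F" 
  shows "(\<lambda>z. \<Sum>v\<in>F. c v * box_spline n (2 ^ (l - 1) *\<^sub>R z - lat v)) \<in> fun_vs.span (box_splines n l)"
proof -
  have "(\<Sum>v\<in>F. fscale (c v) (\<lambda>z. box_spline n (2 ^ (l - 1) *\<^sub>R z - lat v))) \<in> fun_vs.span (box_splines n l)"
    by (intro fun_vs.span_sum fun_vs.span_scale fun_vs.span_base) (auto simp: box_splines_eq)
  moreover have "(\<Sum>v\<in>F. fscale (c v) (\<lambda>z. box_spline n (2 ^ (l - 1) *\<^sub>R z - lat v)))
      = (\<lambda>z. \<Sum>v\<in>F. c v * box_spline n (2 ^ (l - 1) *\<^sub>R z - lat v))"
    using assms by (induction F rule: finite_induct) (auto simp: fscale_def fun_eq_iff)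
  ultimately show ?thesis by simp
qed

text \<open>For the first inclusion a single triangle suffices, because a polynomial is determined
  by its values on an open set.\<close>

theorem local_polys_eq:
  assumes n: "\<forall>i. n $ i \<ge> 1"
  shows "local_polys n = kpoly n"
proof (intro equalityI subsetI)
  fix p assume p: "p \<in> local_polys n"
  define \<kappa> :: "3 \<Rightarrow> int" where "\<kappa> = (\<lambda>_. 0)"
  have v: "valid \<kappa>" by (simp add: valid_def \<kappa>_def)
  have "cell \<kappa> \<in> base_triangles" using v by (auto simp: base_triangles_eq)
  then obtain g where g: "g \<in> fun_vs.span (box_splines n 1)" "\<forall>z\<in>cell \<kappa>. p z = g z"
    using p by (auto simp: local_polys_def)
  obtain c where "g = (\<lambda>z. spl n c (2 ^ (1 - 1) *\<^sub>R z))" by (rule span_box_splines_spl[OF n g(1)])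
  hence c: "g = spl n c" by simp
  obtain P where P: "P \<in> kpoly n" "\<forall>z\<in>cell \<kappa>. spl n c z = P z" using spl_piece[OF n v] by blast
  have "p = P"
    by (rule poly2_eq[OF _ kpoly_poly2[OF P(1)] open_cell cell_nonempty[OF v]])
      (use p g(2) P(2) c in \<open>auto simp: local_polys_def\<close>)
  thus "p \<in> kpoly n" using P(1) by simp
next
  fix p assume p: "p \<in> kpoly n"
  have "\<exists>g\<in>fun_vs.span (box_splines n 1). \<forall>z\<in>T. p z = g z" if T: "T \<in> base_triangles" for T
  proof -
    obtain \<kappa> where k: "valid \<kappa>" "T = cell \<kappa>" using T unfolding base_triangles_eq by blast
    obtain c where c: "\<forall>z\<in>cell \<kappa>. p z = spl n c z" using kpoly_spl[OF n k(1) p] by blast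
    show ?thesis
      by (rule bexI[OF _ spl_span_box_splines[OF finite_act[of n \<kappa>], of c]])
        (use c spl_act[OF n] k(2) in auto)
  qed
  thus "p \<in> local_polys n" using kpoly_poly2[OF p] by (simp add: local_polys_def)
qed

section \<open>Smoothness of splines across edges\<close>

text \<open>The entry d_i written uniformly in \<open>i\<close>: the sum of the two multiplicities
  other than n_i, minus 2.\<close>

definition contact_order :: "nat ^ 3 \<Rightarrow> 3 \<Rightarrow> nat"
  where "contact_order n i = n $ 1 + n $ 2 + n $ 3 - n $ i - 2"

text \<open>Matches the behaviour of \<open>vanishing\<close>: one order is lost for a direction
  transverse to the edge, and none for the direction of the edge itself.\<close>

lemma contact_order_lower:
  assumes "\<forall>i. n $ i \<ge> 1" "n $ l \<ge> 2"
  shows "l \<noteq> i \<Longrightarrow> contact_order n i = Suc (contact_order (n - axis l 1) i)"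
    and "contact_order (n - axis l 1) l = contact_order n l"
proof -
  have n: "n $ 1 \<ge> 1" "n $ 2 \<ge> 1" "n $ 3 \<ge> 1" using assms(1) by blast+
  let ?n = "n - axis l 1"
  have S: "?n $ 1 + ?n $ 2 + ?n $ 3 = n $ 1 + n $ 2 + n $ 3 - 1"
    using exhaust_3[of l] assms(2)
    by (elim disjE) (simp_all add: lower_nth_simps del: vector_minus_component)
  have l: "?n $ l = n $ l - 1" "n $ l \<le> n $ 1 + n $ 2 + n $ 3"
    using exhaust_3[of l] by (auto simp: lower_nth_simps simp del: vector_minus_component)
  show "contact_order ?n l = contact_order n l"
    unfolding contact_order_def S l(1) using assms(2) l(2) by linarith
  assume li: "l \<noteq> i"
  hence i: "?n $ i = n $ i" by (simp add: lower_nth_simps del: vector_minus_component)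
  have "n $ i + n $ l + 1 \<le> n $ 1 + n $ 2 + n $ 3"
    using exhaust_3[of l] exhaust_3[of i] li n by (elim disjE) simp_all
  thus "contact_order n i = Suc (contact_order ?n i)"
    unfolding contact_order_def S i using assms(2) by linarith
qed

lemma spl_eq_on_ccell:
  assumes "\<forall>i. n $ i \<ge> 1" "valid \<kappa>" "poly2 p" "\<And>z. z \<in> cell \<kappa> \<Longrightarrow> spl n c z = p z" "z \<in> ccell \<kappa>"
  shows "spl n c z = p z"
proof -
  have "spl n c z - p z = 0"
  proof (rule continuous_constant_on_closure[of "cell \<kappa>" "\<lambda>z. spl n c z - p z"])
    show "continuous_on (closure (cell \<kappa>)) (\<lambda>z. spl n c z - p z)"
      by (intro continuous_on_diff continuous_on_poly2 assms(3)
          continuous_on_subset[OF continuous_spl[OF assms(1)] subset_UNIV])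
  qed (use assms closure_cell in auto)
  thus ?thesis by simp
qed

lemma spl_piece_dird:
  assumes "\<forall>i. n $ i \<ge> 1" "n $ l \<ge> 2" "poly2 p" "\<And>z. z \<in> cell \<kappa> \<Longrightarrow> spl n c z = p z" "z \<in> cell \<kappa>"
  shows "spl (n - axis l 1) (nabla l c) z = dird (dir l) p z"
proof -
  have "has_dird p (dir l) (spl (n - axis l 1) (nabla l c) z) z"
    by (rule has_dird_local[OF open_cell assms(5,4) has_dird_spl[OF assms(1,2)]])
  thus ?thesis using has_dird_imp_dird by metis
qed

text \<open>If a direction transverse to the edge is raised, the order is known for the derivative
  along it, and \<open>vanishing_of_transverse\<close> adds the missing one. Otherwise the required
  order is 0 and continuity is enough.\<close>

lemma spl_smooth:
  assumes "\<forall>i. n $ i \<ge> 1" "valid \<kappa>" "valid \<kappa>'" "tangential i e" "e \<subseteq> ccell \<kappa>" "e \<subseteq> ccell \<kappa>'"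
    "poly2 p" "poly2 p'" "\<And>z. z \<in> cell \<kappa> \<Longrightarrow> spl n c z = p z" "\<And>z. z \<in> cell \<kappa>' \<Longrightarrow> spl n c z = p' z"
  shows "vanishing (contact_order n i) e (\<lambda>z. p z - p' z)"
proof -
  have zero: "p z - p' z = 0"
    if "\<forall>i. n $ i \<ge> 1" "poly2 p" "poly2 p'" "\<And>z. z \<in> cell \<kappa> \<Longrightarrow> spl n c z = p z"
      "\<And>z. z \<in> cell \<kappa>' \<Longrightarrow> spl n c z = p' z" "z \<in> e" for n c p p' z
    using spl_eq_on_ccell[OF that(1) assms(2) that(2,4), of z] spl_eq_on_ccell[OF that(1) assms(3) that(3,5), of z]
      assms(5,6) that(6) by (metis cancel_comm_monoid_add_class.diff_cancel subsetD)
  show ?thesis using assms(1,7-10)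
  proof (induction n arbitrary: c p p' rule: box_induct)
    case one
    have "\<forall>i. ones $ i \<ge> 1" by simp
    moreover have "contact_order ones i = 0" using exhaust_3[of i] by (auto simp: contact_order_def)
    ultimately show ?case using zero[of ones p p' c] one by simp
  next
    case (step n k)
    note n = step.hyps(1)
    show ?case
    proof (cases "\<exists>l. l \<noteq> i \<and> n $ l \<ge> 2")
      case True
      then obtain l where l: "l \<noteq> i" "n $ l \<ge> 2" by blast
      have "vanishing (contact_order (n - axis l 1) i) e (\<lambda>z. dird (dir l) p z - dird (dir l) p' z)"
        by (rule step.IH[OF l(2) poly2_dird[OF step.prems(1)] poly2_dird[OF step.prems(2)]
              spl_piece_dird[OF n l(2) step.prems(1,3)] spl_piece_dird[OF n l(2) step.prems(2,4)]])
      hence "vanishing (contact_order (n - axis l 1) i) e (dird (dir l) (\<lambda>z. p z - p' z))"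
        using dird_diff[OF step.prems(1,2)] by simp
      thus ?thesis unfolding contact_order_lower(1)[OF n l(2,1)]
        using vanishing_of_transverse[OF real_polynomial_function_diff[OF step.prems(1,2)] assms(4) l(1)[symmetric]]
          zero[OF n step.prems] by blast
    next
      case False
      have "n $ l = 1" if "l \<noteq> i" for l
      proof -
        have "\<not> n $ l \<ge> 2" using False that by blast
        moreover have "n $ l \<ge> 1" using n by blast
        ultimately show ?thesis by linarith
      qed
      hence "contact_order n i = 0" using exhaust_3[of i] by (auto simp: contact_order_def)
      thus ?thesis using zero[OF n step.prems] by simp
    qed
  qed
qed

section \<open>Edges between adjacent triangles\<close>

text \<open>\<open>cell \<kappa>\<close> and \<open>cell (below i \<kappa>)\<close> are adjacent across the edge \<open>edge i \<kappa>\<close> of type \<open>i\<close>.\<close>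

definition below :: "3 \<Rightarrow> (3 \<Rightarrow> int) \<Rightarrow> 3 \<Rightarrow> int"
  where "below i \<kappa> = \<kappa>(i := \<kappa> i - 1)"

definition edge :: "3 \<Rightarrow> (3 \<Rightarrow> int) \<Rightarrow> point set"
  where "edge i \<kappa> = {z. form i z = of_int (\<kappa> i) \<and>
    (\<forall>j. j \<noteq> i \<longrightarrow> of_int (\<kappa> j) < form j z \<and> form j z < of_int (\<kappa> j) + 1)}"

lemma edge_subset_ccell: "edge i \<kappa> \<subseteq> ccell \<kappa>" "edge i \<kappa> \<subseteq> ccell (below i \<kappa>)"
proof -
  show "edge i \<kappa> \<subseteq> ccell \<kappa>"
  proof
    fix z assume z: "z \<in> edge i \<kappa>"
    have "of_int (\<kappa> j) \<le> form j z \<and> form j z \<le> of_int (\<kappa> j) + 1" for j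
      using z by (cases "j = i") (auto simp: edge_def intro: less_imp_le)
    thus "z \<in> ccell \<kappa>" by (simp add: ccell_def)
  qed
  show "edge i \<kappa> \<subseteq> ccell (below i \<kappa>)"
  proof
    fix z assume z: "z \<in> edge i \<kappa>"
    have "of_int (below i \<kappa> j) \<le> form j z \<and> form j z \<le> of_int (below i \<kappa> j) + 1" for j
      using z by (cases "j = i") (auto simp: edge_def below_def intro: less_imp_le)
    thus "z \<in> ccell (below i \<kappa>)" by (simp add: ccell_def)
  qed
qed

lemma tangential_edge: "tangential i (edge i \<kappa>)"
  unfolding tangential_def
proof
  fix z assume z: "z \<in> edge i \<kappa>"
  define U where "U = (\<Inter>j\<in>{j. j \<noteq> i}. {w. of_int (\<kappa> j) < form j w \<and> form j w < of_int (\<kappa> j) + 1})"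
  have "open U" unfolding U_def Collect_conj_eq
    by (intro open_INT ballI open_Int open_Collect_less continuous_form continuous_on_const
        continuous_on_add finite)
  moreover have "z \<in> U" using z by (auto simp: U_def edge_def)
  moreover have "((\<lambda>h. z + h *\<^sub>R dir i) \<longlongrightarrow> z) (nhds 0)"
    by (auto intro!: tendsto_eq_intros filterlim_ident)
  ultimately have "\<forall>\<^sub>F h in nhds 0. z + h *\<^sub>R dir i \<in> U" by (metis topological_tendstoD)
  thus "\<forall>\<^sub>F h in nhds 0. z + h *\<^sub>R dir i \<in> edge i \<kappa>"
  proof eventually_elim
    case (elim h)
    have "form i (z + h *\<^sub>R dir i) = form i z" by (simp add: form_add form_scale form_dir)
    thus ?case using z elim by (simp add: edge_def U_def)
  qed
qed

definition aedge :: "nat ^ 3 \<Rightarrow> 3 \<Rightarrow> (3 \<Rightarrow> int) \<Rightarrow> (int \<times> int) set"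
  where "aedge n i \<kappa> = act n \<kappa> \<inter> act n (below i \<kappa>)"

text \<open>An index must be active for both \<open>\<kappa> i\<close> and
  \<open>\<kappa> i - 1\<close>, so compared with the triangle \<open>\<kappa>\<close> the range of
  \<open>iform i\<close> loses its top value; the other two ranges are unchanged.\<close>

lemma aedge_bounds:
  "v \<in> aedge n i \<kappa> \<longleftrightarrow> (\<forall>j. \<kappa> j - hi n j + 1 \<le> iform j v \<and>
     iform j v \<le> \<kappa> j - lo n j - (if j = i then 1 else 0))"
proof -
  have "(lo n j \<le> \<kappa> j - iform j v \<and> \<kappa> j - iform j v < hi n j \<and>
      lo n j \<le> below i \<kappa> j - iform j v \<and> below i \<kappa> j - iform j v < hi n j) \<longleftrightarrow>
    (\<kappa> j - hi n j + 1 \<le> iform j v \<and> iform j v \<le> \<kappa> j - lo n j - (if j = i then 1 else 0))" for j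
    by (auto simp: below_def)
  thus ?thesis unfolding aedge_def act_def by blast
qed

lemma mem_aedge:
  assumes "\<forall>i. n $ i \<ge> 1" "z \<in> edge i \<kappa>" "box_spline n (z - lat v) \<noteq> 0"
  shows "v \<in> aedge n i \<kappa>"
  unfolding aedge_bounds
proof
  fix j
  note b = active_bounds[OF assms(1,3), of j]
  show "\<kappa> j - hi n j + 1 \<le> iform j v \<and> iform j v \<le> \<kappa> j - lo n j - (if j = i then 1 else 0)"
  proof (cases "j = i")
    case True
    hence "form j z = of_int (\<kappa> j)" using assms(2) by (simp add: edge_def)
    hence "of_int (lo n j) < (of_int (\<kappa> j - iform j v) :: real)" "of_int (\<kappa> j - iform j v) < (of_int (hi n j) :: real)"
      using b by simp_all
    thus ?thesis using True by simp
  next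
    case False
    hence "of_int (\<kappa> j) < form j z" "form j z < of_int (\<kappa> j) + 1" using assms(2) by (auto simp: edge_def)
    hence "of_int (lo n j) < (of_int (\<kappa> j + 1 - iform j v) :: real)" "of_int (\<kappa> j - iform j v) < (of_int (hi n j) :: real)"
      using b by simp_all
    thus ?thesis using False by simp
  qed
qed

text \<open>Lowering the index \<open>i\<close> alone must give a triangle again, which decides on
  which half of its square \<open>\<kappa>\<close> lies. In all three cases the edge then starts at
  the corner \<open>(\<kappa> 2, \<kappa> 1)\<close>.\<close>

lemma edge_corners:
  assumes "valid \<kappa>" "valid (below i \<kappa>)"
  shows "i = 1 \<Longrightarrow> \<kappa> 3 = \<kappa> 2 - \<kappa> 1" "i = 2 \<Longrightarrow> \<kappa> 3 = \<kappa> 2 - \<kappa> 1 - 1" "i = 3 \<Longrightarrow> \<kappa> 3 = \<kappa> 2 - \<kappa> 1"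
  using assms by (auto simp: valid_def below_def)

lemma edge_parametrization:
  assumes "valid \<kappa>" "valid (below i \<kappa>)" "0 < s" "s < 1"
  shows "lat (\<kappa> 2, \<kappa> 1) + s *\<^sub>R dir i \<in> edge i \<kappa>"
  using exhaust_3[of i] edge_corners[OF assms(1,2)] assms(3,4)
  by (elim disjE) (auto simp: edge_def all_3_index form_def lat_def dir_def)

text \<open>On the edge the series interpolates linearly between the coefficients at the two end
  points, so two points of the edge determine both.\<close>

lemma spl_ones_edge:
  assumes "valid \<kappa>" "valid (below i \<kappa>)" "\<And>z. z \<in> edge i \<kappa> \<Longrightarrow> spl ones c z = 0"
  shows "c (\<kappa> 2 - 1, \<kappa> 1 - 1) = 0" "c ((\<kappa> 2 - 1, \<kappa> 1 - 1) + idir i) = 0"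
proof -
  have e: "(1 - s) * c (\<kappa> 2 - 1, \<kappa> 1 - 1) + s * c ((\<kappa> 2 - 1, \<kappa> 1 - 1) + idir i) = 0" if "0 < s" "s < 1" for s
  proof -
    let ?z = "lat (\<kappa> 2, \<kappa> 1) + s *\<^sub>R dir i"
    have z: "?z \<in> edge i \<kappa>" by (rule edge_parametrization[OF assms(1,2) that])
    have zc: "?z \<in> ccell \<kappa>" using z edge_subset_ccell by blast
    show ?thesis
      using exhaust_3[of i]
    proof (elim disjE)
      assume i: "i = 1"
      show ?thesis using spl_ones(1)[OF assms(1) zc edge_corners(1)[OF assms(1,2) i], of c] assms(3)[OF z]
        by (simp add: i lat_def dir_def idir_def)
    next
      assume i: "i = 2"
      show ?thesis using spl_ones(2)[OF assms(1) zc edge_corners(2)[OF assms(1,2) i], of c] assms(3)[OF z]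
        by (simp add: i lat_def dir_def idir_def)
    next
      assume i: "i = 3"
      show ?thesis using spl_ones(1)[OF assms(1) zc edge_corners(3)[OF assms(1,2) i], of c] assms(3)[OF z]
        by (simp add: i lat_def dir_def idir_def)
    qed
  qed
  from e[of "1/3"] e[of "2/3"] show "c (\<kappa> 2 - 1, \<kappa> 1 - 1) = 0" "c ((\<kappa> 2 - 1, \<kappa> 1 - 1) + idir i) = 0"
    by simp_all
qed

lemma aedge_ones:
  assumes "valid \<kappa>" "valid (below i \<kappa>)" "v \<in> aedge ones i \<kappa>"
  shows "v = (\<kappa> 2 - 1, \<kappa> 1 - 1) \<or> v = (\<kappa> 2 - 1, \<kappa> 1 - 1) + idir i"
proof -
  obtain p q where v: "v = (p, q)" by (cases v)
  have b: "\<kappa> 1 - 1 \<le> q" "q \<le> \<kappa> 1 - (if 1 = i then 1 else 0)" "\<kappa> 2 - 1 \<le> p" "p \<le> \<kappa> 2 - (if 2 = i then 1 else 0)"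
    "\<kappa> 3 \<le> p - q" "p - q \<le> \<kappa> 3 + 1 - (if 3 = i then 1 else 0)"
    using assms(3) unfolding aedge_bounds v all_3_index by (simp_all add: lo_def hi_def iform_def)
  show ?thesis using exhaust_3[of i]
  proof (elim disjE)
    assume i: "i = 1"
    have "q = \<kappa> 1 - 1" "p = \<kappa> 2 - 1 \<or> p = \<kappa> 2" using b i by auto
    thus ?thesis by (auto simp: v i idir_def)
  next
    assume i: "i = 2"
    have "p = \<kappa> 2 - 1" "q = \<kappa> 1 - 1 \<or> q = \<kappa> 1" using b i by auto
    thus ?thesis by (auto simp: v i idir_def)
  next
    assume i: "i = 3"
    have "p - q = \<kappa> 2 - \<kappa> 1" "p = \<kappa> 2 - 1 \<or> p = \<kappa> 2" using b i edge_corners(3)[OF assms(1,2) i] by auto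
    thus ?thesis by (auto simp: v i idir_def)
  qed
qed

text \<open>The bounds \<open>lo n k\<close> and \<open>hi n k\<close> do not involve
  \<open>n $ k\<close>, so under \<open>iform k\<close> the range is that of the hat functions, and
  only the values at the two end points occur.\<close>

lemma aedge_single:
  assumes "valid \<kappa>" "valid (below i \<kappa>)" "v \<in> aedge n i \<kappa>" "\<forall>l. l \<noteq> k \<longrightarrow> n $ l = 1"
  shows "iform k v = iform k (\<kappa> 2 - 1, \<kappa> 1 - 1) \<or> iform k v = iform k ((\<kappa> 2 - 1, \<kappa> 1 - 1) + idir i)"
proof -
  have b: "\<kappa> k - hi n k + 1 \<le> iform k v" "iform k v \<le> \<kappa> k - lo n k - (if k = i then 1 else 0)"
    using assms(3) unfolding aedge_bounds by blast+
  have n: "l \<noteq> k \<Longrightarrow> n $ l = 1" for l using assms(4) by blast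
  have lohi: "lo n k = lo ones k" "hi n k = hi ones k"
    using exhaust_3[of k] by (auto simp: lo_def hi_def n)
  define x where "x = iform k v"
  have x: "\<kappa> k - hi ones k + 1 \<le> x" "x \<le> \<kappa> k - lo ones k - (if k = i then 1 else 0)"
    using b lohi by (simp_all add: x_def)
  have c: "iform k ((\<kappa> 2 - 1, \<kappa> 1 - 1) + idir i) = iform k (\<kappa> 2 - 1, \<kappa> 1 - 1) + iform k (idir i)"
    by (rule iform_add)
  have "x = iform k (\<kappa> 2 - 1, \<kappa> 1 - 1) \<or> x = iform k (\<kappa> 2 - 1, \<kappa> 1 - 1) + iform k (idir i)"
    using exhaust_3[of k]
  proof (elim disjE)
    assume k: "k = 1"
    show ?thesis using exhaust_3[of i] x k by (elim disjE) (auto simp: lo_def hi_def iform_def idir_def)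
  next
    assume k: "k = 2"
    show ?thesis using exhaust_3[of i] x k by (elim disjE) (auto simp: lo_def hi_def iform_def idir_def)
  next
    assume k: "k = 3"
    show ?thesis using exhaust_3[of i] x k edge_corners[OF assms(1,2)]
      by (elim disjE) (auto simp: lo_def hi_def iform_def idir_def)
  qed
  thus ?thesis unfolding c x_def .
qed

section \<open>Constancy of coefficients on hexagons of lattice points\<close>

lemma staircase_constant:
  fixes F :: "int \<Rightarrow> int \<Rightarrow> real" and la ra lb rb lc rc :: int
  defines "A \<equiv> \<lambda>p q. la \<le> p \<and> p \<le> ra \<and> lb \<le> q \<and> q \<le> rb \<and> lc \<le> p - q \<and> p - q \<le> rc"
  assumes "lc < rc" "\<And>p q. A p q \<Longrightarrow> A (p + 1) q \<Longrightarrow> F (p + 1) q = F p q"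
    "\<And>p q. A p q \<Longrightarrow> A p (q + 1) \<Longrightarrow> F p (q + 1) = F p q" "A p q" "A p' q'"
  shows "F p q = F p' q'"
  using assms(5)
proof (induction "nat (\<bar>p - p'\<bar> + \<bar>q - q'\<bar>)" arbitrary: p q rule: less_induct)
  case less
  have up: "F p q = F p' q'" if "A (p + 1) q" "p < p'"
    using less(1)[OF _ that(1)] assms(3)[OF less(2) that(1)] that(2) by simp
  have down: "F p q = F p' q'" if "A (p - 1) q" "p > p'"
    using less(1)[OF _ that(1)] assms(3)[OF that(1)] less(2) that(2) by simp
  have right: "F p q = F p' q'" if "A p (q + 1)" "q < q'"
    using less(1)[OF _ that(1)] assms(4)[OF less(2) that(1)] that(2) by simp
  have left: "F p q = F p' q'" if "A p (q - 1)" "q > q'"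
    using less(1)[OF _ that(1)] assms(4)[OF that(1)] less(2) that(2) by simp
  \<comment> \<open>Each move shortens the l1 distance to the target. If the diagonal strip forbids
    the move in \<open>p\<close>, the target lies in such a position that the move in
    \<open>q\<close> is both allowed and shortening. A strip of width 0 would admit no unit steps at
    all, hence \<open>lc < rc\<close>.\<close>
  consider "p < p'" | "p > p'" | "p = p'" "q < q'" | "p = p'" "q > q'" | "p = p'" "q = q'" by linarith
  thus ?case
  proof cases
    case 1
    show ?thesis
    proof (cases "p - q < rc")
      case True
      thus ?thesis using up 1 less(2) assms(6) by (simp add: A_def)
    next
      case False
      hence "q < q'" "A p (q + 1)" using 1 less(2) assms(2,6) by (auto simp: A_def)
      thus ?thesis using right by blast
    qed
  next
    case 2
    show ?thesis
    proof (cases "lc < p - q")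
      case True
      thus ?thesis using down 2 less(2) assms(6) by (simp add: A_def)
    next
      case False
      hence "q' < q" "A p (q - 1)" using 2 less(2) assms(2,6) by (auto simp: A_def)
      thus ?thesis using left by blast
    qed
  next
    case 3
    thus ?thesis using right less(2) assms(6) by (simp add: A_def)
  next
    case 4
    thus ?thesis using left less(2) assms(6) by (simp add: A_def)
  qed simp
qed

definition hexagon :: "(3 \<Rightarrow> int) \<Rightarrow> (3 \<Rightarrow> int) \<Rightarrow> (int \<times> int) set"
  where "hexagon \<alpha> \<omega> = {v. \<forall>j. \<alpha> j \<le> iform j v \<and> iform j v \<le> \<omega> j}"

lemma aedge_hexagon:
  "aedge n i \<kappa> = hexagon (\<lambda>j. \<kappa> j - hi n j + 1) (\<lambda>j. \<kappa> j - lo n j - (if j = i then 1 else 0))"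
  by (rule set_eqI) (simp only: aedge_bounds hexagon_def mem_Collect_eq)

lemma hexagon_pair:
  "(p, q) \<in> hexagon \<alpha> \<omega> \<longleftrightarrow> \<alpha> 1 \<le> q \<and> q \<le> \<omega> 1 \<and> \<alpha> 2 \<le> p \<and> p \<le> \<omega> 2 \<and> \<alpha> 3 \<le> p - q \<and> p - q \<le> \<omega> 3"
  by (auto simp: hexagon_def all_3_index iform_def)

text \<open>A unimodular change of coordinates turns steps along \<open>idir k\<close> and
  \<open>idir l\<close> into steps along the axes, up to sign, and the third form into the
  difference of the new coordinates. Its range has to have positive width for the staircase
  argument.\<close>

lemma hexagon_two_constant:
  assumes kl: "k \<noteq> l" and width: "\<And>j. j \<noteq> k \<Longrightarrow> j \<noteq> l \<Longrightarrow> \<alpha> j < \<omega> j"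
    and step: "\<And>v m. m = k \<or> m = l \<Longrightarrow> v \<in> hexagon \<alpha> \<omega> \<Longrightarrow> v - idir m \<in> hexagon \<alpha> \<omega> \<Longrightarrow> c v = c (v - idir m)"
    and vw: "v \<in> hexagon \<alpha> \<omega>" "w \<in> hexagon \<alpha> \<omega>"
  shows "(c :: int \<times> int \<Rightarrow> real) v = c w"
proof -
  obtain v1 v2 w1 w2 where v: "v = (v1, v2)" and w: "w = (w1, w2)" by (cases v; cases w) blast
  have "{k, l} = {1, 2} \<or> {k, l} = {1, 3} \<or> {k, l} = {2, 3}"
    using kl exhaust_3[of k] exhaust_3[of l] by auto
  thus ?thesis
  proof (elim disjE)
    assume s: "{k, l} = {1, 2}"
    hence m: "1 = k \<or> 1 = l" "2 = k \<or> 2 = l" "3 \<noteq> k" "3 \<noteq> l" by (auto simp: doubleton_eq_iff)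
    have "(\<lambda>p q. c (p, q)) v1 v2 = (\<lambda>p q. c (p, q)) w1 w2"
    proof (rule staircase_constant[where F = "\<lambda>p q. c (p, q)" and lc = "\<alpha> 3" and rc = "\<omega> 3" and la = "\<alpha> 2" and ra = "\<omega> 2" and lb = "\<alpha> 1" and rb = "\<omega> 1"
        and p = v1 and q = v2 and p' = w1 and q' = w2])
      fix p q
      show "c (p + 1, q) = c (p, q)"
        if "\<alpha> 2 \<le> p \<and> p \<le> \<omega> 2 \<and> \<alpha> 1 \<le> q \<and> q \<le> \<omega> 1 \<and> \<alpha> 3 \<le> p - q \<and> p - q \<le> \<omega> 3"
          "\<alpha> 2 \<le> p + 1 \<and> p + 1 \<le> \<omega> 2 \<and> \<alpha> 1 \<le> q \<and> q \<le> \<omega> 1 \<and> \<alpha> 3 \<le> p + 1 - q \<and> p + 1 - q \<le> \<omega> 3"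
        using step[OF m(1), of "(p + 1, q)"] that by (simp add: hexagon_pair idir_def)
      show "c (p, q + 1) = c (p, q)"
        if "\<alpha> 2 \<le> p \<and> p \<le> \<omega> 2 \<and> \<alpha> 1 \<le> q \<and> q \<le> \<omega> 1 \<and> \<alpha> 3 \<le> p - q \<and> p - q \<le> \<omega> 3"
          "\<alpha> 2 \<le> p \<and> p \<le> \<omega> 2 \<and> \<alpha> 1 \<le> q + 1 \<and> q + 1 \<le> \<omega> 1 \<and> \<alpha> 3 \<le> p - (q + 1) \<and> p - (q + 1) \<le> \<omega> 3"
        using step[OF m(2), of "(p, q + 1)"] that by (simp add: hexagon_pair idir_def)
    qed (use width[OF m(3,4)] vw in \<open>auto simp: v w hexagon_pair\<close>)
    thus ?thesis by (simp add: v w)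
  next
    assume s: "{k, l} = {1, 3}"
    hence m: "1 = k \<or> 1 = l" "3 = k \<or> 3 = l" "2 \<noteq> k" "2 \<noteq> l" by (auto simp: doubleton_eq_iff)
    have "(\<lambda>p q. c (p - q, - q)) (v1 - v2) (- v2) = (\<lambda>p q. c (p - q, - q)) (w1 - w2) (- w2)"
    proof (rule staircase_constant[where F = "\<lambda>p q. c (p - q, - q)" and lc = "\<alpha> 2" and rc = "\<omega> 2" and la = "\<alpha> 3" and ra = "\<omega> 3" and lb = "- \<omega> 1" and rb = "- \<alpha> 1"
        and p = "v1 - v2" and q = "- v2" and p' = "w1 - w2" and q' = "- w2"])
      fix p q
      show "c (p + 1 - q, - q) = c (p - q, - q)"
        if "\<alpha> 3 \<le> p \<and> p \<le> \<omega> 3 \<and> - \<omega> 1 \<le> q \<and> q \<le> - \<alpha> 1 \<and> \<alpha> 2 \<le> p - q \<and> p - q \<le> \<omega> 2"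
          "\<alpha> 3 \<le> p + 1 \<and> p + 1 \<le> \<omega> 3 \<and> - \<omega> 1 \<le> q \<and> q \<le> - \<alpha> 1 \<and> \<alpha> 2 \<le> p + 1 - q \<and> p + 1 - q \<le> \<omega> 2"
        using step[OF m(1), of "(p + 1 - q, - q)"] that by (simp add: hexagon_pair idir_def)
      show "c (p - (q + 1), - (q + 1)) = c (p - q, - q)"
        if "\<alpha> 3 \<le> p \<and> p \<le> \<omega> 3 \<and> - \<omega> 1 \<le> q \<and> q \<le> - \<alpha> 1 \<and> \<alpha> 2 \<le> p - q \<and> p - q \<le> \<omega> 2"
          "\<alpha> 3 \<le> p \<and> p \<le> \<omega> 3 \<and> - \<omega> 1 \<le> q + 1 \<and> q + 1 \<le> - \<alpha> 1 \<and> \<alpha> 2 \<le> p - (q + 1) \<and> p - (q + 1) \<le> \<omega> 2"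
      proof -
        have eq: "(p - q, - q) - idir 3 = (p - (q + 1), - (q + 1))" by (simp add: idir_def)
        have h: "(p - q, - q) \<in> hexagon \<alpha> \<omega>" "(p - (q + 1), - (q + 1)) \<in> hexagon \<alpha> \<omega>"
          using that by (auto simp: hexagon_pair)
        show ?thesis using step[OF m(2) h(1)] h(2) unfolding eq by simp
      qed
    qed (use width[OF m(3,4)] vw in \<open>auto simp: v w hexagon_pair\<close>)
    thus ?thesis by (simp add: v w)
  next
    assume s: "{k, l} = {2, 3}"
    hence m: "2 = k \<or> 2 = l" "3 = k \<or> 3 = l" "1 \<noteq> k" "1 \<noteq> l" by (auto simp: doubleton_eq_iff)
    have "(\<lambda>p q. c (- q, p - q)) (v2 - v1) (- v1) = (\<lambda>p q. c (- q, p - q)) (w2 - w1) (- w1)"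
    proof (rule staircase_constant[where F = "\<lambda>p q. c (- q, p - q)" and lc = "\<alpha> 1" and rc = "\<omega> 1" and la = "- \<omega> 3" and ra = "- \<alpha> 3" and lb = "- \<omega> 2" and rb = "- \<alpha> 2"
        and p = "v2 - v1" and q = "- v1" and p' = "w2 - w1" and q' = "- w1"])
      fix p q
      show "c (- q, p + 1 - q) = c (- q, p - q)"
        if "- \<omega> 3 \<le> p \<and> p \<le> - \<alpha> 3 \<and> - \<omega> 2 \<le> q \<and> q \<le> - \<alpha> 2 \<and> \<alpha> 1 \<le> p - q \<and> p - q \<le> \<omega> 1"
          "- \<omega> 3 \<le> p + 1 \<and> p + 1 \<le> - \<alpha> 3 \<and> - \<omega> 2 \<le> q \<and> q \<le> - \<alpha> 2 \<and> \<alpha> 1 \<le> p + 1 - q \<and> p + 1 - q \<le> \<omega> 1"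
        using step[OF m(1), of "(- q, p + 1 - q)"] that by (simp add: hexagon_pair idir_def)
      show "c (- (q + 1), p - (q + 1)) = c (- q, p - q)"
        if "- \<omega> 3 \<le> p \<and> p \<le> - \<alpha> 3 \<and> - \<omega> 2 \<le> q \<and> q \<le> - \<alpha> 2 \<and> \<alpha> 1 \<le> p - q \<and> p - q \<le> \<omega> 1"
          "- \<omega> 3 \<le> p \<and> p \<le> - \<alpha> 3 \<and> - \<omega> 2 \<le> q + 1 \<and> q + 1 \<le> - \<alpha> 2 \<and> \<alpha> 1 \<le> p - (q + 1) \<and> p - (q + 1) \<le> \<omega> 1"
      proof -
        have eq: "(- q, p - q) - idir 3 = (- (q + 1), p - (q + 1))" by (simp add: idir_def)
        have h: "(- q, p - q) \<in> hexagon \<alpha> \<omega>" "(- (q + 1), p - (q + 1)) \<in> hexagon \<alpha> \<omega>"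
          using that by (auto simp: hexagon_pair)
        show ?thesis using step[OF m(2) h(1)] h(2) unfolding eq by simp
      qed
    qed (use width[OF m(3,4)] vw in \<open>auto simp: v w hexagon_pair\<close>)
    thus ?thesis by (simp add: v w)
  qed
qed

lemma line_multiple:
  assumes "iform k v = iform k w"
  obtains t :: int where "\<And>j. iform j v = iform j w + t * iform j (idir k)"
proof -
  have "\<exists>t. \<forall>j. iform j v = iform j w + t * iform j (idir k)"
    unfolding all_3_index using exhaust_3[of k]
  proof (elim disjE)
    assume "k = 2"
    thus "\<exists>t. iform 1 v = iform 1 w + t * iform 1 (idir k) \<and> iform 2 v = iform 2 w + t * iform 2 (idir k) \<and>
        iform 3 v = iform 3 w + t * iform 3 (idir k)"
      using assms by (intro exI[of _ "snd v - snd w"]) (simp add: iform_def idir_def)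
  qed (use assms in \<open>auto simp: iform_def idir_def intro!: exI[of _ "fst v - fst w"]\<close>)
  thus ?thesis using that by blast
qed

text \<open>Along a lattice line each form changes monotonically, so the points between
  \<open>v\<close> and \<open>w\<close> stay in the hexagon.\<close>

lemma hexagon_line_constant:
  assumes step: "\<And>v. v \<in> hexagon \<alpha> \<omega> \<Longrightarrow> v - idir k \<in> hexagon \<alpha> \<omega> \<Longrightarrow> c v = c (v - idir k)"
    and vw: "v \<in> hexagon \<alpha> \<omega>" "w \<in> hexagon \<alpha> \<omega>" "iform k v = iform k w"
  shows "(c :: int \<times> int \<Rightarrow> real) v = c w"
proof -
  have main: "c v = c w"
    if "v \<in> hexagon \<alpha> \<omega>" "w \<in> hexagon \<alpha> \<omega>" "\<And>j. iform j v = iform j w + int t * iform j (idir k)" for v w t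
    using that
  proof (induction t arbitrary: v)
    case 0
    obtain j :: 3 where "j \<noteq> k" using that[of 1] that[of 2] by (cases "k = 1") auto
    hence "v = w" using 0(3) iform_inj[of j k v w] by simp
    thus ?case by simp
  next
    case (Suc t)
    have f: "iform j (v - idir k) = iform j w + int t * iform j (idir k)" for j
      using Suc.prems(3)[of j] by (simp add: iform_diff algebra_simps)
    have "\<alpha> j \<le> iform j (v - idir k) \<and> iform j (v - idir k) \<le> \<omega> j" for j
    proof -
      have b: "\<alpha> j \<le> iform j v" "iform j v \<le> \<omega> j" "\<alpha> j \<le> iform j w" "iform j w \<le> \<omega> j"
        using Suc.prems(1,2) by (auto simp: hexagon_def)
      have "iform j (idir k) = 0 \<or> iform j (idir k) = 1 \<or> iform j (idir k) = - 1"
        using iform_other[of j k] by (cases "j = k") auto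
      thus ?thesis using b f[of j] Suc.prems(3)[of j] by auto
    qed
    hence "v - idir k \<in> hexagon \<alpha> \<omega>" by (simp add: hexagon_def)
    thus ?case using Suc.IH[OF _ Suc.prems(2) f] step[OF Suc.prems(1)] by simp
  qed
  obtain t :: int where t: "\<And>j. iform j v = iform j w + t * iform j (idir k)"
    using line_multiple[OF vw(3)] by blast
  show ?thesis
  proof (cases "t \<ge> 0")
    case True
    thus ?thesis using main[OF vw(1,2), of "nat t"] t by simp
  next
    case False
    thus ?thesis using main[OF vw(2,1), of "nat (- t)"] t by simp
  qed
qed

text \<open>Lets the induction hypothesis for the lowered multiplicities speak about every
  difference of two coefficients that both belong to the edge.\<close>

lemma aedge_lower:
  assumes "n $ l \<ge> 2" "v \<in> aedge n i \<kappa>" "v - idir l \<in> aedge n i \<kappa>"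
  shows "v \<in> aedge (n - axis l 1) i \<kappa>"
  unfolding aedge_bounds
proof
  fix j
  have "iform j (idir l) = 0 \<or> iform j (idir l) = 1 \<or> iform j (idir l) = - 1"
    using iform_other[of j l] by (cases "j = l") auto
  moreover have "\<kappa> j - hi n j + 1 \<le> iform j v" "iform j v \<le> \<kappa> j - lo n j - (if j = i then 1 else 0)"
     "\<kappa> j - hi n j + 1 \<le> iform j v - iform j (idir l)"
     "iform j v - iform j (idir l) \<le> \<kappa> j - lo n j - (if j = i then 1 else 0)"
    using assms(2,3) unfolding aedge_bounds iform_diff by blast+
  ultimately show "\<kappa> j - hi (n - axis l 1) j + 1 \<le> iform j v \<and>
         iform j v \<le> \<kappa> j - lo (n - axis l 1) j - (if j = i then 1 else 0)"
    unfolding lo_lower[OF assms(1)] hi_lower[OF assms(1)] by (elim disjE) simp_all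
qed

lemma spl_line_single:
  assumes "\<forall>i. n $ i \<ge> 1" "\<forall>l. l \<noteq> k \<longrightarrow> n $ l = 1"
  shows "spl n (\<lambda>v. g (iform k v)) = spl ones (\<lambda>v. g (iform k v))"
  using assms
proof (induction n rule: box_induct)
  case (step n j)
  have j: "j = k" using step.hyps(2) step.prems by (metis numeral_le_one_iff semiring_norm(69))
  have "\<forall>l. l \<noteq> k \<longrightarrow> (n - axis k 1) $ l = 1"
    using step.prems by (simp add: lower_nth_simps del: vector_minus_component)
  thus ?case using step.IH[of k] step.hyps j spl_line_lower[OF step.hyps(1), of k g] by simp
qed simp

text \<open>By induction, differentiation along \<open>dir l\<close> with \<open>n $ l \<ge> 2\<close> shows that \<open>c\<close> is constant along
  \<open>dir l\<close> within \<open>aedge n i \<kappa>\<close>. With two such directions \<open>c\<close> is constant, hence equal to the value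
  of the spline on the edge; with one, the spline agrees on the edge with a series of hat functions.\<close>

theorem edge_coefficients:
  assumes "\<forall>i. n $ i \<ge> 1" "valid \<kappa>" "valid (below i \<kappa>)" "\<mu> = \<kappa> \<or> \<mu> = below i \<kappa>"
    "poly2 q" "\<And>z. z \<in> cell \<mu> \<Longrightarrow> spl n c z = q z" "vanishing (contact_order n i) (edge i \<kappa>) q" "v \<in> aedge n i \<kappa>"
  shows "c v = 0"
proof -
  have mu: "valid \<mu>" "edge i \<kappa> \<subseteq> ccell \<mu>"
    using assms(2-4) edge_subset_ccell[of i \<kappa>] by (elim disjE; simp)+
  have zero: "spl n c z = 0"
    if "\<forall>i. n $ i \<ge> 1" "poly2 q" "\<And>z. z \<in> cell \<mu> \<Longrightarrow> spl n c z = q z" "vanishing m (edge i \<kappa>) q" "z \<in> edge i \<kappa>" for n c q z m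
    using spl_eq_on_ccell[OF that(1) mu(1) that(2,3), of z] mu(2) vanishing_zero[OF that(4,5)] that(5) by auto
  show ?thesis using assms(1,5-8)
  proof (induction n arbitrary: c q v rule: box_induct)
    case one
    have "\<forall>i. ones $ i \<ge> 1" by simp
    from zero[OF this one(1-3)] have z: "\<And>z. z \<in> edge i \<kappa> \<Longrightarrow> spl ones c z = 0" by blast
    show ?case using spl_ones_edge[OF assms(2,3) z] aedge_ones[OF assms(2,3) one(4)] by metis
  next
    case (step n k)
    note n = step.hyps(1) and k = step.hyps(2)
    have z: "spl n c z = 0" if "z \<in> edge i \<kappa>" for z by (rule zero[OF n step.prems(1-3) that])
    have nab: "c w = c (w - idir l)" if l: "n $ l \<ge> 2" and w: "w \<in> aedge n i \<kappa>" "w - idir l \<in> aedge n i \<kappa>" for l w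
    proof -
      have "vanishing (contact_order (n - axis l 1) i) (edge i \<kappa>) (dird (dir l) q)"
      \<comment> \<open>For \<open>l = i\<close> neither the derivative nor the lowering of
        \<open>n\<close> changes the order; for a transverse direction both cost exactly
        one.\<close>
      proof (cases "l = i")
        case True
        have "contact_order (n - axis l 1) i = contact_order n i"
          using contact_order_lower(2)[OF n l] True by simp
        thus ?thesis using vanishing_tangential[OF step.prems(1) tangential_edge step.prems(3)] True by simp
      next
        case False
        show ?thesis
          using vanishing_dird[OF step.prems(1)] step.prems(3) unfolding contact_order_lower(1)[OF n l False] by blast
      qed
      hence "nabla l c w = 0"
        by (intro step.IH[OF l, of "dird (dir l) q" "nabla l c" w] aedge_lower[OF l w])
          (use step.prems(1) spl_piece_dird[OF n l step.prems(1,2)] in auto)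
      thus ?thesis by (simp add: nabla_def)
    qed
    show ?case
    proof (cases "\<exists>l. l \<noteq> k \<and> n $ l \<ge> 2")
      case True
      then obtain l where l: "l \<noteq> k" "n $ l \<ge> 2" by blast
      have const: "c w = c v" if "w \<in> aedge n i \<kappa>" for w
      proof (rule hexagon_two_constant[OF l(1)[symmetric], of "\<lambda>j. \<kappa> j - hi n j + 1" "\<lambda>j. \<kappa> j - lo n j - (if j = i then 1 else 0)"])
        fix j assume j: "j \<noteq> k" "j \<noteq> l"
        \<comment> \<open>The width is the sum of the two raised multiplicities \<open>n $ k\<close>
          and \<open>n $ l\<close>. Positive width of the hexagon, after the shifts by one, needs
          more than 2.\<close>
        have "hi n j - lo n j \<ge> 4"
          using j l k exhaust_3[of j] exhaust_3[of k] exhaust_3[of l] by (auto simp: hi_def lo_def)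
        thus "\<kappa> j - hi n j + 1 < \<kappa> j - lo n j - (if j = i then 1 else 0)" by (cases "j = i"; simp)
      next
        fix w m assume "m = k \<or> m = l" "w \<in> hexagon (\<lambda>j. \<kappa> j - hi n j + 1) (\<lambda>j. \<kappa> j - lo n j - (if j = i then 1 else 0))"
          "w - idir m \<in> hexagon (\<lambda>j. \<kappa> j - hi n j + 1) (\<lambda>j. \<kappa> j - lo n j - (if j = i then 1 else 0))"
        thus "c w = c (w - idir m)" using nab[of m w] k l(2) unfolding aedge_hexagon by blast
      qed (use that step.prems(4) in \<open>simp_all only: aedge_hexagon\<close>)
      \<comment> \<open>The midpoint of the edge. All box splines that are nonzero there belong to
        \<open>aedge n i \<kappa>\<close>, and with a constant coefficient they sum to that
        constant.\<close>
      let ?z = "lat (\<kappa> 2, \<kappa> 1) + (1/2) *\<^sub>R dir i"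
      have e: "?z \<in> edge i \<kappa>" by (rule edge_parametrization[OF assms(2,3)]) simp_all
      have "0 = spl n c ?z" using z[OF e] by simp
      also have "\<dots> = spl n (\<lambda>_. c v) ?z"
        by (rule spl_cong) (use const mem_aedge[OF n e] in blast)
      also have "\<dots> = c v" by (rule spl_const[OF n])
      finally show ?thesis by simp
    next
      case False
      have single: "\<forall>l. l \<noteq> k \<longrightarrow> n $ l = 1"
      proof (intro allI impI)
        fix l assume "l \<noteq> k"
        hence "\<not> n $ l \<ge> 2" using False by blast
        moreover have "n $ l \<ge> 1" using n by blast
        ultimately show "n $ l = 1" by linarith
      qed
      \<comment> \<open>On the edge indices \<open>c\<close> turns out to be constant along
        \<open>idir k\<close>, so any representative of a line will do; values of \<open>g\<close>
        not attained there are arbitrary.\<close>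
      define g where "g m = c (SOME w. w \<in> aedge n i \<kappa> \<and> iform k w = m)" for m
      have g: "c w = g (iform k w)" if w: "w \<in> aedge n i \<kappa>" for w
      proof -
        define w' where "w' = (SOME w'. w' \<in> aedge n i \<kappa> \<and> iform k w' = iform k w)"
        have w': "w' \<in> aedge n i \<kappa> \<and> iform k w' = iform k w"
          unfolding w'_def by (rule someI[of _ w]) (use w in simp)
        have "c w = c w'"
        proof (rule hexagon_line_constant[OF _ w[unfolded aedge_hexagon]
                conjunct1[OF w', unfolded aedge_hexagon] conjunct2[OF w', symmetric]])
          fix u assume "u \<in> hexagon (\<lambda>j. \<kappa> j - hi n j + 1) (\<lambda>j. \<kappa> j - lo n j - (if j = i then 1 else 0))"
            "u - idir k \<in> hexagon (\<lambda>j. \<kappa> j - hi n j + 1) (\<lambda>j. \<kappa> j - lo n j - (if j = i then 1 else 0))"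
          thus "c u = c (u - idir k)" using nab[OF k] unfolding aedge_hexagon by blast
        qed
        thus ?thesis by (simp add: g_def w'_def)
      qed
      have z': "spl ones (\<lambda>v. g (iform k v)) z = 0" if e: "z \<in> edge i \<kappa>" for z
      proof -
        have "spl n (\<lambda>v. g (iform k v)) z = spl n c z"
          by (rule spl_cong) (use g mem_aedge[OF n e] in metis)
        thus ?thesis using z[OF e] spl_line_single[OF n single, of g] by simp
      qed
      have "g (iform k (\<kappa> 2 - 1, \<kappa> 1 - 1)) = 0" "g (iform k ((\<kappa> 2 - 1, \<kappa> 1 - 1) + idir i)) = 0"
        using spl_ones_edge[OF assms(2,3), of "\<lambda>v. g (iform k v)"] z' by blast+
      hence "g (iform k v) = 0"
        using aedge_single[OF assms(2,3) step.prems(4) single] by (elim disjE) simp_all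
      thus ?thesis using g[OF step.prems(4)] by simp
    qed
  qed
qed

text \<open>Failing at all three edges would put \<open>v\<close> at an extreme value of every form,
  with signs that contradict the relation between the three forms. So each index active on a
  triangle is also active on a neighbour.\<close>

lemma act_cover:
  assumes "valid \<kappa>" "v \<in> act n \<kappa>" "\<forall>i. n $ i \<ge> 1"
  obtains i \<kappa>' where "valid \<kappa>'" "valid (below i \<kappa>')" "\<kappa> = \<kappa>' \<or> \<kappa> = below i \<kappa>'" "v \<in> aedge n i \<kappa>'"
proof -
  have b: "lo n j \<le> \<kappa> j - iform j v" "\<kappa> j - iform j v < hi n j" for j using assms(2) by (auto simp: act_def)
  have fw: "v \<in> aedge n i \<kappa>" if "lo n i < \<kappa> i - iform i v" for i
    unfolding aedge_bounds
  proof
    fix j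
    show "\<kappa> j - hi n j + 1 \<le> iform j v \<and> iform j v \<le> \<kappa> j - lo n j - (if j = i then 1 else 0)"
      using b[of j] that by (cases "j = i") auto
  qed
  have bw: "v \<in> aedge n i (\<kappa>(i := \<kappa> i + 1))" if "\<kappa> i - iform i v < hi n i - 1" for i
    unfolding aedge_bounds
  proof
    fix j
    show "(\<kappa>(i := \<kappa> i + 1)) j - hi n j + 1 \<le> iform j v \<and> iform j v \<le> (\<kappa>(i := \<kappa> i + 1)) j - lo n j - (if j = i then 1 else 0)"
      using b[of j] that by (cases "j = i") auto
  qed
  have bb: "below i (\<kappa>(i := \<kappa> i + 1)) = \<kappa>" for i by (simp add: below_def)
  have n: "n $ 1 \<ge> 1" "n $ 2 \<ge> 1" "n $ 3 \<ge> 1" using assms(3) by blast+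
  show ?thesis
  proof (cases "\<kappa> 3 = \<kappa> 2 - \<kappa> 1")
    case True
    hence "lo n 1 < \<kappa> 1 - iform 1 v \<or> \<kappa> 2 - iform 2 v < hi n 2 - 1 \<or> lo n 3 < \<kappa> 3 - iform 3 v"
      using n b[of 1] b[of 2] b[of 3] by (auto simp: lo_def hi_def iform_def)
    moreover have "valid (below 1 \<kappa>)" "valid (\<kappa>(2 := \<kappa> 2 + 1))" "valid (below 3 \<kappa>)"
      using True by (auto simp: valid_def below_def)
    ultimately show ?thesis
      using that[of \<kappa> 1] that[of "\<kappa>(2 := \<kappa> 2 + 1)" 2] that[of \<kappa> 3] fw[of 1] bw[of 2] fw[of 3] bb assms(1) by metis
  next
    case False
    hence k: "\<kappa> 3 = \<kappa> 2 - \<kappa> 1 - 1" using assms(1) by (auto simp: valid_def)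
    hence "\<kappa> 1 - iform 1 v < hi n 1 - 1 \<or> lo n 2 < \<kappa> 2 - iform 2 v \<or> \<kappa> 3 - iform 3 v < hi n 3 - 1"
      using n b[of 1] b[of 2] b[of 3] by (auto simp: lo_def hi_def iform_def)
    moreover have "valid (\<kappa>(1 := \<kappa> 1 + 1))" "valid (below 2 \<kappa>)" "valid (\<kappa>(3 := \<kappa> 3 + 1))"
      using k by (auto simp: valid_def below_def)
    ultimately show ?thesis
      using that[of "\<kappa>(1 := \<kappa> 1 + 1)" 1] that[of \<kappa> 2] that[of "\<kappa>(3 := \<kappa> 3 + 1)" 3] bw[of 1] fw[of 2] bw[of 3] bb assms(1)
      by metis
  qed
qed

text \<open>Local linear independence: an active index belongs to some edge of the triangle, and the
  zero piece satisfies every contact condition there.\<close>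

theorem spl_independent:
  assumes "\<forall>i. n $ i \<ge> 1" "valid \<kappa>" "\<And>z. z \<in> cell \<kappa> \<Longrightarrow> spl n c z = 0" "v \<in> act n \<kappa>"
  shows "c v = 0"
proof -
  obtain i \<kappa>' where "valid \<kappa>'" "valid (below i \<kappa>')" "\<kappa> = \<kappa>' \<or> \<kappa> = below i \<kappa>'" "v \<in> aedge n i \<kappa>'"
    using act_cover[OF assms(2,4,1)] .
  thus ?thesis
    by (intro edge_coefficients[OF assms(1), of \<kappa>' i \<kappa> "\<lambda>_. 0" c v]) (use assms(3) poly2_const vanishing_null in auto)
qed

lemma spl_single: "\<forall>i. n $ i \<ge> 1 \<Longrightarrow> spl n (\<lambda>w. if w = v then r else 0) z = r * box_spline n (z - lat v)"
  by (subst spl_eq[of "{v}"]) (auto split: if_splits)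

text \<open>Independence applied to a unit coefficient. Together with \<open>mem_act\<close> this
  makes \<open>act n \<kappa>\<close> the exact set of box splines that do not vanish identically on
  the triangle.\<close>

lemma box_spline_nonzero:
  assumes "\<forall>i. n $ i \<ge> 1" "valid \<kappa>" "v \<in> act n \<kappa>"
  obtains z where "z \<in> cell \<kappa>" "box_spline n (z - lat v) \<noteq> 0"
proof -
  have "\<exists>z\<in>cell \<kappa>. box_spline n (z - lat v) \<noteq> 0"
  proof (rule ccontr)
    assume "\<not> ?thesis"
    hence "spl n (\<lambda>w. if w = v then 1 else 0) z = 0" if "z \<in> cell \<kappa>" for z
      using that by (simp add: spl_single[OF assms(1)])
    from spl_independent[OF assms(1,2) this assms(3)] show False by simp
  qed
  thus ?thesis using that by blast
qed

text \<open>The spline with coefficients \<open>c'\<close> is continued across the edge. Its piece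
  \<open>P\<close> on the upper triangle has full contact with \<open>p'\<close>, hence so have
  \<open>p\<close> and \<open>P\<close>, which are now pieces on the same triangle with coefficients
  \<open>c\<close> and \<open>c'\<close>.\<close>

theorem adjacent_coefficients:
  assumes n: "\<forall>i. n $ i \<ge> 1" and \<kappa>: "valid \<kappa>" "valid (below i \<kappa>)"
    and p: "poly2 p" "\<And>z. z \<in> cell \<kappa> \<Longrightarrow> spl n c z = p z"
    and p': "poly2 p'" "\<And>z. z \<in> cell (below i \<kappa>) \<Longrightarrow> spl n c' z = p' z"
    and vanishing: "vanishing (contact_order n i) (edge i \<kappa>) (\<lambda>z. p z - p' z)" and v: "v \<in> aedge n i \<kappa>"
  shows "c v = c' v"
proof -
  obtain P where P: "P \<in> kpoly n" "\<forall>z\<in>cell \<kappa>. spl n c' z = P z" using spl_piece[OF n \<kappa>(1)] by blast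
  have pP: "poly2 P" using P(1) by (rule kpoly_poly2)
  have "vanishing (contact_order n i) (edge i \<kappa>) (\<lambda>z. P z - p' z)"
    by (rule spl_smooth[OF n \<kappa> tangential_edge edge_subset_ccell pP p'(1)]) (use P(2) p'(2) in auto)
  from vanishing_diff[OF _ _ vanishing this]
  have "vanishing (contact_order n i) (edge i \<kappa>) (\<lambda>z. p z - P z)"
    using p(1) p'(1) pP by (simp add: real_polynomial_function_diff)
  hence "(\<lambda>v. c v - c' v) v = 0"
    using edge_coefficients[OF n \<kappa>, of \<kappa> "\<lambda>z. p z - P z" "\<lambda>v. c v - c' v" v] v p P(2) pP
    by (simp add: spl_diff real_polynomial_function_diff)
  thus ?thesis by simp
qed

section \<open>Triangles of a grid level\<close>

definition tri :: "nat \<Rightarrow> (3 \<Rightarrow> int) \<Rightarrow> point set"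
  where "tri l \<kappa> = {z. 2 ^ (l - 1) *\<^sub>R z \<in> cell \<kappa>}"

lemma scaled_image: "(\<lambda>x. (1/2) ^ (l - 1) *\<^sub>R x) ` S = {z. 2 ^ (l - 1) *\<^sub>R z \<in> S}" for S :: "point set"
proof (intro equalityI subsetI)
  fix z assume "z \<in> (\<lambda>x. (1/2) ^ (l - 1) *\<^sub>R x) ` S"
  thus "z \<in> {z. 2 ^ (l - 1) *\<^sub>R z \<in> S}" by (auto simp: power_one_over)
next
  fix z assume "z \<in> {z. 2 ^ (l - 1) *\<^sub>R z \<in> S}"
  moreover have "z = (1/2) ^ (l - 1) *\<^sub>R (2 ^ (l - 1) *\<^sub>R z)" by (simp add: power_one_over)
  ultimately show "z \<in> (\<lambda>x. (1/2) ^ (l - 1) *\<^sub>R x) ` S" by blast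
qed

lemma triangles_eq: "triangles l = tri l ` {\<kappa>. valid \<kappa>}"
  unfolding triangles_def base_triangles_eq image_image scaled_image tri_def ..

lemma grid_vertices_iff: "x \<in> grid_vertices l \<longleftrightarrow> (\<exists>u. 2 ^ (l - 1) *\<^sub>R x = lat u)"
  unfolding grid_vertices_def scaled_image int_lattice_eq by auto

lemma continuous_on_scaled: "continuous_on S (\<lambda>z::point. 2 ^ m *\<^sub>R z)"
  by (intro continuous_intros)

lemma open_tri: "open (tri l \<kappa>)"
proof -
  have "tri l \<kappa> = (\<lambda>z. 2 ^ (l - 1) *\<^sub>R z) -` cell \<kappa>" by (auto simp: tri_def)
  thus ?thesis using open_vimage[OF open_cell continuous_on_scaled] by simp
qed

lemma tri_nonempty: "valid \<kappa> \<Longrightarrow> tri l \<kappa> \<noteq> {}"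
proof -
  assume "valid \<kappa>"
  then obtain z where "z \<in> cell \<kappa>" using cell_nonempty by blast
  hence "(1/2) ^ (l - 1) *\<^sub>R z \<in> tri l \<kappa>" by (simp add: tri_def power_one_over)
  thus ?thesis by blast
qed

lemma tri_unique: "z \<in> tri l \<kappa> \<Longrightarrow> z \<in> tri l \<kappa>' \<Longrightarrow> \<kappa> = \<kappa>'"
  unfolding tri_def using cell_disjoint by blast

lemma tri_inj: "valid \<kappa> \<Longrightarrow> tri l \<kappa> = tri l \<kappa>' \<Longrightarrow> \<kappa> = \<kappa>'"
  using tri_nonempty[of \<kappa> l] tri_unique by blast

lemma closure_tri: "valid \<kappa> \<Longrightarrow> closure (tri l \<kappa>) = {z. 2 ^ (l - 1) *\<^sub>R z \<in> ccell \<kappa>}"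
  unfolding tri_def scaled_image[symmetric] closure_scaleR[symmetric] by (simp add: closure_cell)

lemma valid_tri: "z \<in> tri l \<kappa> \<Longrightarrow> valid \<kappa>"
  unfolding tri_def using valid_of_nonempty by blast

lemma convex_closure_tri: "valid \<kappa> \<Longrightarrow> convex (closure (tri l \<kappa>))"
proof -
  have "convex (tri l \<kappa>)" unfolding tri_def scaled_image[symmetric] by (rule convex_scaling[OF convex_cell])
  thus "convex (closure (tri l \<kappa>))" by (rule convex_closure)
qed

lemma lat_mem_ccell: "lat v \<in> ccell \<kappa> \<longleftrightarrow> (\<forall>j. \<kappa> j \<le> iform j v \<and> iform j v \<le> \<kappa> j + 1)"
proof -
  have "(of_int a :: real) + 1 = of_int (a + 1)" for a by simp
  thus ?thesis unfolding ccell_def mem_Collect_eq form_lat by (simp only: of_int_le_iff)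
qed

lemma lattice_points_ccell:
  assumes "valid \<kappa>" "a = (\<kappa> 2, \<kappa> 1)" "u = (if \<kappa> 3 = \<kappa> 2 - \<kappa> 1 then idir 1 else idir 2)"
  shows "lat v \<in> ccell \<kappa> \<longleftrightarrow> v = a \<or> v = a + u \<or> v = a + idir 3"
proof -
  obtain p q where v: "v = (p, q)" by (cases v)
  have "lat v \<in> ccell \<kappa> \<longleftrightarrow> (\<forall>j. \<kappa> j \<le> iform j v \<and> iform j v \<le> \<kappa> j + 1)"
    by (rule lat_mem_ccell)
  also have "\<dots> \<longleftrightarrow> \<kappa> 1 \<le> q \<and> q \<le> \<kappa> 1 + 1 \<and> \<kappa> 2 \<le> p \<and> p \<le> \<kappa> 2 + 1 \<and> \<kappa> 3 \<le> p - q \<and> p - q \<le> \<kappa> 3 + 1"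
    unfolding all_3_index v iform_def by auto
  also have "\<dots> \<longleftrightarrow> v = a \<or> v = a + u \<or> v = a + idir 3"
  proof (cases "\<kappa> 3 = \<kappa> 2 - \<kappa> 1")
    case True
    have "(k1 \<le> q \<and> q \<le> k1 + 1 \<and> k2 \<le> p \<and> p \<le> k2 + 1 \<and> k2 - k1 \<le> p - q \<and> p - q \<le> k2 - k1 + 1) \<longleftrightarrow>
        ((p = k2 \<and> q = k1) \<or> (p = k2 + 1 \<and> q = k1) \<or> (p = k2 + 1 \<and> q = k1 + 1))" for k1 k2 :: int
      by presburger
    thus ?thesis using True assms(2,3) by (simp add: v idir_def)
  next
    case False
    hence k3: "\<kappa> 3 = \<kappa> 2 - \<kappa> 1 - 1" using assms(1) by (simp add: valid_def)
    have "(k1 \<le> q \<and> q \<le> k1 + 1 \<and> k2 \<le> p \<and> p \<le> k2 + 1 \<and> k2 - k1 - 1 \<le> p - q \<and> p - q \<le> k2 - k1) \<longleftrightarrow>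
        ((p = k2 \<and> q = k1) \<or> (p = k2 \<and> q = k1 + 1) \<or> (p = k2 + 1 \<and> q = k1 + 1))" for k1 k2 :: int
      by presburger
    thus ?thesis using False k3 assms(2,3) by (simp add: v idir_def)
  qed
  finally show ?thesis .
qed

text \<open>The three corners are not collinear, so all of them are extreme points, and they are the
  only lattice points of the closed triangle.\<close>

lemma tri_vertices_tri:
  assumes "valid \<kappa>"
  shows "x \<in> tri_vertices (tri l \<kappa>) \<longleftrightarrow> (\<exists>v. 2 ^ (l - 1) *\<^sub>R x = lat v \<and> lat v \<in> ccell \<kappa>)"
proof -
  let ?a = "(\<kappa> 2, \<kappa> 1)" and ?u = "if \<kappa> 3 = \<kappa> 2 - \<kappa> 1 then idir 1 else idir 2"
  let ?s = "\<lambda>x::point. (1/2) ^ (l - 1) *\<^sub>R x"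
  let ?S = "{lat ?a, lat (?a + ?u), lat (?a + idir 3)}"
  have cc: "ccell \<kappa> = convex hull ?S"
  proof -
    have u: "lat ?u = (if \<kappa> 3 = \<kappa> 2 - \<kappa> 1 then dir 1 else dir 2)" by simp
    show ?thesis unfolding lat_add u lat_idir by (rule convex_hull_ccell[OF assms refl refl, symmetric])
  qed
  have cl: "closure (tri l \<kappa>) = convex hull (?s ` ?S)"
    unfolding closure_tri[OF assms] scaled_image[symmetric] cc convex_hull_scaling ..
  have "\<not> collinear (?s ` ?S)"
  proof
    assume "collinear (?s ` ?S)"
    hence "collinear {?s (lat (?a + ?u)), ?s (lat ?a), ?s (lat (?a + idir 3))}"
      by (simp add: insert_commute)
    hence "collinear {0, ?s (lat (?a + ?u)) - ?s (lat ?a), ?s (lat (?a + idir 3)) - ?s (lat ?a)}"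
      by (rule iffD1[OF collinear_3, rotated]) (simp add: NO_MATCH_def)
    hence "collinear {0, ?s (lat ?u), ?s (dir 3)}"
      by (simp add: lat_add scaleR_add_right)
    moreover have "lat ?u = dir 1 \<or> lat ?u = dir 2" by simp
    ultimately show False unfolding collinear_lemma by (auto simp: dir_def zero_prod_def)
  qed
  hence "\<not> affine_dependent (?s ` ?S)"
    by (simp add: collinear_3_eq_affine_dependent)
  hence "x \<in> tri_vertices (tri l \<kappa>) \<longleftrightarrow> x \<in> ?s ` ?S"
    unfolding tri_vertices_def cl mem_Collect_eq by (rule extreme_point_of_convex_hull_affine_independent)
  also have "\<dots> \<longleftrightarrow> 2 ^ (l - 1) *\<^sub>R x \<in> ?S" unfolding scaled_image by simp
  also have "\<dots> \<longleftrightarrow> (\<exists>v. 2 ^ (l - 1) *\<^sub>R x = lat v \<and> lat v \<in> ccell \<kappa>)"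
    unfolding lattice_points_ccell[OF assms refl refl] by blast
  finally show ?thesis .
qed

lemma tri_vertices_subset: "tri_vertices T \<subseteq> closure T"
  by (auto simp: tri_vertices_def extreme_point_of_def)

lemma tri_edges_subset:
  assumes "valid \<kappa>" "e \<in> tri_edges (tri l \<kappa>)"
  shows "e \<subseteq> closure (tri l \<kappa>)"
proof -
  obtain a b where "e = open_segment a b" "a \<in> closure (tri l \<kappa>)" "b \<in> closure (tri l \<kappa>)"
    using assms(2) tri_vertices_subset unfolding tri_edges_def by blast
  thus ?thesis using convex_closure_tri[OF assms(1)] convex_contains_open_segment by blast
qed

lemma unit_displacement:
  assumes "u \<noteq> u'" "\<And>j. \<bar>iform j u' - iform j u\<bar> \<le> 1"
  obtains i where "u' = u + idir i \<or> u = u' + idir i"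
proof -
  obtain p q p' q' where u: "u = (p, q)" "u' = (p', q')" by (cases u; cases u')
  define dp dq where "dp = p' - p" and "dq = q' - q"
  have d: "u' = (p + dp, q + dq)" by (simp add: u dp_def dq_def)
  have b: "\<bar>dq\<bar> \<le> 1" "\<bar>dp\<bar> \<le> 1" "\<bar>dp - dq\<bar> \<le> 1"
    using assms(2)[of 1] assms(2)[of 2] assms(2)[of 3] by (simp_all add: u iform_def dp_def dq_def algebra_simps)
  have "dp \<noteq> 0 \<or> dq \<noteq> 0" using assms(1) u(1) d by auto
  moreover have "dp = - 1 \<or> dp = 0 \<or> dp = 1" "dq = - 1 \<or> dq = 0 \<or> dq = 1" using b by auto
  ultimately show ?thesis
    using that[of 1] that[of 2] that[of 3] b(3) by (elim disjE) (auto simp: u(1) d idir_def)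
qed

lemma edge_subset_segment:
  assumes "\<kappa> i = iform i u" "\<And>j. j \<noteq> i \<Longrightarrow> \<kappa> j = min (iform j u) (iform j (u + idir i))"
    "2 ^ (l - 1) *\<^sub>R a = lat u" "2 ^ (l - 1) *\<^sub>R b = lat (u + idir i)" "2 ^ (l - 1) *\<^sub>R z \<in> edge i \<kappa>"
  shows "z \<in> open_segment a b"
proof -
  let ?r = "2 ^ (l - 1) :: real" and ?z = "(2::real) ^ (l - 1) *\<^sub>R z"
  obtain j :: 3 where j: "j \<noteq> i" using that[of 1] that[of 2] by (cases "i = 1") auto
  define s where "s = iform j (idir i)"
  have s: "s = 1 \<or> s = - 1" unfolding s_def by (rule iform_other[OF j])
  define t where "t = (form j ?z - of_int (iform j u)) * of_int s"
  have "of_int (\<kappa> j) < form j ?z" "form j ?z < of_int (\<kappa> j) + 1" "form i ?z = of_int (\<kappa> i)"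
    using assms(5) j by (auto simp: edge_def)
  moreover have "\<kappa> j = iform j u + min 0 s" using assms(2)[OF j] by (simp add: iform_add s_def)
  ultimately have t: "0 < t" "t < 1" using s by (auto simp: t_def)
  have "form j ?z = form j (lat u + t *\<^sub>R dir i)"
    using s by (auto simp: form_add form_scale form_dir form_lat t_def s_def[symmetric])
  moreover have "form i ?z = form i (lat u + t *\<^sub>R dir i)"
    using assms(1) \<open>form i ?z = of_int (\<kappa> i)\<close> by (simp add: form_add form_scale form_dir form_lat)
  ultimately have "?z = lat u + t *\<^sub>R dir i" using form_inj[OF j] by blast
  also have "\<dots> = (1 - t) *\<^sub>R lat u + t *\<^sub>R lat (u + idir i)" by (simp add: lat_add algebra_simps)
  also have "\<dots> = ?r *\<^sub>R ((1 - t) *\<^sub>R a + t *\<^sub>R b)"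
    unfolding assms(3)[symmetric] assms(4)[symmetric] by (simp add: scaleR_add_right mult.commute)
  finally have z: "z = (1 - t) *\<^sub>R a + t *\<^sub>R b" by simp
  have "u \<noteq> u + idir i" using exhaust_3[of i] by (auto simp: idir_def zero_prod_def)
  hence "lat u \<noteq> lat (u + idir i)" by (metis lat_eq_iff)
  hence "a \<noteq> b" using assms(3,4) by auto
  thus ?thesis unfolding z in_segment using t by blast
qed

text \<open>Both end points of \<open>e\<close> are vertices of both triangles. They differ in each
  form other than \<open>form i\<close>, which fixes those two indices as the smaller of the values;
  so the triangles differ in the index \<open>i\<close> alone, lying on the two sides of the
  line.\<close>

lemma common_edge:
  assumes "valid \<kappa>" "valid \<kappa>'" "\<kappa> \<noteq> \<kappa>'" "e \<in> tri_edges (tri l \<kappa>)" "e \<in> tri_edges (tri l \<kappa>')"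
  obtains i \<kappa>0 where "(\<kappa> = \<kappa>0 \<and> \<kappa>' = below i \<kappa>0) \<or> (\<kappa>' = \<kappa>0 \<and> \<kappa> = below i \<kappa>0)"
    "edge_type i e" "\<And>z. 2 ^ (l - 1) *\<^sub>R z \<in> edge i \<kappa>0 \<Longrightarrow> z \<in> e"
proof -
  obtain a b where e: "e = open_segment a b" and ab: "a \<in> tri_vertices (tri l \<kappa>)" "b \<in> tri_vertices (tri l \<kappa>)" "a \<noteq> b"
    using assms(4) by (auto simp: tri_edges_def)
  obtain a' b' where e': "e = open_segment a' b'" and ab': "a' \<in> tri_vertices (tri l \<kappa>')" "b' \<in> tri_vertices (tri l \<kappa>')" "a' \<noteq> b'"
    using assms(5) by (auto simp: tri_edges_def)
  have "{a, b} = {a', b'}" using e e' ab(3) by (metis open_segment_eq)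
  hence abv: "a \<in> tri_vertices (tri l \<kappa>')" "b \<in> tri_vertices (tri l \<kappa>')" using ab' by (auto simp: doubleton_eq_iff)
  obtain u where u: "2 ^ (l - 1) *\<^sub>R a = lat u" "lat u \<in> ccell \<kappa>" using ab(1) tri_vertices_tri[OF assms(1)] by blast
  obtain w where w: "2 ^ (l - 1) *\<^sub>R b = lat w" "lat w \<in> ccell \<kappa>" using ab(2) tri_vertices_tri[OF assms(1)] by blast
  have uw': "lat u \<in> ccell \<kappa>'" "lat w \<in> ccell \<kappa>'" using abv tri_vertices_tri[OF assms(2)] u(1) w(1) by auto
  have cc: "\<mu> j \<le> iform j v \<and> iform j v \<le> \<mu> j + 1" if "lat v \<in> ccell \<mu>" for \<mu> j v
    using that unfolding lat_mem_ccell by blast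
  note goal = that
  have main: thesis
    if wu: "w = u + idir i" and e: "e = open_segment a b"
      and u: "2 ^ (l - 1) *\<^sub>R a = lat u" "lat u \<in> ccell \<kappa>" "lat u \<in> ccell \<kappa>'"
      and w: "2 ^ (l - 1) *\<^sub>R b = lat w" "lat w \<in> ccell \<kappa>" "lat w \<in> ccell \<kappa>'" for u w a b i
  proof -
    have other: "\<kappa> j = min (iform j u) (iform j w) \<and> \<kappa>' j = min (iform j u) (iform j w)" if j: "j \<noteq> i" for j
    proof -
      have "iform j w = iform j u + iform j (idir i)" by (simp add: wu iform_add)
      thus ?thesis using iform_other[OF j] cc[OF u(2), of j] cc[OF u(3), of j] cc[OF w(2), of j] cc[OF w(3), of j] by auto
    qed
    have "\<kappa> i \<noteq> \<kappa>' i"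
    proof
      assume eq: "\<kappa> i = \<kappa>' i"
      have "\<kappa> = \<kappa>'"
      proof
        fix j show "\<kappa> j = \<kappa>' j" by (cases "j = i") (use eq other[of j] in auto)
      qed
      thus False using assms(3) by simp
    qed
    hence cases: "(\<kappa> i = iform i u \<and> \<kappa>' i = iform i u - 1) \<or> (\<kappa>' i = iform i u \<and> \<kappa> i = iform i u - 1)"
      using cc[OF u(2), of i] cc[OF u(3), of i] by linarith
    have "b - a = (1/2) ^ (l - 1) *\<^sub>R (2 ^ (l - 1) *\<^sub>R b - 2 ^ (l - 1) *\<^sub>R a)"
      by (simp add: power_one_over scaleR_diff_right)
    also have "\<dots> = (1/2) ^ (l - 1) *\<^sub>R dir i" unfolding u(1) w(1) wu by (simp add: lat_add)
    finally have et: "edge_type i e" unfolding edge_type_def e by (intro exI[of _ a] exI[of _ b] exI[of _ "(1/2) ^ (l - 1)"]) simp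
    from cases show thesis
    proof
      assume c: "\<kappa> i = iform i u \<and> \<kappa>' i = iform i u - 1"
      have "\<kappa>' = below i \<kappa>"
      proof
        fix j show "\<kappa>' j = below i \<kappa> j" by (cases "j = i") (use c other[of j] in \<open>auto simp: below_def\<close>)
      qed
      moreover have "z \<in> e" if "2 ^ (l - 1) *\<^sub>R z \<in> edge i \<kappa>" for z
        unfolding e by (rule edge_subset_segment[OF _ _ u(1) w(1)[unfolded wu] that]) (use c other wu in auto)
      ultimately show thesis by (intro goal[of \<kappa> i]) (use et in auto)
    next
      assume c: "\<kappa>' i = iform i u \<and> \<kappa> i = iform i u - 1"
      have "\<kappa> = below i \<kappa>'"
      proof
        fix j show "\<kappa> j = below i \<kappa>' j" by (cases "j = i") (use c other[of j] in \<open>auto simp: below_def\<close>)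
      qed
      moreover have "z \<in> e" if "2 ^ (l - 1) *\<^sub>R z \<in> edge i \<kappa>'" for z
        unfolding e by (rule edge_subset_segment[OF _ _ u(1) w(1)[unfolded wu] that]) (use c other wu in auto)
      ultimately show thesis by (intro goal[of \<kappa>' i]) (use et in auto)
    qed
  qed
  have "2 ^ (l - 1) *\<^sub>R a \<noteq> 2 ^ (l - 1) *\<^sub>R b" using ab(3) by simp
  hence "u \<noteq> w" using u(1) w(1) by metis
  moreover have "\<bar>iform j w - iform j u\<bar> \<le> 1" for j using cc[OF u(2), of j] cc[OF w(2), of j] by linarith
  ultimately obtain i where "w = u + idir i \<or> u = w + idir i" using unit_displacement[of u w] by blast
  thus thesis
  proof
    assume "w = u + idir i"
    thus thesis using main[OF _ e u uw'(1) w uw'(2)] by blast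
  next
    assume "u = w + idir i"
    thus thesis using main[OF _ e[unfolded open_segment_commute[of a b]] w uw'(2) u uw'(1)] by blast
  qed
qed

lemma edge_endpoints:
  assumes "valid \<kappa>" "valid (below i \<kappa>)"
  shows "lat (\<kappa> 2, \<kappa> 1) \<in> ccell \<kappa>" "lat ((\<kappa> 2, \<kappa> 1) + idir i) \<in> ccell \<kappa>"
    "lat (\<kappa> 2, \<kappa> 1) \<in> ccell (below i \<kappa>)" "lat ((\<kappa> 2, \<kappa> 1) + idir i) \<in> ccell (below i \<kappa>)"
  using exhaust_3[of i] edge_corners[OF assms]
  by (elim disjE; simp add: ccell_def all_3_index form_def lat_def idir_def below_def)+

lemma adjacent_common_edge:
  assumes "valid \<kappa>" "valid (below i \<kappa>)"
  shows "tri_edges (tri l \<kappa>) \<inter> tri_edges (tri l (below i \<kappa>)) \<noteq> {}"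
proof -
  let ?a = "(1/2) ^ (l - 1) *\<^sub>R lat (\<kappa> 2, \<kappa> 1)" and ?b = "(1/2) ^ (l - 1) *\<^sub>R lat ((\<kappa> 2, \<kappa> 1) + idir i)"
  have s: "2 ^ (l - 1) *\<^sub>R ?a = lat (\<kappa> 2, \<kappa> 1)" "2 ^ (l - 1) *\<^sub>R ?b = lat ((\<kappa> 2, \<kappa> 1) + idir i)"
    by (simp_all add: power_one_over)
  have "(\<kappa> 2, \<kappa> 1) \<noteq> (\<kappa> 2, \<kappa> 1) + idir i" using exhaust_3[of i] by (auto simp: idir_def zero_prod_def)
  hence "?a \<noteq> ?b" using s lat_eq_iff by metis
  hence "open_segment ?a ?b \<in> tri_edges (tri l \<kappa>)" "open_segment ?a ?b \<in> tri_edges (tri l (below i \<kappa>))"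
    unfolding tri_edges_def mem_Collect_eq using tri_vertices_tri[OF assms(1)] tri_vertices_tri[OF assms(2)] s
      edge_endpoints[OF assms] by metis+
  thus ?thesis by blast
qed

lemma lattice_of_two_forms:
  assumes "j \<noteq> k" "form j y = of_int p" "form k y = of_int q"
  obtains u where "y = lat u"
proof -
  have "fst y = of_int (if j = 2 then p else if k = 2 then q else p + q)"
    "snd y = of_int (if j = 1 then p else if k = 1 then q else if j = 2 then p - q else q - p)"
    using assms exhaust_3[of j] exhaust_3[of k] by (elim disjE; simp add: form_def)+
  hence "y = lat (if j = 2 then p else if k = 2 then q else p + q,
      if j = 1 then p else if k = 1 then q else if j = 2 then p - q else q - p)"
    by (simp only: lat_def prod_eq_iff fst_conv snd_conv)
  thus ?thesis by (rule that)
qed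

text \<open>In every form where the indices differ they differ by one, and the form is determined at
  each common point. A single such form means neighbours across an edge; two of them leave just one
  common point, with integer forms.\<close>

lemma touching_triangles:
  assumes "valid \<kappa>" "valid \<kappa>'" "\<kappa> \<noteq> \<kappa>'" "x \<in> closure (tri l \<kappa>)" "x \<in> closure (tri l \<kappa>')"
  shows "tri_edges (tri l \<kappa>) \<inter> tri_edges (tri l \<kappa>') \<noteq> {} \<or>
    (x \<in> grid_vertices l \<and> closure (tri l \<kappa>) \<inter> closure (tri l \<kappa>') = {x})"
proof -
  have diff: "\<bar>\<kappa> j - \<kappa>' j\<bar> \<le> 1 \<and> (\<kappa> j \<noteq> \<kappa>' j \<longrightarrow> form j (2 ^ (l - 1) *\<^sub>R y) = of_int (max (\<kappa> j) (\<kappa>' j)))"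
    if "y \<in> closure (tri l \<kappa>)" "y \<in> closure (tri l \<kappa>')" for j y
  proof -
    let ?f = "form j (2 ^ (l - 1) *\<^sub>R y)"
    have b: "of_int (\<kappa> j) \<le> ?f" "?f \<le> of_int (\<kappa> j) + 1" "of_int (\<kappa>' j) \<le> ?f" "?f \<le> of_int (\<kappa>' j) + 1"
      using that by (auto simp: closure_tri assms ccell_def)
    hence "\<kappa> j \<le> \<kappa>' j + 1" "\<kappa>' j \<le> \<kappa> j + 1" by linarith+
    moreover have "?f = of_int (max (\<kappa> j) (\<kappa>' j))" if ne: "\<kappa> j \<noteq> \<kappa>' j"
    proof (cases "\<kappa> j < \<kappa>' j")
      case True
      hence "\<kappa>' j = \<kappa> j + 1" using calculation by linarith
      thus ?thesis using b by simp
    next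
      case False
      hence "\<kappa> j = \<kappa>' j + 1" using calculation ne by linarith
      thus ?thesis using b by simp
    qed
    ultimately show ?thesis by auto
  qed
  obtain i where i: "\<kappa> i \<noteq> \<kappa>' i" using assms(3) by blast
  show ?thesis
  proof (cases "\<exists>j. j \<noteq> i \<and> \<kappa> j \<noteq> \<kappa>' j")
    case True
    then obtain j where j: "j \<noteq> i" "\<kappa> j \<noteq> \<kappa>' j" by blast
    have "y = x" if "y \<in> closure (tri l \<kappa>)" "y \<in> closure (tri l \<kappa>')" for y
    proof -
      have "2 ^ (l - 1) *\<^sub>R y = 2 ^ (l - 1) *\<^sub>R x"
        using form_inj[OF j(1)] diff[OF that, of j] diff[OF assms(4,5), of j] j(2)
          diff[OF that, of i] diff[OF assms(4,5), of i] i by metis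
      thus ?thesis by simp
    qed
    hence "closure (tri l \<kappa>) \<inter> closure (tri l \<kappa>') = {x}" using assms(4,5) by blast
    moreover obtain u where "2 ^ (l - 1) *\<^sub>R x = lat u"
      using lattice_of_two_forms[OF j(1)] diff[OF assms(4,5)] i j(2) by metis
    ultimately show ?thesis using grid_vertices_iff by blast
  next
    case False
    have "\<kappa>' = below i \<kappa> \<or> \<kappa> = below i \<kappa>'"
    proof (cases "\<kappa> i < \<kappa>' i")
      case True
      hence "\<kappa> i = \<kappa>' i - 1" using diff[OF assms(4,5), of i] by linarith
      hence "\<kappa> j = below i \<kappa>' j" for j using False by (auto simp: below_def)
      thus ?thesis by blast
    next
      case lt: False
      hence "\<kappa>' i = \<kappa> i - 1" using diff[OF assms(4,5), of i] i by linarith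
      hence "\<kappa>' j = below i \<kappa> j" for j using False by (auto simp: below_def)
      thus ?thesis by blast
    qed
    thus ?thesis using adjacent_common_edge[of \<kappa> i l] adjacent_common_edge[of \<kappa>' i l] assms(1,2) by auto
  qed
qed

text \<open>The lines of level \<open>m\<close> are also lines of level \<open>l\<close>, so the
  index of the surrounding triangle arises by integer division, rounding down.\<close>

lemma tri_refine:
  assumes "1 \<le> m" "m \<le> l" "valid \<kappa>"
  obtains \<kappa>' where "valid \<kappa>'" "tri l \<kappa> \<subseteq> tri m \<kappa>'"
proof -
  define k where "k = l - m"
  define \<kappa>' where "\<kappa>' j = \<kappa> j div 2 ^ k" for j
  have l: "l - 1 = k + (m - 1)" using assms(1,2) by (simp add: k_def)
  have sub: "tri l \<kappa> \<subseteq> tri m \<kappa>'"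
  proof
    fix z assume z: "z \<in> tri l \<kappa>"
    have "of_int (\<kappa>' j) < form j (2 ^ (m - 1) *\<^sub>R z) \<and> form j (2 ^ (m - 1) *\<^sub>R z) < of_int (\<kappa>' j) + 1" for j
    proof -
      let ?f = "form j (2 ^ (m - 1) *\<^sub>R z)"
      have f: "form j (2 ^ (l - 1) *\<^sub>R z) = 2 ^ k * ?f" by (simp add: l[unfolded One_nat_def] power_add form_scale)
      have b: "of_int (\<kappa> j) < 2 ^ k * ?f" "2 ^ k * ?f < of_int (\<kappa> j) + 1"
        using z unfolding tri_def cell_def f[symmetric] by blast+
      have d: "2 ^ k * \<kappa>' j \<le> \<kappa> j" "\<kappa> j + 1 \<le> 2 ^ k * (\<kappa>' j + 1)"
      proof -
        have "2 ^ k * \<kappa>' j + \<kappa> j mod 2 ^ k = \<kappa> j" unfolding \<kappa>'_def by (rule mult_div_mod_eq)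
        moreover have "0 \<le> \<kappa> j mod 2 ^ k" "\<kappa> j mod 2 ^ k < 2 ^ k" by simp_all
        moreover have "2 ^ k * (\<kappa>' j + 1) = 2 ^ k * \<kappa>' j + 2 ^ k" by (simp add: algebra_simps)
        ultimately show "2 ^ k * \<kappa>' j \<le> \<kappa> j" "\<kappa> j + 1 \<le> 2 ^ k * (\<kappa>' j + 1)" by linarith+
      qed
      have "(of_int (2 ^ k * \<kappa>' j) :: real) \<le> of_int (\<kappa> j)" "(of_int (\<kappa> j + 1) :: real) \<le> of_int (2 ^ k * (\<kappa>' j + 1))"
        using d by (simp_all only: of_int_le_iff)
      hence "2 ^ k * of_int (\<kappa>' j) \<le> (of_int (\<kappa> j) :: real)"
        "of_int (\<kappa> j) + (1 :: real) \<le> 2 ^ k * (of_int (\<kappa>' j) + 1)" by simp_all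
      hence "2 ^ k * of_int (\<kappa>' j) < 2 ^ k * ?f" "2 ^ k * ?f < 2 ^ k * (of_int (\<kappa>' j) + 1)"
        using b by linarith+
      thus ?thesis by simp
    qed
    thus "z \<in> tri m \<kappa>'" by (simp add: tri_def cell_def)
  qed
  moreover have "valid \<kappa>'" using tri_nonempty[OF assms(3), of l] sub valid_tri by blast
  ultimately show ?thesis using that by blast
qed

lemma tri_cover: obtains \<kappa> where "valid \<kappa>" "z \<in> closure (tri l \<kappa>)"
proof -
  obtain \<kappa> where "valid \<kappa>" "2 ^ (l - 1) *\<^sub>R z \<in> ccell \<kappa>" using ccell_cover by metis
  thus ?thesis using that closure_tri by blast
qed

lemma triangle_properties:
  assumes "T \<in> all_triangles"
  shows "open T" "T \<noteq> {}"
  using assms open_tri tri_nonempty unfolding all_triangles_def triangles_eq by blast+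

text \<open>Edges and vertices have empty interior, so no triangle of any level is hidden among
  them.\<close>

lemma hat_triangles:
  assumes "T \<in> all_triangles" "X \<in> hat T" "X \<in> all_triangles"
  shows "X = T"
proof (rule ccontr)
  assume "X \<noteq> T"
  hence "(\<exists>a b. X = open_segment a b) \<or> (\<exists>v. X = {v})"
    using assms(2) unfolding hat_def tri_edges_def by blast
  moreover have "interior X = X" "X \<noteq> {}" using triangle_properties[OF assms(3)] by (simp_all add: interior_open)
  moreover have "interior (open_segment a b) = {}" for a b :: point by (simp add: interior_open_segment)
  ultimately show False by (metis interior_singleton)
qed

lemma hat_self: "T \<in> hat T"
  by (simp add: hat_def)

lemma Union_hat_triangles:
  assumes "\<T> \<subseteq> all_triangles"
  shows "\<Union> (hat ` \<T>) \<inter> all_triangles = \<T>"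
  using assms hat_triangles hat_self by blast

lemma triangles_subset: "1 \<le> l \<Longrightarrow> triangles l \<subseteq> all_triangles"
  unfolding all_triangles_def by (simp add: UN_upper)

section \<open>The hierarchical spline space\<close>

definition lspl :: "nat ^ 3 \<Rightarrow> nat \<Rightarrow> (int \<times> int \<Rightarrow> real) \<Rightarrow> point \<Rightarrow> real"
  where "lspl n l c z = spl n c (2 ^ (l - 1) *\<^sub>R z)"

lemma kpoly_null: "(\<lambda>_. 0) \<in> kpoly n"
  by (simp add: kpoly_def poly2_const dird_power_zero)

lemma kpoly_add: "p \<in> kpoly n \<Longrightarrow> q \<in> kpoly n \<Longrightarrow> (\<lambda>z. p z + q z) \<in> kpoly n"
  unfolding kpoly_def mem_Collect_eq by (simp add: poly2_add dird_power_add poly2_dird_power)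

lemma kpoly_cmult: "p \<in> kpoly n \<Longrightarrow> (\<lambda>z. c * p z) \<in> kpoly n"
  unfolding kpoly_def mem_Collect_eq by (simp add: poly2_mult poly2_const dird_power_cmult poly2_dird_power)

lemma contact_null: "(\<And>z. z \<in> T \<Longrightarrow> f z = 0) \<Longrightarrow> (\<And>z. z \<in> T' \<Longrightarrow> f z = 0) \<Longrightarrow> contact k f T T' e"
  unfolding contact_iff using poly2_const vanishing_null by (intro exI[of _ "\<lambda>_. 0"]) auto

lemma contact_add: "contact k f T T' e \<Longrightarrow> contact k g T T' e \<Longrightarrow> contact k (\<lambda>z. f z + g z) T T' e"
proof -
  assume "contact k f T T' e" "contact k g T T' e"
  then obtain p p' q q' where p: "poly2 p" "poly2 p'" "\<forall>z\<in>T. f z = p z" "\<forall>z\<in>T'. f z = p' z" "vanishing k e (\<lambda>z. p z - p' z)"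
    and q: "poly2 q" "poly2 q'" "\<forall>z\<in>T. g z = q z" "\<forall>z\<in>T'. g z = q' z" "vanishing k e (\<lambda>z. q z - q' z)"
    unfolding contact_iff by blast
  have "vanishing k e (\<lambda>z. (p z - p' z) + (q z - q' z))"
    by (rule vanishing_add[OF _ _ p(5) q(5)]) (intro real_polynomial_function_diff p q)+
  moreover have "(\<lambda>z. (p z - p' z) + (q z - q' z)) = (\<lambda>z. (p z + q z) - (p' z + q' z))" by (simp add: fun_eq_iff)
  ultimately show ?thesis unfolding contact_iff
    using p(3,4) q(3,4) poly2_add[OF p(1) q(1)] poly2_add[OF p(2) q(2)]
    by (intro exI[of _ "\<lambda>z. p z + q z"] exI[of _ "\<lambda>z. p' z + q' z"]) simp
qed

lemma contact_cmult: "contact k f T T' e \<Longrightarrow> contact k (\<lambda>z. c * f z) T T' e"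
proof -
  assume "contact k f T T' e"
  then obtain p p' where p: "poly2 p" "poly2 p'" "\<forall>z\<in>T. f z = p z" "\<forall>z\<in>T'. f z = p' z" "vanishing k e (\<lambda>z. p z - p' z)"
    unfolding contact_iff by blast
  have "vanishing k e (\<lambda>z. c * (p z - p' z))"
    by (rule vanishing_cmult[OF _ p(5)]) (intro real_polynomial_function_diff p)
  moreover have "(\<lambda>z. c * (p z - p' z)) = (\<lambda>z. c * p z - c * p' z)" by (simp add: fun_eq_iff right_diff_distrib)
  ultimately show ?thesis unfolding contact_iff
    using p(3,4) poly2_mult[OF poly2_const p(1)] poly2_mult[OF poly2_const p(2)]
    by (intro exI[of _ "\<lambda>z. c * p z"] exI[of _ "\<lambda>z. c * p' z"]) simp
qed

lemma tangential_scaled_segment: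
  assumes "edge_type i e"
  shows "tangential i ((\<lambda>z. 2 ^ m *\<^sub>R z) ` e)"
  unfolding tangential_def
proof
  obtain a b c where e: "e = open_segment a b" "c \<noteq> 0" "b - a = c *\<^sub>R dir i" using assms unfolding edge_type_def by blast
  fix y assume "y \<in> (\<lambda>z. 2 ^ m *\<^sub>R z) ` e"
  then obtain z where z: "z \<in> open_segment a b" "y = 2 ^ m *\<^sub>R z" using e(1) by blast
  obtain t where t: "0 < t" "t < 1" "z = (1 - t) *\<^sub>R a + t *\<^sub>R b" and ab: "a \<noteq> b" using z(1) by (auto simp: in_segment)
  have "((\<lambda>h. t + h / (2 ^ m * c)) \<longlongrightarrow> t) (nhds 0)"
    using e(2) by (auto intro!: tendsto_eq_intros filterlim_ident)
  hence "\<forall>\<^sub>F h in nhds 0. t + h / (2 ^ m * c) \<in> {0<..<1}"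
    using t(1,2) by (metis greaterThanLessThan_iff open_greaterThanLessThan topological_tendstoD)
  thus "\<forall>\<^sub>F h in nhds 0. y + h *\<^sub>R dir i \<in> (\<lambda>z. 2 ^ m *\<^sub>R z) ` e"
  proof eventually_elim
    case (elim h)
    let ?t = "t + h / (2 ^ m * c)"
    have b: "b = a + c *\<^sub>R dir i" using e(3) by (metis add.commute diff_add_cancel)
    have zt: "z = a + (t * c) *\<^sub>R dir i" unfolding t(3) b by (simp add: algebra_simps)
    have "(1 - ?t) *\<^sub>R a + ?t *\<^sub>R b = a + (?t * c) *\<^sub>R dir i" unfolding b by (simp add: algebra_simps)
    moreover have "?t * c = t * c + h / 2 ^ m" using e(2) by (simp add: field_simps)
    ultimately have "2 ^ m *\<^sub>R ((1 - ?t) *\<^sub>R a + ?t *\<^sub>R b) = y + h *\<^sub>R dir i"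
      unfolding z(2) zt by (simp add: algebra_simps)
    moreover have "(1 - ?t) *\<^sub>R a + ?t *\<^sub>R b \<in> e" unfolding e(1) in_segment using elim ab by auto
    ultimately show ?case by (metis imageI)
  qed
qed

text \<open>\<open>T\<close> and \<open>T'\<close> may be of a finer level than the spline and may
  even lie in one triangle of level \<open>l\<close>. It is enough that \<open>e\<close> has type
  \<open>i\<close> and lies in the closures of both.\<close>

lemma lspl_contact:
  assumes n: "\<forall>i. n $ i \<ge> 1" and \<kappa>: "valid \<kappa>" "valid \<kappa>'"
    and T: "T \<subseteq> tri l \<kappa>" "T' \<subseteq> tri l \<kappa>'" and e: "edge_type i e" "e \<subseteq> closure T" "e \<subseteq> closure T'"
  shows "contact (contact_order n i) (lspl n l c) T T' e"
proof -
  let ?r = "2 ^ (l - 1) :: real"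
  obtain p where p: "p \<in> kpoly n" "\<forall>z\<in>cell \<kappa>. spl n c z = p z" using spl_piece[OF n \<kappa>(1)] by blast
  obtain p' where p': "p' \<in> kpoly n" "\<forall>z\<in>cell \<kappa>'. spl n c z = p' z" using spl_piece[OF n \<kappa>(2)] by blast
  have pp: "poly2 p" "poly2 p'" using p(1) p'(1) by (auto intro: kpoly_poly2)
  have cl: "(\<lambda>z. ?r *\<^sub>R z) ` e \<subseteq> ccell \<kappa>" "(\<lambda>z. ?r *\<^sub>R z) ` e \<subseteq> ccell \<kappa>'"
    using e(2,3) closure_mono[OF T(1)] closure_mono[OF T(2)] closure_tri[OF \<kappa>(1)] closure_tri[OF \<kappa>(2)] by blast+
  have "vanishing (contact_order n i) ((\<lambda>z. ?r *\<^sub>R z) ` e) (\<lambda>z. p z - p' z)"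
    by (rule spl_smooth[OF n \<kappa> tangential_scaled_segment[OF e(1)] cl pp]) (use p(2) p'(2) in auto)
  hence "vanishing (contact_order n i) e (\<lambda>z. (\<lambda>z. p z - p' z) (?r *\<^sub>R z + 0))"
    by (rule vanishing_affine[OF real_polynomial_function_diff[OF pp]]) simp
  hence v: "vanishing (contact_order n i) e (\<lambda>z. p (?r *\<^sub>R z + 0) - p' (?r *\<^sub>R z + 0))" by simp
  have "\<forall>z\<in>T. lspl n l c z = p (?r *\<^sub>R z + 0)" "\<forall>z\<in>T'. lspl n l c z = p' (?r *\<^sub>R z + 0)"
    using T p(2) p'(2) by (auto simp: lspl_def tri_def)
  thus ?thesis unfolding contact_iff using poly2_affine[OF pp(1), of ?r 0] poly2_affine[OF pp(2), of ?r 0] v by blast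
qed

lemma continuous_lspl: "\<forall>i. n $ i \<ge> 1 \<Longrightarrow> continuous_on S (lspl n l c)"
  unfolding lspl_def by (rule continuous_on_compose2[OF continuous_spl]) (auto intro!: continuous_intros)

lemma lspl_single: "\<forall>i. n $ i \<ge> 1 \<Longrightarrow> lspl n l (\<lambda>w. if w = v then r else 0) z = r * box_spline n (2 ^ (l - 1) *\<^sub>R z - lat v)"
  unfolding lspl_def by (rule spl_single)

section \<open>The spline space and its basis over a fixed hierarchy of domains\<close>

locale hierarchy =
  fixes n d :: "nat ^ 3" and N :: nat and M :: "nat \<Rightarrow> point set set" and \<Omega> :: "point set"
  assumes n: "\<forall>i. n $ i \<ge> 1"
    and d: "\<And>i. d $ i = contact_order n i"
    and domain: "hierarchical_domain N M \<Omega>"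
    and admissible: "\<forall>l\<in>{1..N}. admissible n l (M l)"
begin

definition cells :: "nat \<Rightarrow> (3 \<Rightarrow> int) set"
  where "cells l = {\<kappa>. valid \<kappa> \<and> tri l \<kappa> \<in> M l}"

abbreviation space :: "(point \<Rightarrow> real) set"
  where "space \<equiv> spline_space d N M (local_polys n)"

lemma multicell_cells:
  assumes "l \<in> {1..N}"
  shows "M l \<inter> all_triangles = tri l ` cells l" "M l \<inter> triangles l = tri l ` cells l" "finite (cells l)"
proof -
  have "\<forall>l\<in>{1..N}. multicell l (M l)" using domain unfolding hierarchical_domain_def by (elim conjE)
  hence "multicell l (M l)" using assms by (rule bspec)
  then obtain \<T> where T: "finite \<T>" "\<T> \<subseteq> triangles l" "M l = \<Union> (hat ` \<T>)"
    unfolding multicell_def by (elim exE conjE)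
  have sub: "triangles l \<subseteq> all_triangles" using assms triangles_subset by simp
  have MT: "M l \<inter> all_triangles = \<T>" using Union_hat_triangles[of \<T>] T(2,3) sub by simp
  have eq: "\<T> = tri l ` cells l"
  proof (intro equalityI subsetI)
    fix X assume "X \<in> \<T>"
    moreover from this obtain \<kappa> where "valid \<kappa>" "X = tri l \<kappa>" using T(2) by (auto simp: triangles_eq)
    moreover have "X \<in> M l" using MT \<open>X \<in> \<T>\<close> by blast
    ultimately show "X \<in> tri l ` cells l" by (auto simp: cells_def)
  next
    fix X assume "X \<in> tri l ` cells l"
    hence "X \<in> M l" "X \<in> triangles l" by (auto simp: cells_def triangles_eq)
    thus "X \<in> \<T>" using MT sub by blast
  qed
  show "M l \<inter> all_triangles = tri l ` cells l" using MT eq by simp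
  thus "M l \<inter> triangles l = tri l ` cells l" using sub eq T(2) by blast
  have "inj_on (tri l) (cells l)" by (rule inj_onI) (simp add: cells_def tri_inj)
  thus "finite (cells l)" using T(1) eq finite_imageD by blast
qed

lemma valid_cells: "\<kappa> \<in> cells l \<Longrightarrow> valid \<kappa>"
  by (simp add: cells_def)

lemma region_cells: "l \<in> {1..N} \<Longrightarrow> region (M l) = (\<Union>\<kappa>\<in>cells l. closure (tri l \<kappa>))"
  unfolding region_def multicell_cells(1) by simp

lemma tri_subset_region: "l \<in> {1..N} \<Longrightarrow> \<kappa> \<in> cells l \<Longrightarrow> tri l \<kappa> \<subseteq> region (M l)"
  unfolding region_cells using closure_subset by blast

lemma region_0: "region (M 0) = {}"
  using domain by (simp add: hierarchical_domain_def region_def)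

lemma closed_region: "l \<le> N \<Longrightarrow> closed (region (M l))"
proof (cases "l = 0")
  case False
  assume "l \<le> N"
  hence "l \<in> {1..N}" using False by simp
  thus ?thesis unfolding region_cells[OF \<open>l \<in> {1..N}\<close>]
    by (intro closed_UN multicell_cells(3) ballI closed_closure)
qed (simp add: region_0)

lemma region_mono: "m \<le> l \<Longrightarrow> l \<le> N \<Longrightarrow> region (M m) \<subseteq> region (M l)"
proof (induction l)
  case (Suc l)
  have "region (M (Suc l - 1)) \<subseteq> region (M (Suc l))"
    using domain Suc.prems(2) unfolding hierarchical_domain_def by (metis One_nat_def Suc_le_mono atLeastAtMost_iff zero_le)
  thus ?case using Suc by (cases "m = Suc l") auto
qed simp

lemma region_N: "region (M N) = \<Omega>"
  using domain by (simp add: hierarchical_domain_def)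

lemma region_subset: "l \<le> N \<Longrightarrow> region (M l) \<subseteq> \<Omega>"
  using region_mono[of l N] region_N by simp

lemma tri_meets_closure:
  assumes "tri l \<kappa> \<inter> closure (tri l \<kappa>') \<noteq> {}"
  shows "\<kappa> = \<kappa>'"
proof -
  have "tri l \<kappa> \<inter> tri l \<kappa>' \<noteq> {}" using assms open_Int_closure_eq_empty[OF open_tri] by blast
  thus ?thesis using tri_unique by blast
qed

lemma cell_meets_region:
  assumes "l \<in> {1..N}" "valid \<kappa>" "z \<in> tri l \<kappa>" "z \<in> region (M l)"
  shows "\<kappa> \<in> cells l"
proof -
  obtain \<kappa>' where "\<kappa>' \<in> cells l" "z \<in> closure (tri l \<kappa>')" using assms(4) region_cells[OF assms(1)] by blast
  thus ?thesis using tri_meets_closure[of l \<kappa> \<kappa>'] assms(3) by blast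
qed

text \<open>A fine triangle lies in a single triangle of level \<open>m\<close>; by nestedness of
  the grids it is inside the coarse region or disjoint from it.\<close>

lemma tri_meets_region:
  assumes "m \<le> l" "l \<le> N" "valid \<kappa>" "z \<in> tri l \<kappa>" "z \<in> region (M m)"
  shows "tri l \<kappa> \<subseteq> region (M m)"
proof -
  have m: "m \<noteq> 0" using assms(5) region_0 by (metis empty_iff)
  hence m': "m \<in> {1..N}" using assms(1,2) by simp
  obtain \<kappa>' where k: "valid \<kappa>'" "tri l \<kappa> \<subseteq> tri m \<kappa>'" using tri_refine[of m l \<kappa>] m assms(1,3) by auto
  hence "\<kappa>' \<in> cells m" using cell_meets_region[OF m' k(1)] assms(4,5) by blast
  thus ?thesis using k(2) tri_subset_region[OF m'] by blast
qed

lemma diff_region_subset: "l \<le> N \<Longrightarrow> diff_region M l \<subseteq> region (M l)"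
  unfolding diff_region_def by (rule closure_minimal[OF _ closed_region]) auto

lemma cells_cases:
  assumes "l \<in> {1..N}" "\<kappa> \<in> cells l"
  shows "tri l \<kappa> \<subseteq> region (M (l - 1)) \<or> tri l \<kappa> \<subseteq> diff_region M l"
proof (cases "tri l \<kappa> \<inter> region (M (l - 1)) = {}")
  case True
  hence "tri l \<kappa> \<subseteq> region (M l) - region (M (l - 1))" using tri_subset_region[OF assms] by blast
  thus ?thesis unfolding diff_region_def using closure_subset by blast
next
  case False
  then obtain z where "z \<in> tri l \<kappa>" "z \<in> region (M (l - 1))" by blast
  thus ?thesis using tri_meets_region[of "l - 1" l \<kappa> z] assms valid_cells by auto
qed

lemma hier_cells_triangles:
  "T \<in> hier_cells N M \<inter> all_triangles \<longleftrightarrow> (\<exists>l\<in>{1..N}. \<exists>\<kappa>. valid \<kappa> \<and> T = tri l \<kappa> \<and> tri l \<kappa> \<subseteq> diff_region M l)"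
proof -
  have *: "diff_cells M l \<inter> all_triangles = {T \<in> triangles l. T \<subseteq> diff_region M l}" if "l \<in> {1..N}" for l
    unfolding diff_cells_def by (rule Union_hat_triangles) (use that triangles_subset[of l] in auto)
  have "T \<in> hier_cells N M \<inter> all_triangles \<longleftrightarrow> (\<exists>l\<in>{1..N}. T \<in> diff_cells M l \<inter> all_triangles)"
    unfolding hier_cells_def by blast
  also have "\<dots> \<longleftrightarrow> (\<exists>l\<in>{1..N}. T \<in> triangles l \<and> T \<subseteq> diff_region M l)"
    by (intro bex_cong refl) (simp only: * mem_Collect_eq)
  also have "\<dots> \<longleftrightarrow> (\<exists>l\<in>{1..N}. \<exists>\<kappa>. valid \<kappa> \<and> T = tri l \<kappa> \<and> tri l \<kappa> \<subseteq> diff_region M l)"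
    by (intro bex_cong refl) (auto simp: triangles_eq)
  finally show ?thesis .
qed

lemma spaceI:
  assumes "\<And>x. x \<notin> \<Omega> \<Longrightarrow> f x = 0" "continuous_on \<Omega> f"
    "\<And>l \<kappa>. l \<in> {1..N} \<Longrightarrow> valid \<kappa> \<Longrightarrow> tri l \<kappa> \<subseteq> diff_region M l \<Longrightarrow> \<exists>p\<in>kpoly n. \<forall>z\<in>tri l \<kappa>. f z = p z"
    "\<And>i e l \<kappa> \<kappa>'. e \<in> hier_cells N M \<Longrightarrow> edge_type i e \<Longrightarrow> l \<in> {1..N} \<Longrightarrow> \<kappa> \<in> cells l \<Longrightarrow> \<kappa>' \<in> cells l \<Longrightarrow> \<kappa> \<noteq> \<kappa>' \<Longrightarrow>
      e \<in> tri_edges (tri l \<kappa>) \<Longrightarrow> e \<in> tri_edges (tri l \<kappa>') \<Longrightarrow>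
      contact (contact_order n i) f (tri l \<kappa>) (tri l \<kappa>') e"
  shows "f \<in> space"
  unfolding spline_space_def piecewise_polys_def mem_Collect_eq region_N local_polys_eq[OF n]
proof (intro conjI allI impI ballI)
  fix T assume "T \<in> hier_cells N M \<inter> all_triangles"
  thus "\<exists>p\<in>kpoly n. \<forall>x\<in>T. f x = p x" unfolding hier_cells_triangles using assms(3) by blast
next
  fix i e l T T'
  assume e: "e \<in> hier_cells N M" "edge_type i e" and l: "l \<in> {1..N}" and T: "T \<in> M l \<inter> triangles l"
    "T' \<in> M l \<inter> triangles l" and a: "T \<noteq> T' \<and> e \<in> tri_edges T \<and> e \<in> tri_edges T'"
  then obtain \<kappa> \<kappa>' where "\<kappa> \<in> cells l" "T = tri l \<kappa>" "\<kappa>' \<in> cells l" "T' = tri l \<kappa>'"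
    unfolding multicell_cells(2)[OF l] by blast
  thus "contact (d $ i) f T T' e" using assms(4)[OF e l] a d by auto
qed (use assms(1,2) in auto)

lemma spaceD:
  assumes "f \<in> space"
  shows "x \<notin> \<Omega> \<Longrightarrow> f x = 0" "continuous_on \<Omega> f"
    "l \<in> {1..N} \<Longrightarrow> valid \<kappa> \<Longrightarrow> tri l \<kappa> \<subseteq> diff_region M l \<Longrightarrow> \<exists>p\<in>kpoly n. \<forall>z\<in>tri l \<kappa>. f z = p z"
    "e \<in> hier_cells N M \<Longrightarrow> edge_type i e \<Longrightarrow> l \<in> {1..N} \<Longrightarrow> \<kappa> \<in> cells l \<Longrightarrow> \<kappa>' \<in> cells l \<Longrightarrow> \<kappa> \<noteq> \<kappa>' \<Longrightarrow>
      e \<in> tri_edges (tri l \<kappa>) \<Longrightarrow> e \<in> tri_edges (tri l \<kappa>') \<Longrightarrow>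
      contact (contact_order n i) f (tri l \<kappa>) (tri l \<kappa>') e"
proof -
  have f: "\<forall>x. x \<notin> \<Omega> \<longrightarrow> f x = 0" "continuous_on \<Omega> f"
    "\<forall>T \<in> hier_cells N M \<inter> all_triangles. \<exists>p\<in>kpoly n. \<forall>x\<in>T. f x = p x"
    and c: "\<forall>i. \<forall>e \<in> hier_cells N M. edge_type i e \<longrightarrow>
         (\<forall>l\<in>{1..N}. \<forall>T \<in> M l \<inter> triangles l. \<forall>T' \<in> M l \<inter> triangles l.
            T \<noteq> T' \<and> e \<in> tri_edges T \<and> e \<in> tri_edges T' \<longrightarrow> contact (d $ i) f T T' e)"
    using assms unfolding spline_space_def piecewise_polys_def mem_Collect_eq region_N local_polys_eq[OF n] by blast+
  show "x \<notin> \<Omega> \<Longrightarrow> f x = 0" "continuous_on \<Omega> f" using f by blast+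
  show "l \<in> {1..N} \<Longrightarrow> valid \<kappa> \<Longrightarrow> tri l \<kappa> \<subseteq> diff_region M l \<Longrightarrow> \<exists>p\<in>kpoly n. \<forall>z\<in>tri l \<kappa>. f z = p z"
    using f(3) hier_cells_triangles by blast
  assume a: "e \<in> hier_cells N M" "edge_type i e" "l \<in> {1..N}" "\<kappa> \<in> cells l" "\<kappa>' \<in> cells l" "\<kappa> \<noteq> \<kappa>'"
      "e \<in> tri_edges (tri l \<kappa>)" "e \<in> tri_edges (tri l \<kappa>')"
  have "tri l \<kappa> \<noteq> tri l \<kappa>'" using a(6) tri_inj valid_cells[OF a(4)] by blast
  moreover have "tri l \<kappa> \<in> M l \<inter> triangles l" "tri l \<kappa>' \<in> M l \<inter> triangles l"
    unfolding multicell_cells(2)[OF a(3)] using a(4,5) by blast+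
  ultimately have "contact (d $ i) f (tri l \<kappa>) (tri l \<kappa>') e" using c a by blast
  thus "contact (contact_order n i) f (tri l \<kappa>) (tri l \<kappa>') e" by (simp add: d)
qed

lemma subspace_space: "fun_vs.subspace space"
proof (rule fun_vs.subspaceI)
  show "0 \<in> space"
    by (rule spaceI) (auto simp: zero_fun_def intro: contact_null intro!: bexI[OF _ kpoly_null])
next
  fix f g assume fg: "f \<in> space" "g \<in> space"
  have "(\<lambda>x. f x + g x) \<in> space"
  proof (rule spaceI)
    show "f x + g x = 0" if "x \<notin> \<Omega>" for x using spaceD(1)[OF fg(1) that] spaceD(1)[OF fg(2) that] by simp
    show "continuous_on \<Omega> (\<lambda>x. f x + g x)" using spaceD(2)[OF fg(1)] spaceD(2)[OF fg(2)] by (rule continuous_on_add)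
  next
    fix l \<kappa> assume a: "l \<in> {1..N}" "valid \<kappa>" "tri l \<kappa> \<subseteq> diff_region M l"
    obtain p q where "p \<in> kpoly n" "\<forall>z\<in>tri l \<kappa>. f z = p z" "q \<in> kpoly n" "\<forall>z\<in>tri l \<kappa>. g z = q z"
      using spaceD(3)[OF fg(1) a] spaceD(3)[OF fg(2) a] by blast
    thus "\<exists>p\<in>kpoly n. \<forall>z\<in>tri l \<kappa>. f z + g z = p z"
      by (intro bexI[of _ "\<lambda>z. p z + q z"] kpoly_add) auto
  qed (intro contact_add spaceD(4)[OF fg(1)] spaceD(4)[OF fg(2)])
  thus "f + g \<in> space" by (simp add: plus_fun_def)
next
  fix c f assume f: "f \<in> space"
  have "(\<lambda>x. c * f x) \<in> space"
  proof (rule spaceI)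
    show "c * f x = 0" if "x \<notin> \<Omega>" for x using spaceD(1)[OF f that] by simp
    show "continuous_on \<Omega> (\<lambda>x. c * f x)" using spaceD(2)[OF f] by (intro continuous_intros)
  next
    fix l \<kappa> assume a: "l \<in> {1..N}" "valid \<kappa>" "tri l \<kappa> \<subseteq> diff_region M l"
    obtain p where "p \<in> kpoly n" "\<forall>z\<in>tri l \<kappa>. f z = p z" using spaceD(3)[OF f a] by blast
    thus "\<exists>p\<in>kpoly n. \<forall>z\<in>tri l \<kappa>. c * f z = p z"
      by (intro bexI[of _ "\<lambda>z. c * p z"] kpoly_cmult) auto
  qed (intro contact_cmult spaceD(4)[OF f])
  thus "fscale c f \<in> space" by (simp add: fscale_def)
qed

lemma contact_restr:
  assumes "T \<subseteq> \<Omega>" "T' \<subseteq> \<Omega>" "contact k f T T' e"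
  shows "contact k (restr \<Omega> f) T T' e"
proof -
  obtain p p' where p: "poly2 p" "poly2 p'" "\<forall>z\<in>T. f z = p z" "\<forall>z\<in>T'. f z = p' z" "vanishing k e (\<lambda>z. p z - p' z)"
    using assms(3) unfolding contact_iff by blast
  have "\<forall>z\<in>T. restr \<Omega> f z = p z" "\<forall>z\<in>T'. restr \<Omega> f z = p' z" using p(3,4) assms(1,2) by (auto simp: restr_def)
  thus ?thesis unfolding contact_iff using p(1,2,5) by blast
qed

text \<open>On levels below \<open>l\<close> the function vanishes. On the other levels triangles
  are parts of level \<open>l\<close> triangles, where the pieces belong to the kernel by scaling
  invariance and the contact is that of box splines.\<close>

lemma restr_lspl_space:
  assumes l: "l \<in> {1..N}" and zero: "\<And>z. z \<in> region (M (l - 1)) \<Longrightarrow> lspl n l c z = 0"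
  shows "restr \<Omega> (lspl n l c) \<in> space"
proof (rule spaceI)
  show "restr \<Omega> (lspl n l c) x = 0" if "x \<notin> \<Omega>" for x using that by (simp add: restr_def)
  have "continuous_on \<Omega> (lspl n l c)" by (rule continuous_lspl[OF n])
  thus "continuous_on \<Omega> (restr \<Omega> (lspl n l c))" by (rule continuous_on_eq) (simp add: restr_def)
next
  fix k \<kappa> assume k: "k \<in> {1..N}" and \<kappa>: "valid \<kappa>" and sub: "tri k \<kappa> \<subseteq> diff_region M k"
  have subk: "tri k \<kappa> \<subseteq> region (M k)" using sub diff_region_subset[of k] k by auto
  hence sub\<Omega>: "tri k \<kappa> \<subseteq> \<Omega>" using region_subset[of k] k by auto
  show "\<exists>p\<in>kpoly n. \<forall>z\<in>tri k \<kappa>. restr \<Omega> (lspl n l c) z = p z"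
  proof (cases "l \<le> k")
    case True
    obtain \<kappa>' where k': "valid \<kappa>'" "tri k \<kappa> \<subseteq> tri l \<kappa>'" using tri_refine[of l k \<kappa>] l True \<kappa> by auto
    obtain p where p: "p \<in> kpoly n" "\<forall>z\<in>cell \<kappa>'. spl n c z = p z" using spl_piece[OF n k'(1)] by blast
    have "restr \<Omega> (lspl n l c) z = p (2 ^ (l - 1) *\<^sub>R z + 0)" if "z \<in> tri k \<kappa>" for z
    proof -
      have "2 ^ (l - 1) *\<^sub>R z \<in> cell \<kappa>'" using k'(2) that by (auto simp: tri_def)
      moreover have "z \<in> \<Omega>" using sub\<Omega> that by blast
      ultimately show ?thesis using p(2) by (simp add: restr_def lspl_def)
    qed
    thus ?thesis by (intro bexI[OF _ kpoly_affine[OF p(1)]]) blast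
  next
    case False
    hence "region (M k) \<subseteq> region (M (l - 1))" using l by (intro region_mono) auto
    hence "z \<in> region (M (l - 1))" if "z \<in> tri k \<kappa>" for z using that subk by blast
    hence "restr \<Omega> (lspl n l c) z = 0" if "z \<in> tri k \<kappa>" for z using zero that by (simp add: restr_def)
    thus ?thesis using kpoly_null by (intro bexI[of _ "\<lambda>_. 0"]) auto
  qed
next
  fix i e k \<kappa> \<kappa>'
  assume e: "edge_type i e" and k: "k \<in> {1..N}" and cells: "\<kappa> \<in> cells k" "\<kappa>' \<in> cells k"
    and edges: "e \<in> tri_edges (tri k \<kappa>)" "e \<in> tri_edges (tri k \<kappa>')"
  have v: "valid \<kappa>" "valid \<kappa>'" using cells valid_cells by auto
  have sub: "tri k \<kappa> \<subseteq> region (M k)" "tri k \<kappa>' \<subseteq> region (M k)" using tri_subset_region[OF k] cells by auto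
  have reg: "region (M k) \<subseteq> \<Omega>" using region_subset k by simp
  show "contact (contact_order n i) (restr \<Omega> (lspl n l c)) (tri k \<kappa>) (tri k \<kappa>') e"
  proof (cases "l \<le> k")
    case True
    have l1: "1 \<le> l" using l by simp
    obtain \<mu> where mu: "valid \<mu>" "tri k \<kappa> \<subseteq> tri l \<mu>" using tri_refine[OF l1 True v(1)] .
    obtain \<mu>' where mu': "valid \<mu>'" "tri k \<kappa>' \<subseteq> tri l \<mu>'" using tri_refine[OF l1 True v(2)] .
    have "contact (contact_order n i) (lspl n l c) (tri k \<kappa>) (tri k \<kappa>') e"
      by (rule lspl_contact[OF n mu(1) mu'(1) mu(2) mu'(2) e tri_edges_subset[OF v(1) edges(1)]
            tri_edges_subset[OF v(2) edges(2)]])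
    thus ?thesis using sub reg by (intro contact_restr) auto
  next
    case False
    hence "region (M k) \<subseteq> region (M (l - 1))" using l by (intro region_mono) auto
    thus ?thesis using sub zero by (intro contact_null) (auto simp: restr_def)
  qed
qed

text \<open>One inclusion of the theorem, and also the reason why the remainders in the
  level-by-level subtraction stay in the spline space.\<close>

lemma span_basis_subset: "fun_vs.span (hier_basis n N M) \<subseteq> space"
proof (rule fun_vs.span_minimal[OF _ subspace_space])
  show "hier_basis n N M \<subseteq> space"
  proof
    fix g assume "g \<in> hier_basis n N M"
    then obtain l \<beta> where l: "l \<in> {1..N}" and b: "\<beta> \<in> hier_basis_level n M l" and g: "g = restr \<Omega> \<beta>"
      unfolding hier_basis_def region_N by blast
    obtain v where v: "\<beta> = (\<lambda>z. box_spline n (2 ^ (l - 1) *\<^sub>R z - lat v))"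
      using b unfolding hier_basis_level_def active_def box_splines_eq by blast
    have eq: "\<beta> = lspl n l (\<lambda>w. if w = v then 1 else 0)" using lspl_single[OF n, of l v 1] v by (simp add: fun_eq_iff)
    have "\<beta> z = 0" if "z \<in> region (M (l - 1))" for z
      using b that unfolding hier_basis_level_def support_on_def by blast
    thus "g \<in> space" unfolding g eq by (intro restr_lspl_space[OF l]) blast
  qed
qed

text \<open>By continuity a box spline that is nonzero at a boundary point is nonzero inside. In
  particular, if it is nonzero at a vertex, it is active on all triangles around it.\<close>

lemma active_of_nonzero:
  assumes "valid \<kappa>" "x \<in> closure (tri l \<kappa>)" "box_spline n (2 ^ (l - 1) *\<^sub>R x - lat v) \<noteq> 0"
  shows "v \<in> act n \<kappa>"
proof -
  let ?U = "{z. box_spline n (2 ^ (l - 1) *\<^sub>R z - lat v) \<noteq> 0}"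
  have "continuous_on UNIV (\<lambda>z. box_spline n (2 ^ (l - 1) *\<^sub>R z - lat v))"
    by (rule continuous_on_compose2[OF continuous_box_spline]) (auto intro!: continuous_intros)
  hence "open ?U" by (intro open_Collect_neq continuous_on_const)
  moreover have "?U \<inter> closure (tri l \<kappa>) \<noteq> {}" using assms(2,3) by blast
  ultimately have "?U \<inter> tri l \<kappa> \<noteq> {}" using open_Int_closure_eq_empty by blast
  then obtain z where "z \<in> tri l \<kappa>" "box_spline n (2 ^ (l - 1) *\<^sub>R z - lat v) \<noteq> 0" by blast
  thus ?thesis using mem_act[OF n, of "2 ^ (l - 1) *\<^sub>R z" \<kappa> v] by (simp add: tri_def)
qed

text \<open>Local coefficients agree across common edges by the contact conditions. Since the support of an
  active box spline in the region is connected and there are no kissing triangles, any two triangles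
  in that support are joined by a chain of triangles with common edges.\<close>

theorem level_completeness:
  assumes l: "l \<in> {1..N}" and cont: "continuous_on (region (M l)) f"
    and loc: "\<And>\<kappa>. \<kappa> \<in> cells l \<Longrightarrow> \<exists>c. \<forall>z\<in>tri l \<kappa>. f z = lspl n l c z"
    and con: "\<And>i e \<kappa> \<kappa>'. edge_type i e \<Longrightarrow> \<kappa> \<in> cells l \<Longrightarrow> \<kappa>' \<in> cells l \<Longrightarrow> \<kappa> \<noteq> \<kappa>' \<Longrightarrow>
      e \<in> tri_edges (tri l \<kappa>) \<Longrightarrow> e \<in> tri_edges (tri l \<kappa>') \<Longrightarrow>
      contact (contact_order n i) f (tri l \<kappa>) (tri l \<kappa>') e"
  obtains c where "\<And>z. z \<in> region (M l) \<Longrightarrow> f z = lspl n l c z"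
    "\<And>v. c v \<noteq> 0 \<Longrightarrow> \<exists>\<kappa>\<in>cells l. v \<in> act n \<kappa>"
proof -
  let ?r = "2 ^ (l - 1) :: real"
  obtain C where C: "\<And>\<kappa> z. \<kappa> \<in> cells l \<Longrightarrow> z \<in> tri l \<kappa> \<Longrightarrow> f z = lspl n l (C \<kappa>) z" using loc by metis
  have scaled: "(1/2) ^ (l - 1) *\<^sub>R z \<in> tri l \<kappa>" "?r *\<^sub>R ((1/2) ^ (l - 1) *\<^sub>R z) = z" if "z \<in> cell \<kappa>" for z \<kappa>
    using that by (simp_all add: tri_def power_one_over)
  have adj: "C \<kappa> v = C (below i \<kappa>) v"
    if cells: "\<kappa> \<in> cells l" "below i \<kappa> \<in> cells l" and e: "e \<in> tri_edges (tri l \<kappa>)" "e \<in> tri_edges (tri l (below i \<kappa>))"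
      "edge_type i e" "\<And>z. ?r *\<^sub>R z \<in> edge i \<kappa> \<Longrightarrow> z \<in> e" and v: "v \<in> act n \<kappa>" "v \<in> act n (below i \<kappa>)" for \<kappa> i e v
  proof -
    have "\<kappa> i \<noteq> below i \<kappa> i" by (simp add: below_def)
    hence ne: "\<kappa> \<noteq> below i \<kappa>" by metis
    obtain p p' where p: "poly2 p" "poly2 p'" "\<forall>z\<in>tri l \<kappa>. f z = p z" "\<forall>z\<in>tri l (below i \<kappa>). f z = p' z"
       "vanishing (contact_order n i) e (\<lambda>z. p z - p' z)"
      using con[OF e(3) cells ne e(1,2)] unfolding contact_iff by blast
    let ?s = "(1/2) ^ (l - 1) :: real"
    have P: "spl n (C \<kappa>) z = p (?s *\<^sub>R z + 0)" if "z \<in> cell \<kappa>" for z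
      using C[OF cells(1) scaled(1)[OF that]] p(3) scaled[OF that] by (simp add: lspl_def)
    have P': "spl n (C (below i \<kappa>)) z = p' (?s *\<^sub>R z + 0)" if "z \<in> cell (below i \<kappa>)" for z
      using C[OF cells(2) scaled(1)[OF that]] p(4) scaled[OF that] by (simp add: lspl_def)
    have "vanishing (contact_order n i) (edge i \<kappa>) (\<lambda>z. (\<lambda>z. p z - p' z) (?s *\<^sub>R z + 0))"
      by (rule vanishing_affine[OF real_polynomial_function_diff[OF p(1,2)] p(5)]) (rule e(4), simp add: power_one_over)
    hence "vanishing (contact_order n i) (edge i \<kappa>) (\<lambda>z. p (?s *\<^sub>R z + 0) - p' (?s *\<^sub>R z + 0))" by simp
    from adjacent_coefficients[OF n valid_cells[OF cells(1)] valid_cells[OF cells(2)] poly2_affine[OF p(1)] P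
        poly2_affine[OF p(2)] P' this] v
    show ?thesis by (simp add: aedge_def)
  qed
  have edge: "C \<kappa> v = C \<kappa>' v"
    if c: "\<kappa> \<in> cells l" "\<kappa>' \<in> cells l" and common: "tri_edges (tri l \<kappa>) \<inter> tri_edges (tri l \<kappa>') \<noteq> {}"
      and v: "v \<in> act n \<kappa>" "v \<in> act n \<kappa>'" for \<kappa> \<kappa>' v
  proof (cases "\<kappa> = \<kappa>'")
    case False
    obtain e where e: "e \<in> tri_edges (tri l \<kappa>)" "e \<in> tri_edges (tri l \<kappa>')" using common by blast
    obtain i \<kappa>0 where k: "(\<kappa> = \<kappa>0 \<and> \<kappa>' = below i \<kappa>0) \<or> (\<kappa>' = \<kappa>0 \<and> \<kappa> = below i \<kappa>0)"
      "edge_type i e" "\<And>z. ?r *\<^sub>R z \<in> edge i \<kappa>0 \<Longrightarrow> z \<in> e"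

      using common_edge[OF valid_cells[OF c(1)] valid_cells[OF c(2)] False e] by metis
    from k(1) show ?thesis
    proof
      assume "\<kappa> = \<kappa>0 \<and> \<kappa>' = below i \<kappa>0"
      thus ?thesis using adj[of \<kappa>0 i e v] k(2,3) c v e by blast
    next
      assume "\<kappa>' = \<kappa>0 \<and> \<kappa> = below i \<kappa>0"
      thus ?thesis using adj[of \<kappa>0 i e v] k(2,3) c v e by metis
    qed
  qed simp
  have global: "C \<kappa>1 v = C \<kappa>2 v" if k12: "\<kappa>1 \<in> cells l" "\<kappa>2 \<in> cells l" and v12: "v \<in> act n \<kappa>1" "v \<in> act n \<kappa>2" for \<kappa>1 \<kappa>2 v
  proof (rule ccontr)
    assume ne: "C \<kappa>1 v \<noteq> C \<kappa>2 v"
    define \<beta> where "\<beta> = (\<lambda>z. box_spline n (?r *\<^sub>R z - lat v))"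
    define A where "A = {\<kappa> \<in> cells l. v \<in> act n \<kappa>}"
    \<comment> \<open>The triangles on which \<open>v\<close> is active, split by whether their
      coefficient agrees with that of \<open>\<kappa>1\<close>. If the two values differ, the two
      closed sets would separate the connected support.\<close>
    define F1 F2 where "F1 = (\<Union>\<kappa>\<in>{\<kappa> \<in> A. C \<kappa> v = C \<kappa>1 v}. closure (tri l \<kappa>))"
      and "F2 = (\<Union>\<kappa>\<in>{\<kappa> \<in> A. C \<kappa> v \<noteq> C \<kappa>1 v}. closure (tri l \<kappa>))"
    let ?X = "support_on (region (M l)) \<beta>"
    have fin: "finite A" using multicell_cells(3)[OF l] by (simp add: A_def)
    have hit: "\<exists>z\<in>tri l \<kappa>. \<beta> z \<noteq> 0" if a: "\<kappa> \<in> A" for \<kappa>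
    proof -
      have a': "valid \<kappa>" "v \<in> act n \<kappa>" using a valid_cells by (auto simp: A_def)
      obtain z where z: "z \<in> cell \<kappa>" "box_spline n (z - lat v) \<noteq> 0" by (rule box_spline_nonzero[OF n a'])
      show ?thesis using scaled[OF z(1)] z(2) by (intro bexI[of _ "(1/2) ^ (l - 1) *\<^sub>R z"]) (simp_all add: \<beta>_def)
    qed
    have A12: "\<kappa>1 \<in> A" "\<kappa>2 \<in> A" using k12 v12 by (simp_all add: A_def)
    have sub: "closure (tri l \<kappa>) \<subseteq> region (M l)" if "\<kappa> \<in> A" for \<kappa>
      using that region_cells[OF l] by (auto simp: A_def)
    have "support_on UNIV \<beta> \<inter> region (M l) \<noteq> {}"
      using hit[OF A12(1)] sub[OF A12(1)] closure_subset[of "tri l \<kappa>1"] by (auto simp: support_on_def)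
    moreover have "\<beta> \<in> box_splines n l" unfolding box_splines_eq \<beta>_def by blast
    ultimately have "\<beta> \<in> active n l (M l)" by (simp add: active_def)
    hence connected: "connected ?X" using admissible l unfolding admissible_def by blast
    have "closed F1" "closed F2" unfolding F1_def F2_def using fin by (auto intro!: closed_UN)
    moreover have "?X \<subseteq> F1 \<union> F2"
    proof
      fix x assume "x \<in> ?X"
      hence x: "x \<in> region (M l)" "\<beta> x \<noteq> 0" by (auto simp: support_on_def)
      then obtain \<kappa> where k: "\<kappa> \<in> cells l" "x \<in> closure (tri l \<kappa>)" using region_cells[OF l] by blast
      hence "v \<in> act n \<kappa>" using active_of_nonzero[OF valid_cells[OF k(1)] k(2)] x(2) by (simp add: \<beta>_def)
      thus "x \<in> F1 \<union> F2" using k by (auto simp: F1_def F2_def A_def)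
    qed
    \<comment> \<open>At a common point the two triangles cannot share an edge, since coefficients
      agree across edges; so they touch at a vertex, and as they do not kiss, a chain around this
      vertex links them.\<close>
    moreover have "F1 \<inter> F2 \<inter> ?X = {}"
    proof (rule ccontr)
      assume "F1 \<inter> F2 \<inter> ?X \<noteq> {}"
      then obtain x where x: "x \<in> F1" "x \<in> F2" "\<beta> x \<noteq> 0" by (auto simp: support_on_def)
      obtain \<kappa> where k: "\<kappa> \<in> A" "C \<kappa> v = C \<kappa>1 v" "x \<in> closure (tri l \<kappa>)" using x(1) by (auto simp: F1_def)
      obtain \<kappa>' where k': "\<kappa>' \<in> A" "C \<kappa>' v \<noteq> C \<kappa>1 v" "x \<in> closure (tri l \<kappa>')" using x(2) by (auto simp: F2_def)
      have c: "\<kappa> \<in> cells l" "\<kappa>' \<in> cells l" "v \<in> act n \<kappa>" "v \<in> act n \<kappa>'" using k(1) k'(1) by (auto simp: A_def)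
      have kk: "\<kappa> \<noteq> \<kappa>'" using k(2) k'(2) by auto
      have "tri_edges (tri l \<kappa>) \<inter> tri_edges (tri l \<kappa>') = {}" using edge[OF c(1,2) _ c(3,4)] k(2) k'(2) by auto
      hence touch: "x \<in> grid_vertices l" "closure (tri l \<kappa>) \<inter> closure (tri l \<kappa>') = {x}"
        using touching_triangles[OF valid_cells[OF c(1)] valid_cells[OF c(2)] kk k(3) k'(3)] by auto
      have TM: "tri l \<kappa> \<in> M l \<inter> triangles l" "tri l \<kappa>' \<in> M l \<inter> triangles l"
        unfolding multicell_cells(2)[OF l] using c(1,2) by auto
      have "\<not> kissing l (M l) (tri l \<kappa>) (tri l \<kappa>')" using admissible l unfolding admissible_def by blast
      hence "(tri l \<kappa>, tri l \<kappa>') \<in> (linked_at l (M l) x)\<^sup>*" using touch TM unfolding kissing_def by blast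
      \<comment> \<open>All triangles of the chain have the vertex \<open>x\<close>, where the box
        spline is nonzero, so \<open>v\<close> is active on each of them and its coefficient is
        passed on from one to the next.\<close>
      hence "\<exists>\<mu>\<in>cells l. tri l \<kappa>' = tri l \<mu> \<and> v \<in> act n \<mu> \<and> C \<mu> v = C \<kappa> v"
      proof (induction rule: rtrancl_induct)
        case base
        thus ?case using c(1,3) by blast
      next
        case (step T T')
        then obtain \<mu> where mu: "\<mu> \<in> cells l" "T = tri l \<mu>" "v \<in> act n \<mu>" "C \<mu> v = C \<kappa> v" by blast
        have T': "T' \<in> M l \<inter> triangles l" "x \<in> tri_vertices T'" "tri_edges T \<inter> tri_edges T' \<noteq> {}"
          using step.hyps(2) by (auto simp: linked_at_def)
        then obtain \<mu>' where mu': "\<mu>' \<in> cells l" "T' = tri l \<mu>'" unfolding multicell_cells(2)[OF l] by blast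
        have "x \<in> closure (tri l \<mu>')" using T'(2) tri_vertices_subset mu'(2) by blast
        hence "v \<in> act n \<mu>'" using active_of_nonzero[OF valid_cells[OF mu'(1)]] x(3) by (simp add: \<beta>_def)
        moreover from this have "C \<mu>' v = C \<mu> v" using edge[OF mu(1) mu'(1)] T'(3) mu mu'(2) by simp
        ultimately show ?case using mu' mu(4) by auto
      qed
      then obtain \<mu> where "\<mu> \<in> cells l" "tri l \<kappa>' = tri l \<mu>" "C \<mu> v = C \<kappa> v" by blast
      hence "C \<kappa>' v = C \<kappa> v" using tri_inj valid_cells[OF c(2)] by metis
      thus False using k(2) k'(2) by simp
    qed
    moreover have "F1 \<inter> ?X \<noteq> {}"
    proof -
      obtain z where "z \<in> tri l \<kappa>1" "\<beta> z \<noteq> 0" using hit[OF A12(1)] by blast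
      hence "z \<in> F1 \<inter> ?X" using closure_subset[of "tri l \<kappa>1"] A12(1) sub[OF A12(1)] by (auto simp: F1_def support_on_def)
      thus ?thesis by blast
    qed
    moreover have "F2 \<inter> ?X \<noteq> {}"
    proof -
      obtain z where "z \<in> tri l \<kappa>2" "\<beta> z \<noteq> 0" using hit[OF A12(2)] by blast
      hence "z \<in> F2 \<inter> ?X" using closure_subset[of "tri l \<kappa>2"] A12(2) sub[OF A12(2)] ne by (auto simp: F2_def support_on_def)
      thus ?thesis by blast
    qed
    ultimately show False using connected unfolding connected_closed by blast
  qed
  \<comment> \<open>The default value 0 for indices active on no triangle of the region secures the
    second conclusion.\<close>
  define c where "c v = (if \<exists>\<kappa>\<in>cells l. v \<in> act n \<kappa> then C (SOME \<kappa>. \<kappa> \<in> cells l \<and> v \<in> act n \<kappa>) v else 0)" for v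
  have c: "c v = C \<kappa> v" if k: "\<kappa> \<in> cells l" "v \<in> act n \<kappa>" for \<kappa> v
  proof -
    define \<mu> where "\<mu> = (SOME \<kappa>. \<kappa> \<in> cells l \<and> v \<in> act n \<kappa>)"
    have mu: "\<mu> \<in> cells l \<and> v \<in> act n \<mu>" unfolding \<mu>_def by (rule someI[of _ \<kappa>]) (use k in simp)
    have "c v = C \<mu> v" using k by (auto simp: c_def \<mu>_def)
    thus ?thesis using global[OF conjunct1[OF mu] k(1) conjunct2[OF mu] k(2)] by simp
  qed
  have tri_eq: "f z = lspl n l c z" if "\<kappa> \<in> cells l" "z \<in> tri l \<kappa>" for \<kappa> z
    unfolding C[OF that] lspl_def
    by (rule spl_cong_act[OF n, of _ \<kappa>]) (use that c in \<open>auto simp: tri_def\<close>)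
  have "f z = lspl n l c z" if z: "z \<in> region (M l)" for z
  proof -
    obtain \<kappa> where k: "\<kappa> \<in> cells l" "z \<in> closure (tri l \<kappa>)" using z region_cells[OF l] by blast
    have "closure (tri l \<kappa>) \<subseteq> region (M l)" using k(1) region_cells[OF l] by blast
    hence "continuous_on (closure (tri l \<kappa>)) (\<lambda>z. f z - lspl n l c z)"
      by (intro continuous_on_diff continuous_lspl[OF n] continuous_on_subset[OF cont])
    hence "f z - lspl n l c z = 0"
      by (rule continuous_constant_on_closure[OF _ _ k(2)]) (use tri_eq[OF k(1)] in simp)
    thus ?thesis by simp
  qed
  moreover have "\<exists>\<kappa>\<in>cells l. v \<in> act n \<kappa>" if "c v \<noteq> 0" for v using that by (auto simp: c_def split: if_splits)
  ultimately show ?thesis using that by blast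
qed

text \<open>Vanishing on the old region serves twice: it makes \<open>h\<close> locally a spline of
  level \<open>l\<close> also on triangles that are not cells of the hierarchy, and it excludes box
  splines reaching into the old region.\<close>

lemma level_step:
  assumes l: "l \<in> {1..N}" and h: "h \<in> space" and zero: "\<And>z. z \<in> region (M (l - 1)) \<Longrightarrow> h z = 0"
  obtains g where "g \<in> fun_vs.span (hier_basis n N M)" "\<And>z. z \<in> region (M l) \<Longrightarrow> h z = g z"
proof -
  have reg: "region (M l) \<subseteq> \<Omega>" using region_subset l by simp
  have old: "(\<forall>z\<in>tri l \<kappa>. h z = 0) \<or> tri l \<kappa> \<subseteq> diff_region M l" if "\<kappa> \<in> cells l" for \<kappa>
    using cells_cases[OF l that] zero by blast
  have in_hier: "e \<in> hier_cells N M" if "\<kappa> \<in> cells l" "tri l \<kappa> \<subseteq> diff_region M l" "e \<in> tri_edges (tri l \<kappa>)" for e \<kappa>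
  proof -
    have "tri l \<kappa> \<in> triangles l" using that(1) valid_cells by (auto simp: triangles_eq)
    moreover have "e \<in> hat (tri l \<kappa>)" using that(3) by (simp add: hat_def)
    ultimately show ?thesis using that(2) l unfolding hier_cells_def diff_cells_def by blast
  qed
  obtain c where c: "\<And>z. z \<in> region (M l) \<Longrightarrow> h z = lspl n l c z" "\<And>v. c v \<noteq> 0 \<Longrightarrow> \<exists>\<kappa>\<in>cells l. v \<in> act n \<kappa>"
  proof (rule level_completeness[OF l, of h])
    show "continuous_on (region (M l)) h" by (rule continuous_on_subset[OF spaceD(2)[OF h] reg])
  next
    fix \<kappa> assume k: "\<kappa> \<in> cells l"
    from old[OF k] show "\<exists>c. \<forall>z\<in>tri l \<kappa>. h z = lspl n l c z"
    proof
      assume "\<forall>z\<in>tri l \<kappa>. h z = 0"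
      thus ?thesis by (intro exI[of _ "\<lambda>_. 0"]) (simp add: lspl_def spl_const[OF n])
    next
      assume "tri l \<kappa> \<subseteq> diff_region M l"
      then obtain p where p: "p \<in> kpoly n" "\<forall>z\<in>tri l \<kappa>. h z = p z" using spaceD(3)[OF h l valid_cells[OF k]] by blast
      obtain c where c: "\<forall>z\<in>cell \<kappa>. p ((1/2) ^ (l - 1) *\<^sub>R z + 0) = spl n c z"
        using kpoly_spl[OF n valid_cells[OF k] kpoly_affine[OF p(1)]] by blast
      have "h z = lspl n l c z" if z: "z \<in> tri l \<kappa>" for z
      proof -
        have "(1/2) ^ (l - 1) *\<^sub>R (2 ^ (l - 1) *\<^sub>R z) + 0 = z" by (simp add: power_one_over)
        moreover have "2 ^ (l - 1) *\<^sub>R z \<in> cell \<kappa>" using z by (simp add: tri_def)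
        ultimately have "p z = lspl n l c z" using c unfolding lspl_def by metis
        thus ?thesis using p(2) z by simp
      qed
      thus ?thesis by blast
    qed
  next
    fix i e \<kappa> \<kappa>'
    assume e: "edge_type i e" and k: "\<kappa> \<in> cells l" "\<kappa>' \<in> cells l" "\<kappa> \<noteq> \<kappa>'"
      and ed: "e \<in> tri_edges (tri l \<kappa>)" "e \<in> tri_edges (tri l \<kappa>')"
    show "contact (contact_order n i) h (tri l \<kappa>) (tri l \<kappa>') e"
    proof (cases "e \<in> hier_cells N M")
      case True
      show ?thesis by (rule spaceD(4)[OF h True e l k ed])
    next
      \<comment> \<open>An edge outside the hierarchical domain carries no contact condition, but
        then \<open>h\<close> vanishes on both adjacent triangles.\<close>
      case False
      hence "\<not> tri l \<kappa> \<subseteq> diff_region M l" "\<not> tri l \<kappa>' \<subseteq> diff_region M l" using in_hier k(1,2) ed by blast+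
      thus ?thesis using old[OF k(1)] old[OF k(2)] by (intro contact_null) auto
    qed
  qed blast
  \<comment> \<open>Every nonzero coefficient is active on one of the finitely many triangles of the
    level, so the expansion is a finite linear combination.\<close>
  define F where "F = {v. c v \<noteq> 0}"
  have "F \<subseteq> (\<Union>\<kappa>\<in>cells l. act n \<kappa>)" using c(2) by (auto simp: F_def)
  hence fin: "finite F" using multicell_cells(3)[OF l] finite_act by (meson finite_UN_I finite_subset)
  define \<beta> where "\<beta> v = (\<lambda>z. box_spline n (2 ^ (l - 1) *\<^sub>R z - lat v))" for v
  have basis: "\<beta> v \<in> hier_basis_level n M l" if v: "v \<in> F" for v
  proof -
    have cv: "c v \<noteq> 0" using v by (simp add: F_def)
    obtain \<kappa> where k: "\<kappa> \<in> cells l" "v \<in> act n \<kappa>" using c(2)[OF cv] by blast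
    obtain z where z: "z \<in> cell \<kappa>" "box_spline n (z - lat v) \<noteq> 0" by (rule box_spline_nonzero[OF n valid_cells[OF k(1)] k(2)])
    have "(1/2) ^ (l - 1) *\<^sub>R z \<in> tri l \<kappa>" "\<beta> v ((1/2) ^ (l - 1) *\<^sub>R z) \<noteq> 0"
      using z by (simp_all add: tri_def power_one_over \<beta>_def)
    hence "(1/2) ^ (l - 1) *\<^sub>R z \<in> support_on UNIV (\<beta> v) \<inter> region (M l)"
      using tri_subset_region[OF l k(1)] by (auto simp: support_on_def)
    moreover have "\<beta> v \<in> box_splines n l" unfolding box_splines_eq \<beta>_def by blast
    ultimately have act: "\<beta> v \<in> active n l (M l)" unfolding active_def by blast
    have "support_on UNIV (\<beta> v) \<inter> region (M (l - 1)) = {}"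
    proof (rule ccontr)
      assume "support_on UNIV (\<beta> v) \<inter> region (M (l - 1)) \<noteq> {}"
      then obtain x where x: "\<beta> v x \<noteq> 0" "x \<in> region (M (l - 1))" by (auto simp: support_on_def)
      have "l - 1 \<noteq> 0" using x(2) region_0 by (metis empty_iff)
      hence l1: "l - 1 \<in> {1..N}" using l by auto
      obtain \<kappa>0 where k0: "\<kappa>0 \<in> cells (l - 1)" "x \<in> closure (tri (l - 1) \<kappa>0)" using x(2) region_cells[OF l1] by blast
      \<comment> \<open>The point \<open>x\<close> may lie on the boundary of the old region or on
        grid lines. As the support is open, it also meets an open triangle of level
        \<open>l - 1\<close> in that region, and then one of level \<open>l\<close>; there
        \<open>h\<close> is 0, and independence applies.\<close>
      define U where "U = {z. \<beta> v z \<noteq> 0} \<inter> tri (l - 1) \<kappa>0"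
      have "continuous_on UNIV (\<beta> v)" unfolding \<beta>_def
        by (rule continuous_on_compose2[OF continuous_box_spline]) (auto intro!: continuous_intros)
      hence op: "open {z. \<beta> v z \<noteq> 0}" by (intro open_Collect_neq continuous_on_const)
      hence oU: "open U" unfolding U_def by (intro open_Int open_tri)
      have "{z. \<beta> v z \<noteq> 0} \<inter> closure (tri (l - 1) \<kappa>0) \<noteq> {}" using x(1) k0(2) by blast
      hence "U \<noteq> {}" unfolding U_def using open_Int_closure_eq_empty[OF op] by blast
      then obtain y where y: "y \<in> U" by blast
      obtain \<mu> where mu: "valid \<mu>" "y \<in> closure (tri l \<mu>)" by (rule tri_cover)
      have "U \<inter> closure (tri l \<mu>) \<noteq> {}" using y mu(2) by blast
      hence "U \<inter> tri l \<mu> \<noteq> {}" using open_Int_closure_eq_empty[OF oU] by blast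
      then obtain w where w: "w \<in> U" "w \<in> tri l \<mu>" by blast
      have wr: "w \<in> region (M (l - 1))" using w(1) tri_subset_region[OF l1 k0(1)] by (auto simp: U_def)
      have sub: "tri l \<mu> \<subseteq> region (M (l - 1))"
        using tri_meets_region[of "l - 1" l \<mu> w] l mu(1) w(2) wr by simp
      have "region (M (l - 1)) \<subseteq> region (M l)" using l by (intro region_mono) auto
      hence z0: "lspl n l c z = 0" if "z \<in> tri l \<mu>" for z
        using c(1)[of z] zero[of z] subsetD[OF sub that] by (metis subsetD)
      have "spl n c z = 0" if "z \<in> cell \<mu>" for z
        using z0[of "(1/2) ^ (l - 1) *\<^sub>R z"] that by (simp add: tri_def lspl_def power_one_over)
      moreover have "v \<in> act n \<mu>"
        using active_of_nonzero[OF mu(1) subsetD[OF closure_subset w(2)]] w(1) by (simp add: U_def \<beta>_def)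
      ultimately have "c v = 0" by (rule spl_independent[OF n mu(1)])
      thus False using cv by simp
    qed
    thus ?thesis using act unfolding hier_basis_level_def by blast
  qed
  define g where "g = (\<Sum>v\<in>F. fscale (c v) (restr \<Omega> (\<beta> v)))"
  have "g \<in> fun_vs.span (hier_basis n N M)"
    unfolding g_def
  proof (intro fun_vs.span_sum fun_vs.span_scale fun_vs.span_base)
    fix v assume "v \<in> F"
    thus "restr \<Omega> (\<beta> v) \<in> hier_basis n N M" unfolding hier_basis_def region_N using basis l by blast
  qed
  moreover have "h z = g z" if z: "z \<in> region (M l)" for z
  proof -
    have zO: "z \<in> \<Omega>" using z reg by blast
    have "g z = (\<Sum>v\<in>F. fscale (c v) (restr \<Omega> (\<beta> v)) z)"
      unfolding g_def using fin by (induction F rule: finite_induct) auto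
    also have "\<dots> = (\<Sum>v\<in>F. c v * box_spline n (2 ^ (l - 1) *\<^sub>R z - lat v))"
      using zO by (simp add: fscale_def restr_def \<beta>_def)
    also have "\<dots> = lspl n l c z"
      unfolding lspl_def by (rule spl_eq[OF fin _ n, symmetric]) (simp add: F_def)
    finally show ?thesis using c(1)[OF z] by simp
  qed
  ultimately show ?thesis using that by blast
qed

theorem space_subset_span: "space \<subseteq> fun_vs.span (hier_basis n N M)"
proof
  fix f assume f: "f \<in> space"
  have "\<exists>g\<in>fun_vs.span (hier_basis n N M). \<forall>z\<in>region (M l). f z = g z" if "l \<le> N" for l
    using that
  proof (induction l)
    case 0
    show ?case using fun_vs.span_zero region_0 by blast
  next
    case (Suc l)
    then obtain g where g: "g \<in> fun_vs.span (hier_basis n N M)" "\<forall>z\<in>region (M l). f z = g z" by auto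
    have h: "f - g \<in> space" using fun_vs.subspace_diff[OF subspace_space f] g(1) span_basis_subset by blast
    have l: "Suc l \<in> {1..N}" using Suc.prems by simp
    have z: "(f - g) z = 0" if "z \<in> region (M (Suc l - 1))" for z using g(2) that by simp
    obtain g' where g': "g' \<in> fun_vs.span (hier_basis n N M)" "\<And>z. z \<in> region (M (Suc l)) \<Longrightarrow> (f - g) z = g' z"
      using level_step[OF l h z] by metis
    have "f z = (g + g') z" if "z \<in> region (M (Suc l))" for z
      using g'(2)[OF that] by (simp add: algebra_simps)
    thus ?case using fun_vs.span_add[OF g(1) g'(1)] by blast
  qed
  then obtain g where g: "g \<in> fun_vs.span (hier_basis n N M)" "\<forall>z\<in>\<Omega>. f z = g z" using region_N by auto
  have gs: "g \<in> space" using g(1) span_basis_subset by blast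
  have "f z = g z" for z
  proof (cases "z \<in> \<Omega>")
    case True
    thus ?thesis using g(2) by blast
  next
    case False
    thus ?thesis using spaceD(1)[OF f False] spaceD(1)[OF gs False] by simp
  qed
  hence "f = g" by (rule ext)
  thus "f \<in> fun_vs.span (hier_basis n N M)" using g(1) by simp
qed

end

theorem theorem28:
  fixes n d :: "nat ^ 3" and N :: nat
    and M :: "nat \<Rightarrow> point set set" and \<Omega> :: "point set"
  assumes "\<forall>i. n $ i \<ge> 1"
    and "d = vector [n $ 2 + n $ 3 - 2, n $ 1 + n $ 3 - 2, n $ 1 + n $ 2 - 2]"
    and "hierarchical_domain N M \<Omega>"
    and "\<forall>l\<in>{1..N}. admissible n l (M l)"
  shows "fun_vs.span (hier_basis n N M) = spline_space d N M (local_polys n)"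
proof -
  have "d $ i = contact_order n i" for i
    using exhaust_3[of i] by (auto simp: assms(2) contact_order_def)
  then interpret hierarchy n d N M \<Omega>
    using assms by unfold_locales auto
  show ?thesis using span_basis_subset space_subset_span by blast
qed

end
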